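(* Let $n\ge 1$. For $a\in\ell^\infty(\mathbb{Z},\mathbb{Z})$ let $E(a)\to S^{2n}$ be the $\ell^2(\mathbb{Z},\mathbb{C})$-bundle with end given by the completed sum of $\{E(a_i)\}_{i\in\mathbb{Z}}$. (1) If $a,a'\in\ell^\infty(\mathbb{Z},\mathbb{Z})$ differ by only finitely many entries, then $E(a)\cong E(a')$ as Hilbert bundles with ends. (2) If $a=(a_i)\in\ell^\infty(\mathbb{Z},\mathbb{Z})$ satisfies $a_i\neq0$ for only finitely many $i$, then $E(a)$ is trivial as a Hilbert bundle with end.
   Context: $\ell^\infty(\mathbb{Z},\mathbb{Z})$ is the abelian group of bounded integer sequences indexed by $\mathbb{Z}$. For $k\in\mathbb{Z}$, $E(k)\to S^{2n}$ is a fixed (Hermitian) complex vector bundle of rank $2n$ classified by a map $S^{2n}\to BU(2n)$ representing $k\in\mathbb{Z}\cong\pi_{2n}(BU(2n))$, trivialized over a fixed two-set cover of $S^{2n}$ by neighborhoods of the hemispheres. $E(a)$ is the completed sum of $\{E(a_i)\}_{i\in\mathbb{Z}}$: the fiber over $x$ is the Hilbert space completion of $\bigoplus_{i\in\mathbb{Z}}E(a_i)_x$, topologized by the simultaneous trivializations of the $E(a_i)$, with transition function the block diagonal sum of those of the $E(a_i)$; the fiber is identified with $\ell^2(\mathbb{Z},\mathbb{C})$ by sending the $k$-th basis vector ($0\le k<2n$) of the $i$-th summand to the standard basis vector $e_{2ni+k}$. For a unitary operator $U$ on $\ell^2(\mathbb{Z},\mathbb{C})$ with matrix $(U_{ij})$,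 $\mathrm{prop}(U)=\sup\{|i-j| : U_{ij}\neq 0\}$. $\mathcal{U}_L(1)$ is the set of unitary operators with $\mathrm{prop}(U)\le L$, with the operator norm topology, and $\mathcal{U}(1)=\bigcup_L\mathcal{U}_L(1)$ has the inductive limit topology. An $\ell^2(\mathbb{Z},\mathbb{C})$-bundle with end is a locally trivial bundle with fiber isometric to $\ell^2(\mathbb{Z},\mathbb{C})$ whose transition functions are continuous maps into $\mathcal{U}(1)$. Isomorphism and triviality as Hilbert bundles with ends mean isomorphism and triviality as bundles with structure group $\mathcal{U}(1)$. *)

theory Defs
  imports "HOL-Analysis.Analysis" "HOL-Algebra.Elementary_Groups" "HOL-Library.Extended_Nat"
begin

section \<open>The Hilbert space of square summable sequences indexed by the integers\<close>

typedef ell2 = "{f :: int \<Rightarrow> complex. (\<lambda>i. (cmod (f i))\<^sup>2) summable_on UNIV}"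
  morphisms ell2_nth Abs_ell2
  by (rule exI[of _ "\<lambda>_. 0"]) simp

setup_lifting type_definition_ell2

lemma ell2_nth_summable: "(\<lambda>i. (cmod (ell2_nth x i))\<^sup>2) summable_on UNIV"
  using ell2_nth[of x] by simp

lemma ell2_eqI: "(\<And>i. ell2_nth x i = ell2_nth y i) \<Longrightarrow> x = y"
  by (simp add: ell2_nth_inject[symmetric] fun_eq_iff)

lemma ell2_add_closed:
  fixes f g :: "int \<Rightarrow> complex"
  assumes "(\<lambda>i. (cmod (f i))\<^sup>2) summable_on UNIV" "(\<lambda>i. (cmod (g i))\<^sup>2) summable_on UNIV"
  shows "(\<lambda>i. (cmod (f i + g i))\<^sup>2) summable_on UNIV"
proof (rule summable_on_comparison_test)
  show "(\<lambda>i. 2 * (cmod (f i))\<^sup>2 + 2 * (cmod (g i))\<^sup>2) summable_on UNIV"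
    by (intro summable_on_add summable_on_cmult_right assms)
  show "(cmod (f i + g i))\<^sup>2 \<le> 2 * (cmod (f i))\<^sup>2 + 2 * (cmod (g i))\<^sup>2" for i
  proof -
    have "(cmod (f i + g i))\<^sup>2 \<le> (cmod (f i) + cmod (g i))\<^sup>2"
      by (intro power_mono norm_triangle_ineq) simp
    also have "\<dots> \<le> 2 * (cmod (f i))\<^sup>2 + 2 * (cmod (g i))\<^sup>2"
      using sum_squares_bound[of "cmod (f i)" "cmod (g i)"] by (simp add: power2_sum)
    finally show ?thesis .
  qed
qed simp

lemma ell2_scale_closed:
  fixes f :: "int \<Rightarrow> complex"
  assumes "(\<lambda>i. (cmod (f i))\<^sup>2) summable_on UNIV"
  shows "(\<lambda>i. (cmod (c * f i))\<^sup>2) summable_on UNIV"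
  using summable_on_cmult_right[OF assms, of "(cmod c)\<^sup>2"]
  by (simp add: norm_mult power_mult_distrib)

lemma ell2_cinner_summable:
  "(\<lambda>i. cnj (ell2_nth x i) * ell2_nth y i) summable_on UNIV"
proof (rule Infinite_Sum.abs_summable_summable, rule Infinite_Sum.abs_summable_on_comparison_test')
  show "(\<lambda>i. (cmod (ell2_nth x i))\<^sup>2 + (cmod (ell2_nth y i))\<^sup>2) summable_on UNIV"
    by (intro summable_on_add ell2_nth_summable)
  show "norm (cnj (ell2_nth x i) * ell2_nth y i) \<le> (cmod (ell2_nth x i))\<^sup>2 + (cmod (ell2_nth y i))\<^sup>2" for i
  proof -
    have "2 * (cmod (ell2_nth x i) * cmod (ell2_nth y i)) \<le> (cmod (ell2_nth x i))\<^sup>2 + (cmod (ell2_nth y i))\<^sup>2"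
      using sum_squares_bound[of "cmod (ell2_nth x i)" "cmod (ell2_nth y i)"] by simp
    moreover have "0 \<le> cmod (ell2_nth x i) * cmod (ell2_nth y i)" by simp
    ultimately show ?thesis unfolding norm_mult complex_mod_cnj by linarith
  qed
qed

definition cinner_ell2 :: "ell2 \<Rightarrow> ell2 \<Rightarrow> complex" where
  "cinner_ell2 x y = (\<Sum>\<^sub>\<infinity>i. cnj (ell2_nth x i) * ell2_nth y i)"

lift_definition scaleC_ell2 :: "complex \<Rightarrow> ell2 \<Rightarrow> ell2" is "\<lambda>c f i. c * f i"
  by (rule ell2_scale_closed)

lift_definition ell2_basis :: "int \<Rightarrow> ell2" is "\<lambda>j i. if i = j then 1 else 0"
proof -
  fix j :: int
  have "(\<lambda>i. (cmod (if i = j then 1 else 0))\<^sup>2) summable_on UNIV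
        \<longleftrightarrow> (\<lambda>i. (cmod (if i = j then 1 else 0))\<^sup>2) summable_on {j}"
    by (rule summable_on_cong_neutral) auto
  then show "(\<lambda>i. (cmod (if i = j then 1 else 0))\<^sup>2) summable_on UNIV" by simp
qed

instantiation ell2 :: real_inner
begin

lift_definition zero_ell2 :: ell2 is "\<lambda>_. 0" by simp
lift_definition plus_ell2 :: "ell2 \<Rightarrow> ell2 \<Rightarrow> ell2" is "\<lambda>f g i. f i + g i"
  by (rule ell2_add_closed)
lift_definition uminus_ell2 :: "ell2 \<Rightarrow> ell2" is "\<lambda>f i. - f i" by simp
lift_definition minus_ell2 :: "ell2 \<Rightarrow> ell2 \<Rightarrow> ell2" is "\<lambda>f g i. f i - g i"
  subgoal for f g using ell2_add_closed[of f "\<lambda>i. - g i"] by simp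
  done
lift_definition scaleR_ell2 :: "real \<Rightarrow> ell2 \<Rightarrow> ell2" is "\<lambda>r f i. complex_of_real r * f i"
  by (rule ell2_scale_closed)

definition inner_ell2 :: "ell2 \<Rightarrow> ell2 \<Rightarrow> real" where
  "inner_ell2 x y = Re (cinner_ell2 x y)"
definition norm_ell2 :: "ell2 \<Rightarrow> real" where "norm_ell2 x = sqrt (inner x x)"
definition dist_ell2 :: "ell2 \<Rightarrow> ell2 \<Rightarrow> real" where "dist_ell2 x y = norm (x - y)"
definition sgn_ell2 :: "ell2 \<Rightarrow> ell2" where "sgn_ell2 x = inverse (norm x) *\<^sub>R x"
definition uniformity_ell2 :: "(ell2 \<times> ell2) filter" where
  "uniformity_ell2 = (INF e\<in>{0 <..}. principal {(x, y). dist x y < e})"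
definition open_ell2 :: "ell2 set \<Rightarrow> bool" where
  "open_ell2 S = (\<forall>x\<in>S. \<forall>\<^sub>F (x', y) in uniformity. x' = x \<longrightarrow> y \<in> S)"

lemma inner_ell2_alt:
  "inner (x::ell2) y = (\<Sum>\<^sub>\<infinity>i. Re (cnj (ell2_nth x i) * ell2_nth y i))"
  unfolding inner_ell2_def cinner_ell2_def by (rule infsum_Re[OF ell2_cinner_summable, symmetric])

lemma inner_ell2_self: "inner (x::ell2) x = (\<Sum>\<^sub>\<infinity>i. (cmod (ell2_nth x i))\<^sup>2)"
  unfolding inner_ell2_alt by (simp add: cmod_power2 flip: power2_eq_square)

instance
proof
  fix x y z :: ell2 and r s :: real
  show "x + y + z = x + (y + z)" "x + y = y + x" "0 + x = x" "- x + x = 0" "x - y = x + - y"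
    by (transfer; simp add: algebra_simps fun_eq_iff)+
  show "r *\<^sub>R (x + y) = r *\<^sub>R x + r *\<^sub>R y" "(r + s) *\<^sub>R x = r *\<^sub>R x + s *\<^sub>R x"
    "r *\<^sub>R s *\<^sub>R x = (r * s) *\<^sub>R x" "1 *\<^sub>R x = x"
    by (transfer; simp add: algebra_simps fun_eq_iff)+
  show "dist x y = norm (x - y)" by (rule dist_ell2_def)
  show "sgn x = inverse (norm x) *\<^sub>R x" by (rule sgn_ell2_def)
  show "uniformity = (INF e\<in>{0 <..}. principal {(x :: ell2, y). dist x y < e})"
    by (rule uniformity_ell2_def)
  show "open U = (\<forall>x\<in>U. \<forall>\<^sub>F (x', y) in uniformity. x' = x \<longrightarrow> y \<in> U)" for U :: "ell2 set"
    by (rule open_ell2_def)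
  show "norm x = sqrt (inner x x)" by (rule norm_ell2_def)
  show "inner x y = inner y x"
    unfolding inner_ell2_alt by (simp add: mult.commute)
  have S: "(\<lambda>i. Re (cnj (ell2_nth u i) * ell2_nth v i)) summable_on UNIV" for u v
    by (rule summable_on_Re[OF ell2_cinner_summable])
  have "inner (x + y) z = (\<Sum>\<^sub>\<infinity>i. Re (cnj (ell2_nth x i) * ell2_nth z i) + Re (cnj (ell2_nth y i) * ell2_nth z i))"
    unfolding inner_ell2_alt by (simp add: plus_ell2.rep_eq algebra_simps)
  also have "\<dots> = inner x z + inner y z"
    unfolding inner_ell2_alt by (rule infsum_add[OF S S])
  finally show "inner (x + y) z = inner x z + inner y z" .
  have "inner (r *\<^sub>R x) y = (\<Sum>\<^sub>\<infinity>i. r * Re (cnj (ell2_nth x i) * ell2_nth y i))"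
    unfolding inner_ell2_alt by (simp add: scaleR_ell2.rep_eq algebra_simps)
  then show "inner (r *\<^sub>R x) y = r * inner x y"
    unfolding inner_ell2_alt by (simp only: infsum_cmult_right')
  show "0 \<le> inner x x" unfolding inner_ell2_self by (rule infsum_nonneg) simp
  show "inner x x = 0 \<longleftrightarrow> x = 0"
  proof
    assume "inner x x = 0"
    then have "(cmod (ell2_nth x i))\<^sup>2 = 0" for i
      by (intro nonneg_infsum_le_0D[OF _ ell2_nth_summable]) (auto simp: inner_ell2_self)
    then show "x = 0" by (intro ell2_eqI) (simp add: zero_ell2.rep_eq)
  next
    assume "x = 0"
    then show "inner x x = 0" by (simp add: inner_ell2_self zero_ell2.rep_eq)
  qed
qed

end


section \<open>Final topologies\<close>

definition final_topology ::
  "'a set \<Rightarrow> 'i set \<Rightarrow> ('i \<Rightarrow> 'b topology) \<Rightarrow> ('i \<Rightarrow> 'b \<Rightarrow> 'a) \<Rightarrow> 'a topology" where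
  "final_topology S I X f =
     topology (\<lambda>W. W \<subseteq> S \<and> (\<forall>i\<in>I. openin (X i) {x \<in> topspace (X i). f i x \<in> W}))"

lemma openin_final_topology:
  "openin (final_topology S I X f) W \<longleftrightarrow>
     W \<subseteq> S \<and> (\<forall>i\<in>I. openin (X i) {x \<in> topspace (X i). f i x \<in> W})"
proof -
  have "istopology (\<lambda>W. W \<subseteq> S \<and> (\<forall>i\<in>I. openin (X i) {x \<in> topspace (X i). f i x \<in> W}))"
    unfolding istopology_def
  proof (intro conjI allI impI ballI)
    fix A B i
    assume "A \<subseteq> S \<and> (\<forall>i\<in>I. openin (X i) {x \<in> topspace (X i). f i x \<in> A})"
      and "B \<subseteq> S \<and> (\<forall>i\<in>I. openin (X i) {x \<in> topspace (X i). f i x \<in> B})" and "i \<in> I"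
    then have "openin (X i) ({x \<in> topspace (X i). f i x \<in> A} \<inter> {x \<in> topspace (X i). f i x \<in> B})"
      by blast
    then show "openin (X i) {x \<in> topspace (X i). f i x \<in> A \<inter> B}"
      by (rule back_subst[of "openin (X i)"]) auto
  next
    fix \<K> i
    assume "\<forall>K\<in>\<K>. K \<subseteq> S \<and> (\<forall>i\<in>I. openin (X i) {x \<in> topspace (X i). f i x \<in> K})" and "i \<in> I"
    then have "openin (X i) (\<Union>K\<in>\<K>. {x \<in> topspace (X i). f i x \<in> K})"
      by blast
    then show "openin (X i) {x \<in> topspace (X i). f i x \<in> \<Union> \<K>}"
      by (rule back_subst[of "openin (X i)"]) auto
  qed blast+
  then show ?thesis by (simp add: final_topology_def topology_inverse')
qed

text \<open>Inductive limit of an increasing sequence of sets carrying their subspace topologies.\<close>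

definition inductive_limit :: "(nat \<Rightarrow> 'a::topological_space set) \<Rightarrow> 'a topology" where
  "inductive_limit A = final_topology (\<Union>L. A L) UNIV (\<lambda>L. top_of_set (A L)) (\<lambda>_ x. x)"


section \<open>Unitary operators of finite propagation\<close>

definition unitary_ell2 :: "(ell2 \<Rightarrow>\<^sub>L ell2) \<Rightarrow> bool" where
  "unitary_ell2 U \<longleftrightarrow>
     (\<forall>c x. blinfun_apply U (scaleC_ell2 c x) = scaleC_ell2 c (blinfun_apply U x)) \<and>
     surj (blinfun_apply U) \<and>
     (\<forall>x y. cinner_ell2 (blinfun_apply U x) (blinfun_apply U y) = cinner_ell2 x y)"

definition op_entry :: "(ell2 \<Rightarrow>\<^sub>L ell2) \<Rightarrow> int \<Rightarrow> int \<Rightarrow> complex" where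
  "op_entry U i j = ell2_nth (blinfun_apply U (ell2_basis j)) i"

definition propagation :: "(ell2 \<Rightarrow>\<^sub>L ell2) \<Rightarrow> enat" where
  "propagation U = (SUP (i, j) \<in> {(i, j). op_entry U i j \<noteq> 0}. enat (nat \<bar>i - j\<bar>))"

definition finite_prop_unitaries :: "nat \<Rightarrow> (ell2 \<Rightarrow>\<^sub>L ell2) set" where
  "finite_prop_unitaries L = {U. unitary_ell2 U \<and> propagation U \<le> enat L}"

text \<open>The metric topology of the type \<open>ell2 \<Rightarrow>\<^sub>L ell2\<close> is the operator norm topology.\<close>

definition end_unitary_group :: "(ell2 \<Rightarrow>\<^sub>L ell2) topology" where
  "end_unitary_group = inductive_limit finite_prop_unitaries"


section \<open>Fibre bundles with structure group\<close>

text \<open>The atlas is indexed by the whole type \<open>'c\<close>; the chart with index \<open>c\<close> is the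
  homeomorphism \<open>chart \<xi> c\<close> from \<open>chart_dom \<xi> c \<times> F\<close> onto the part of the total space over
  \<open>chart_dom \<xi> c\<close>.\<close>

record ('c, 'b, 'e, 'f) gbundle =
  total :: "'e topology"
  base_proj :: "'e \<Rightarrow> 'b"
  chart_dom :: "'c \<Rightarrow> 'b set"
  chart :: "'c \<Rightarrow> 'b \<times> 'f \<Rightarrow> 'e"

text \<open>\<open>G\<close> is the structure group as a topological space, acting on the fibre \<open>F\<close> by \<open>act\<close>.\<close>

definition fibre_bundle ::
  "'b topology \<Rightarrow> 'f topology \<Rightarrow> 'g topology \<Rightarrow> ('g \<Rightarrow> 'f \<Rightarrow> 'f) \<Rightarrow> ('c, 'b, 'e, 'f) gbundle \<Rightarrow> bool" where
  "fibre_bundle B F G act \<xi> \<longleftrightarrow>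
     continuous_map (total \<xi>) B (base_proj \<xi>) \<and>
     (\<forall>c. openin B (chart_dom \<xi> c)) \<and>
     (\<Union>c. chart_dom \<xi> c) = topspace B \<and>
     (\<forall>c. homeomorphic_map (prod_topology (subtopology B (chart_dom \<xi> c)) F)
            (subtopology (total \<xi>) {e \<in> topspace (total \<xi>). base_proj \<xi> e \<in> chart_dom \<xi> c})
            (chart \<xi> c)) \<and>
     (\<forall>c. \<forall>x\<in>chart_dom \<xi> c. \<forall>v\<in>topspace F. base_proj \<xi> (chart \<xi> c (x, v)) = x) \<and>
     (\<forall>c d. \<exists>g. continuous_map (subtopology B (chart_dom \<xi> c \<inter> chart_dom \<xi> d)) G g \<and>
        (\<forall>x\<in>chart_dom \<xi> c \<inter> chart_dom \<xi> d. \<forall>v\<in>topspace F.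
           chart \<xi> c (x, v) = chart \<xi> d (x, act (g x) v)))"

definition bundle_iso ::
  "'b topology \<Rightarrow> 'f topology \<Rightarrow> 'g topology \<Rightarrow> ('g \<Rightarrow> 'f \<Rightarrow> 'f) \<Rightarrow>
   ('c, 'b, 'e, 'f) gbundle \<Rightarrow> ('d, 'b, 't, 'f) gbundle \<Rightarrow> bool" where
  "bundle_iso B F G act \<xi> \<eta> \<longleftrightarrow>
     fibre_bundle B F G act \<xi> \<and> fibre_bundle B F G act \<eta> \<and>
     (\<exists>h. homeomorphic_map (total \<xi>) (total \<eta>) h \<and>
        (\<forall>e\<in>topspace (total \<xi>). base_proj \<eta> (h e) = base_proj \<xi> e) \<and>
        (\<forall>c d. \<exists>g. continuous_map (subtopology B (chart_dom \<xi> c \<inter> chart_dom \<eta> d)) G g \<and>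
           (\<forall>x\<in>chart_dom \<xi> c \<inter> chart_dom \<eta> d. \<forall>v\<in>topspace F.
              h (chart \<xi> c (x, v)) = chart \<eta> d (x, act (g x) v))))"

definition product_bundle :: "'b topology \<Rightarrow> 'f topology \<Rightarrow> (unit, 'b, 'b \<times> 'f, 'f) gbundle" where
  "product_bundle B F =
     \<lparr>total = prod_topology B F, base_proj = fst, chart_dom = (\<lambda>_. topspace B), chart = (\<lambda>_ p. p)\<rparr>"

abbreviation bundle_with_end :: "'b topology \<Rightarrow> ('c, 'b, 'e, ell2) gbundle \<Rightarrow> bool" where
  "bundle_with_end B \<xi> \<equiv> fibre_bundle B euclidean end_unitary_group blinfun_apply \<xi>"

abbreviation end_bundle_iso ::
  "'b topology \<Rightarrow> ('c, 'b, 'e, ell2) gbundle \<Rightarrow> ('d, 'b, 't, ell2) gbundle \<Rightarrow> bool" where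
  "end_bundle_iso B \<xi> \<eta> \<equiv> bundle_iso B euclidean end_unitary_group blinfun_apply \<xi> \<eta>"

definition end_bundle_trivial :: "'b topology \<Rightarrow> ('c, 'b, 'e, ell2) gbundle \<Rightarrow> bool" where
  "end_bundle_trivial B \<xi> \<longleftrightarrow> end_bundle_iso B \<xi> (product_bundle B euclidean)"


section \<open>Hermitian vector bundles of finite rank\<close>

text \<open>\<open>\<complex>\<^sup>m\<close> consists of the sequences vanishing from index \<open>m\<close> on, matrices likewise; both carry
  the (product) topology of their ambient function types.\<close>

definition cspace :: "nat \<Rightarrow> (nat \<Rightarrow> complex) set" where
  "cspace m = {z. \<forall>k\<ge>m. z k = 0}"

definition unitary_matrices :: "nat \<Rightarrow> (nat \<Rightarrow> nat \<Rightarrow> complex) set" where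
  "unitary_matrices m = {A. (\<forall>i j. i \<ge> m \<or> j \<ge> m \<longrightarrow> A i j = 0) \<and>
     (\<forall>i<m. \<forall>j<m. (\<Sum>k<m. cnj (A k i) * A k j) = (if i = j then 1 else 0))}"

definition matrix_act :: "nat \<Rightarrow> (nat \<Rightarrow> nat \<Rightarrow> complex) \<Rightarrow> (nat \<Rightarrow> complex) \<Rightarrow> (nat \<Rightarrow> complex)" where
  "matrix_act m A z = (\<lambda>i. \<Sum>j<m. A i j * z j)"

abbreviation hermitian_bundle ::
  "nat \<Rightarrow> 'b topology \<Rightarrow> ('c, 'b, 'e, nat \<Rightarrow> complex) gbundle \<Rightarrow> bool" where
  "hermitian_bundle m B \<xi> \<equiv>
     fibre_bundle B (top_of_set (cspace m)) (top_of_set (unitary_matrices m)) (matrix_act m) \<xi>"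


section \<open>The classifying space and the tautological bundle\<close>

definition cspace_infinity :: "(nat \<Rightarrow> complex) topology" where
  "cspace_infinity = inductive_limit cspace"

text \<open>Orthonormal \<open>m\<close>-frames in \<open>\<complex>\<^sup>N\<close>; \<open>v j\<close> is the \<open>j\<close>-th vector of the frame.\<close>

definition stiefel :: "nat \<Rightarrow> nat \<Rightarrow> (nat \<Rightarrow> nat \<Rightarrow> complex) set" where
  "stiefel m N = {v. (\<forall>j\<ge>m. v j = (\<lambda>_. 0)) \<and> (\<forall>j<m. v j \<in> cspace N) \<and>
     (\<forall>i<m. \<forall>j<m. (\<Sum>k<N. cnj (v i k) * v j k) = (if i = j then 1 else 0))}"

definition frame_comb :: "nat \<Rightarrow> (nat \<Rightarrow> nat \<Rightarrow> complex) \<Rightarrow> (nat \<Rightarrow> complex) \<Rightarrow> (nat \<Rightarrow> complex)" where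
  "frame_comb m v z = (\<lambda>k. \<Sum>j<m. z j * v j k)"

definition frame_span :: "nat \<Rightarrow> (nat \<Rightarrow> nat \<Rightarrow> complex) \<Rightarrow> (nat \<Rightarrow> complex) set" where
  "frame_span m v = frame_comb m v ` cspace m"

text \<open>\<open>BU(m)\<close> is the Grassmannian of \<open>m\<close>-dimensional subspaces of \<open>\<complex>\<^sup>\<infinity>\<close>, the colimit over \<open>N\<close> of
  the Grassmannians of \<open>\<complex>\<^sup>N\<close>, each of which is a quotient of the space of orthonormal frames.\<close>

definition BU :: "nat \<Rightarrow> (nat \<Rightarrow> complex) set topology" where
  "BU m = final_topology (\<Union>N. frame_span m ` stiefel m N) UNIV
            (\<lambda>N. top_of_set (stiefel m N)) (\<lambda>_. frame_span m)"

text \<open>An isomorphism of \<open>\<xi>\<close> with the pullback along \<open>f\<close> of the tautological bundle, whose fibre over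
  \<open>V\<close> is the subspace \<open>V\<close> of \<open>\<complex>\<^sup>\<infinity>\<close>, is a continuous map from the total space of \<open>\<xi>\<close> to \<open>\<complex>\<^sup>\<infinity>\<close>
  that maps the fibre over every \<open>x\<close> by a linear isometry onto \<open>f x\<close>.  Linear isometries from
  \<open>\<complex>\<^sup>m\<close> to \<open>\<complex>\<^sup>\<infinity>\<close> are given by orthonormal frames.\<close>

definition classified_by ::
  "nat \<Rightarrow> 'b topology \<Rightarrow> ('c, 'b, 'e, nat \<Rightarrow> complex) gbundle \<Rightarrow> ('b \<Rightarrow> (nat \<Rightarrow> complex) set) \<Rightarrow> bool" where
  "classified_by m B \<xi> f \<longleftrightarrow>
     continuous_map B (BU m) f \<and>
     (\<exists>h. continuous_map (total \<xi>) cspace_infinity h \<and>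
        (\<forall>c. \<forall>x\<in>chart_dom \<xi> c. \<exists>N. \<exists>v\<in>stiefel m N.
           f x = frame_span m v \<and> (\<forall>z\<in>cspace m. h (chart \<xi> c (x, z)) = frame_comb m v z)))"


section \<open>Homotopy groups\<close>

definition cube :: "nat \<Rightarrow> (nat \<Rightarrow> real) topology" where
  "cube m = subtopology (Euclidean_space m) {x. \<forall>i<m. 0 \<le> x i \<and> x i \<le> 1}"

definition cube_boundary :: "nat \<Rightarrow> (nat \<Rightarrow> real) set" where
  "cube_boundary m = {x \<in> topspace (cube m). \<exists>i<m. x i = 0 \<or> x i = 1}"

definition spheroid :: "nat \<Rightarrow> 'a topology \<Rightarrow> 'a \<Rightarrow> ((nat \<Rightarrow> real) \<Rightarrow> 'a) \<Rightarrow> bool" where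
  "spheroid m X x0 f \<longleftrightarrow> continuous_map (cube m) X f \<and> (\<forall>x\<in>cube_boundary m. f x = x0)"

definition spheroid_class ::
  "nat \<Rightarrow> 'a topology \<Rightarrow> 'a \<Rightarrow> ((nat \<Rightarrow> real) \<Rightarrow> 'a) \<Rightarrow> ((nat \<Rightarrow> real) \<Rightarrow> 'a) set" where
  "spheroid_class m X x0 f =
     {g. homotopic_with (\<lambda>h. \<forall>x\<in>cube_boundary m. h x = x0) (cube m) X f g}"

definition spheroid_join ::
  "((nat \<Rightarrow> real) \<Rightarrow> 'a) \<Rightarrow> ((nat \<Rightarrow> real) \<Rightarrow> 'a) \<Rightarrow> (nat \<Rightarrow> real) \<Rightarrow> 'a" where
  "spheroid_join f g = (\<lambda>x. if x 0 \<le> 1/2 then f (x(0 := 2 * x 0)) else g (x(0 := 2 * x 0 - 1)))"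

text \<open>Meaningful for \<open>m \<ge> 1\<close>.\<close>

definition homotopy_group :: "nat \<Rightarrow> 'a topology \<Rightarrow> 'a \<Rightarrow> ((nat \<Rightarrow> real) \<Rightarrow> 'a) set monoid" where
  "homotopy_group m X x0 =
     \<lparr>carrier = spheroid_class m X x0 ` {f. spheroid m X x0 f},
      mult = (\<lambda>C D. \<Union>f\<in>C. \<Union>g\<in>D. spheroid_class m X x0 (spheroid_join f g)),
      one = spheroid_class m X x0 (\<lambda>_. x0)\<rparr>"

text \<open>A map \<open>q\<close> identifying the quotient of the cube by its boundary with the sphere, the boundary
  going to \<open>s0\<close>; a map \<open>f\<close> on the sphere then represents the class of \<open>f \<circ> q\<close>.\<close>

definition cube_collapse :: "nat \<Rightarrow> (nat \<Rightarrow> real) \<Rightarrow> ((nat \<Rightarrow> real) \<Rightarrow> (nat \<Rightarrow> real)) \<Rightarrow> bool" where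
  "cube_collapse m s0 q \<longleftrightarrow>
     continuous_map (cube m) (nsphere m) q \<and> q ` cube_boundary m = {s0} \<and>
     bij_betw q (topspace (cube m) - cube_boundary m) (topspace (nsphere m) - {s0})"


section \<open>Completed sums of bundles on an even sphere\<close>

definition bounded_int_seqs :: "(int \<Rightarrow> int) set" where
  "bounded_int_seqs = {a. \<exists>C. \<forall>i. \<bar>a i\<bar> \<le> C}"

datatype hemisphere = Upper | Lower

fun hemisphere_set :: "nat \<Rightarrow> hemisphere \<Rightarrow> (nat \<Rightarrow> real) set" where
  "hemisphere_set m Upper = {x \<in> topspace (nsphere m). x m \<ge> 0}"
| "hemisphere_set m Lower = {x \<in> topspace (nsphere m). x m \<le> 0}"

text \<open>The \<open>i\<close>-th block of length \<open>m\<close>, so that the \<open>k\<close>-th basis vector of the \<open>i\<close>-th summand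
  corresponds to \<open>ell2_basis (m * i + k)\<close>.\<close>

definition ell2_block :: "nat \<Rightarrow> ell2 \<Rightarrow> int \<Rightarrow> (nat \<Rightarrow> complex)" where
  "ell2_block m w i = (\<lambda>k. if k < m then ell2_nth w (int m * i + int k) else 0)"

text \<open>The Hilbert space completion of \<open>\<Oplus>\<^sub>i E(a\<^sub>i)\<^sub>x\<close>, as the families \<open>(v\<^sub>i)\<close> with \<open>v\<^sub>i\<close> in the fibre
  of \<open>E(a\<^sub>i)\<close> over \<open>x\<close> and square summable norms.  The norms are those of the coordinates in any
  of the charts, which differ by unitary matrices.\<close>

definition completed_sum_fibre ::
  "nat \<Rightarrow> (int \<Rightarrow> (hemisphere, 'b, 'e, nat \<Rightarrow> complex) gbundle) \<Rightarrow> (int \<Rightarrow> int) \<Rightarrow> 'b \<Rightarrow> (int \<Rightarrow> 'e) set" where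
  "completed_sum_fibre m E a x =
     {v. \<exists>c z. (\<forall>i. x \<in> chart_dom (E (a i)) c \<and> z i \<in> cspace m \<and> v i = chart (E (a i)) c (x, z i)) \<and>
           (\<lambda>i. \<Sum>k<m. (cmod (z i k))\<^sup>2) summable_on UNIV}"

definition completed_sum_chart ::
  "nat \<Rightarrow> (int \<Rightarrow> (hemisphere, 'b, 'e, nat \<Rightarrow> complex) gbundle) \<Rightarrow> (int \<Rightarrow> int) \<Rightarrow>
   hemisphere \<Rightarrow> 'b \<times> ell2 \<Rightarrow> (int \<Rightarrow> 'e)" where
  "completed_sum_chart m E a c = (\<lambda>(x, w) i. chart (E (a i)) c (x, ell2_block m w i))"

text \<open>All \<open>E k\<close> are assumed to be trivialized over the same cover \<open>N\<close> of \<open>B\<close>.  The topology is the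
  one glued from the simultaneous trivializations.\<close>

definition completed_sum ::
  "nat \<Rightarrow> 'b topology \<Rightarrow> (hemisphere \<Rightarrow> 'b set) \<Rightarrow>
   (int \<Rightarrow> (hemisphere, 'b, 'e, nat \<Rightarrow> complex) gbundle) \<Rightarrow> (int \<Rightarrow> int) \<Rightarrow>
   (hemisphere, 'b, int \<Rightarrow> 'e, ell2) gbundle" where
  "completed_sum m B N E a =
     \<lparr>total = final_topology (\<Union>x\<in>topspace B. completed_sum_fibre m E a x) UNIV
                (\<lambda>c. prod_topology (subtopology B (N c)) euclidean) (completed_sum_chart m E a),
      base_proj = (\<lambda>v. base_proj (E (a 0)) (v 0)),
      chart_dom = N,
      chart = completed_sum_chart m E a\<rparr>"

end

theory Submission
  imports Defs
begin

text \<open>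
  Two facts carry the proof.  The first is stable homotopy theory in its simplest form: the direct sum of
  \<open>E p\<close> and \<open>E p2\<close> depends, up to a unitary isomorphism of bundles of rank \<open>4 n\<close>, only on \<open>p + p2\<close>, and
  \<open>E 0\<close> is trivial (\<open>pair_isometries\<close>, \<open>zero_isometries\<close>).  The second is a swindle that pushes a finite
  change of the sequence off to infinity (\<open>swindle\<close>).  If \<open>D i\<close> is the sum of the differences \<open>a' j - a j\<close>
  over \<open>j \<le> i\<close>, then adding \<open>D i\<close> to the entry at \<open>i\<close> and subtracting it from the next one, first for all
  even and then for all odd \<open>i\<close>, turns \<open>a\<close> into \<open>a'\<close>.  Each of the two steps preserves the sums of
  the pairs that it changes.  So it is realized by an operator whose blocks are isometries of sums of two
  neighbouring summands.  The operator has propagation at most \<open>4 n\<close>, and as the sequences, and \<open>D\<close>, are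
  bounded, only finitely many different isometries occur as blocks, which makes it depend continuously, in
  the operator norm, on the point of the sphere.  A sequence of finite support is compared in this way with the
  zero sequence, all of whose summands are trivialized by the same isometry.

  For the first fact, points of the classifying space are turned into projections of rank \<open>2 n\<close> on one Hilbert
  space, and the classifying map of \<open>E p\<close> is pulled back to the cube, where it is a spheroid \<open>F\<close> of class
  \<open>\<iota> p\<close>.  Homotopies of families of projections over a compact space lift to orthonormal frames, and the frame
  does not change at the points where the homotopy is constant (\<open>frame_on_homotopy\<close>).  Hence families that are
  homotopic relative to the boundary of the cube have frames that agree on the boundary, and these define
  an isometry of the bundles on the sphere (\<open>isometries_from_frames_match\<close>).  The homotopy comes from the
  argument of Eckmann and Hilton: squeezing \<open>F\<close> into the left and \<open>G\<close> into the right half of the cube, and then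
  rotating the two summands into each other over the right half only, deforms the sum of \<open>F\<close> and \<open>G\<close> into the sum
  of \<open>spheroid_join F G\<close> and a constant (\<open>frames_match_join\<close>).  Since \<open>\<iota>\<close> is a homomorphism, the class of the join is
  \<open>\<iota> (p + p2)\<close>.
\<close>


section \<open>The complex inner product on square summable sequences\<close>

interpretation scal: vector_space scaleC_ell2
  by standard (rule ell2_eqI, simp add: scaleC_ell2.rep_eq plus_ell2.rep_eq algebra_simps)+

lemma scaleR_conv_scaleC: "r *\<^sub>R (x::ell2) = scaleC_ell2 (of_real r) x"
  by (rule ell2_eqI) (simp add: scaleC_ell2.rep_eq scaleR_ell2.rep_eq)

lemma cinner_add_right: "cinner_ell2 x (y + z) = cinner_ell2 x y + cinner_ell2 x z"
  unfolding cinner_ell2_def plus_ell2.rep_eq distrib_left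
  by (rule infsum_add[OF ell2_cinner_summable ell2_cinner_summable])

lemma cinner_scaleC_right [simp]: "cinner_ell2 x (scaleC_ell2 c y) = c * cinner_ell2 x y"
  unfolding cinner_ell2_def scaleC_ell2.rep_eq
  by (simp add: mult.left_commute infsum_cmult_right')

lemma cnj_cinner: "cnj (cinner_ell2 x y) = cinner_ell2 y x"
  unfolding cinner_ell2_def by (simp flip: infsum_cnj add: mult.commute)

lemma cinner_add_left: "cinner_ell2 (x + y) z = cinner_ell2 x z + cinner_ell2 y z"
  by (metis cinner_add_right cnj_cinner complex_cnj_add)

lemma cinner_scaleC_left [simp]: "cinner_ell2 (scaleC_ell2 c x) y = cnj c * cinner_ell2 x y"
  by (metis cinner_scaleC_right cnj_cinner complex_cnj_mult)

lemma Re_cinner: "Re (cinner_ell2 x y) = inner x y"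
  by (simp add: inner_ell2_def)

lemma cinner_self: "cinner_ell2 x x = of_real ((norm x)\<^sup>2)"
proof (rule complex_eqI)
  show "Im (cinner_ell2 x x) = Im (of_real ((norm x)\<^sup>2))"
    using arg_cong[OF cnj_cinner[of x x], of Im] by simp
qed (simp add: Re_cinner power2_norm_eq_inner)

lemma norm_scaleC_ell2: "norm (scaleC_ell2 c x) = cmod c * norm x"
proof -
  have "complex_of_real ((norm (scaleC_ell2 c x))\<^sup>2) = (c * cnj c) * of_real ((norm x)\<^sup>2)"
    unfolding cinner_self[symmetric] by simp
  also have "\<dots> = of_real ((cmod c * norm x)\<^sup>2)"
    unfolding complex_norm_square[symmetric] by (simp add: power_mult_distrib)
  finally have "complex_of_real ((norm (scaleC_ell2 c x))\<^sup>2) = of_real ((cmod c * norm x)\<^sup>2)" .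
  then have "(norm (scaleC_ell2 c x))\<^sup>2 = (cmod c * norm x)\<^sup>2"
    by (simp only: of_real_eq_iff)
  then show ?thesis by simp
qed

text \<open>The real Cauchy--Schwarz inequality, applied after turning \<open>y\<close> by the phase of the inner product.\<close>

lemma cmod_cinner_le: "cmod (cinner_ell2 x y) \<le> norm x * norm y"
proof (cases "cinner_ell2 x y = 0")
  case False
  define c where "c = cinner_ell2 x y"
  have c: "cmod c \<noteq> 0" using False by (simp add: c_def)
  have "cnj c * c = of_real ((cmod c)\<^sup>2)"
    using complex_norm_square[of c] by (simp add: mult.commute)
  then have "inner x (scaleC_ell2 (cnj c) y) = (cmod c)\<^sup>2"
    by (simp flip: Re_cinner add: c_def[symmetric])
  moreover have "inner x (scaleC_ell2 (cnj c) y) \<le> norm x * (cmod c * norm y)"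
    using norm_cauchy_schwarz[of x "scaleC_ell2 (cnj c) y"] by (simp add: norm_scaleC_ell2)
  ultimately have "cmod c * cmod c \<le> cmod c * (norm x * norm y)"
    by (simp add: power2_eq_square mult_ac)
  then show ?thesis using c unfolding c_def by (simp add: mult_le_cancel_left)
qed simp

interpretation cin: bounded_bilinear cinner_ell2
proof (rule bounded_bilinear.intro)
  show "\<exists>K. \<forall>a b. norm (cinner_ell2 a b) \<le> norm a * norm b * K"
    using cmod_cinner_le by (intro exI[of _ 1]) auto
qed (simp_all add: cinner_add_left cinner_add_right scaleR_conv_scaleC scaleR_conv_of_real)

interpretation scl: bounded_bilinear scaleC_ell2
proof (rule bounded_bilinear.intro)
  show "\<exists>K. \<forall>a b. norm (scaleC_ell2 a b) \<le> norm a * norm b * K"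
    by (intro exI[of _ 1]) (simp add: norm_scaleC_ell2)
qed (simp_all add: scal.scale_left_distrib scal.scale_right_distrib scaleR_conv_scaleC
        scaleR_conv_of_real mult.commute)

lemma ell2_eq_by_cinner: "(\<And>y. cinner_ell2 x y = cinner_ell2 x' y) \<Longrightarrow> x = x'"
proof -
  assume *: "\<And>y. cinner_ell2 x y = cinner_ell2 x' y"
  have "cinner_ell2 (x - x') (x - x') = 0"
    unfolding cin.diff_left by (simp add: *)
  then show ?thesis by (simp add: cinner_self)
qed

lemma cinner_basis_left [simp]: "cinner_ell2 (ell2_basis j) x = ell2_nth x j"
proof -
  have "cinner_ell2 (ell2_basis j) x = (\<Sum>\<^sub>\<infinity>i\<in>{j}. cnj (ell2_nth (ell2_basis j) i) * ell2_nth x i)"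
    unfolding cinner_ell2_def by (rule infsum_cong_neutral) (auto simp: ell2_basis.rep_eq)
  then show ?thesis by (simp add: ell2_basis.rep_eq)
qed

lemma cinner_basis_right [simp]: "cinner_ell2 x (ell2_basis j) = cnj (ell2_nth x j)"
  by (metis cinner_basis_left cnj_cinner)

lemma ell2_nth_basis [simp]: "ell2_nth (ell2_basis j) i = (if i = j then 1 else 0)"
  by (simp add: ell2_basis.rep_eq)

lemma ell2_nth_sum: "ell2_nth (sum f A) i = (\<Sum>a\<in>A. ell2_nth (f a) i)"
  by (induction A rule: infinite_finite_induct) (simp_all add: zero_ell2.rep_eq plus_ell2.rep_eq)


section \<open>Orthonormal frames and their projections\<close>

lift_definition outer :: "ell2 \<Rightarrow> ell2 \<Rightarrow> (ell2 \<Rightarrow>\<^sub>L ell2)" is "\<lambda>u w y. scaleC_ell2 (cinner_ell2 w y) u"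
  by (rule bounded_linear_compose[OF scl.bounded_linear_left cin.bounded_linear_right])

interpretation outer: bounded_bilinear outer
proof (rule bounded_bilinear.intro)
  have "norm (outer u w) \<le> norm u * norm w" for u w
  proof (rule norm_blinfun_bound)
    show "norm (blinfun_apply (outer u w) y) \<le> norm u * norm w * norm y" for y
      using mult_right_mono[OF cmod_cinner_le[of w y], of "norm u"]
      by (simp add: outer.rep_eq norm_scaleC_ell2 mult_ac)
  qed simp
  then show "\<exists>K. \<forall>a b. norm (outer a b) \<le> norm a * norm b * K"
    by (intro exI[of _ 1]) auto
qed (rule blinfun_eqI, simp add: outer.rep_eq blinfun.add_left scal.scale_left_distrib scal.scale_right_distrib
        cinner_add_left scaleR_conv_scaleC blinfun.scaleR_left mult_ac)+

definition orthonormal :: "nat \<Rightarrow> (nat \<Rightarrow> ell2) \<Rightarrow> bool" where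
  "orthonormal r v \<longleftrightarrow> (\<forall>i<r. \<forall>j<r. cinner_ell2 (v i) (v j) = (if i = j then 1 else 0))"

definition proj :: "nat \<Rightarrow> (nat \<Rightarrow> ell2) \<Rightarrow> (ell2 \<Rightarrow>\<^sub>L ell2)" where
  "proj r v = (\<Sum>j<r. outer (v j) (v j))"

definition is_rank_proj :: "nat \<Rightarrow> (ell2 \<Rightarrow>\<^sub>L ell2) \<Rightarrow> bool" where
  "is_rank_proj r P \<longleftrightarrow> (\<exists>v. orthonormal r v \<and> P = proj r v)"

lemma proj_apply: "blinfun_apply (proj r v) y = (\<Sum>j<r. scaleC_ell2 (cinner_ell2 (v j) y) (v j))"
  by (simp add: proj_def blinfun.sum_left outer.rep_eq)

lemma proj_cong: "(\<And>j. j < r \<Longrightarrow> v j = w j) \<Longrightarrow> proj r v = proj r w"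
  by (simp add: proj_def)

lemma orthonormal_cong: "(\<And>j. j < r \<Longrightarrow> v j = w j) \<Longrightarrow> orthonormal r v = orthonormal r w"
  by (simp add: orthonormal_def)

lemma orthonormal_D: "orthonormal r v \<Longrightarrow> i < r \<Longrightarrow> j < r \<Longrightarrow> cinner_ell2 (v i) (v j) = (if i = j then 1 else 0)"
  by (simp add: orthonormal_def)

lemma orthonormal_coeff:
  assumes "orthonormal r v" "i < r"
  shows "cinner_ell2 (v i) (\<Sum>j<r. scaleC_ell2 (c j) (v j)) = c i"
proof -
  have "cinner_ell2 (v i) (\<Sum>j<r. scaleC_ell2 (c j) (v j)) = (\<Sum>j<r. c j * cinner_ell2 (v i) (v j))"
    by (simp add: cin.sum_right)
  also have "\<dots> = (\<Sum>j<r. if j = i then c i else 0)"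
    using assms by (intro sum.cong) (auto simp: orthonormal_def)
  finally show ?thesis using assms by simp
qed

lemma proj_comb:
  "orthonormal r v \<Longrightarrow> blinfun_apply (proj r v) (\<Sum>j<r. scaleC_ell2 (c j) (v j)) = (\<Sum>j<r. scaleC_ell2 (c j) (v j))"
  unfolding proj_apply by (intro sum.cong refl) (simp add: orthonormal_coeff)

lemma proj_idem: "orthonormal r v \<Longrightarrow> blinfun_apply (proj r v) (blinfun_apply (proj r v) y) = blinfun_apply (proj r v) y"
  unfolding proj_apply[of r v y] by (rule proj_comb)

lemma proj_frame: 
  assumes "orthonormal r v" "i < r" shows "blinfun_apply (proj r v) (v i) = v i"
proof -
  have "blinfun_apply (proj r v) (v i) = (\<Sum>j<r. if j = i then v i else 0)"
    unfolding proj_apply using assms by (intro sum.cong) (auto simp: orthonormal_def)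
  then show ?thesis using assms by simp
qed

lemma proj_selfadjoint: "cinner_ell2 (blinfun_apply (proj r v) x) y = cinner_ell2 x (blinfun_apply (proj r v) y)"
  unfolding proj_apply cin.sum_left cin.sum_right 
  by (intro sum.cong refl) (simp add: cnj_cinner mult.commute)

lemma proj_scaleC: "blinfun_apply (proj r v) (scaleC_ell2 c y) = scaleC_ell2 c (blinfun_apply (proj r v) y)"
  by (simp add: proj_apply scal.scale_sum_right)

text \<open>Pythagoras: the defect in the Bessel inequality measures the distance to the span of the frame.\<close>

lemma proj_defect:
  assumes "orthonormal r v"
  shows "(norm (y - blinfun_apply (proj r v) y))\<^sup>2 = (norm y)\<^sup>2 - (\<Sum>j<r. (cmod (cinner_ell2 (v j) y))\<^sup>2)"
proof -
  let ?P = "blinfun_apply (proj r v)"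
  have 1: "cinner_ell2 y (?P y) = of_real (\<Sum>j<r. (cmod (cinner_ell2 (v j) y))\<^sup>2)"
    unfolding proj_apply cin.sum_right of_real_sum
    by (intro sum.cong refl) (simp add: cnj_cinner[symmetric, of y] complex_norm_square flip: of_real_power)
  have 2: "cinner_ell2 (?P y) y = cinner_ell2 y (?P y)" by (rule proj_selfadjoint)
  have 3: "cinner_ell2 (?P y) (?P y) = cinner_ell2 y (?P y)"
    by (simp add: proj_selfadjoint proj_idem[OF assms])
  have "complex_of_real ((norm (y - ?P y))\<^sup>2) = cinner_ell2 y y - cinner_ell2 y (?P y)"
    unfolding cinner_self[symmetric] cin.diff_left cin.diff_right using 2 3 by simp
  then have "complex_of_real ((norm (y - ?P y))\<^sup>2) = of_real ((norm y)\<^sup>2 - (\<Sum>j<r. (cmod (cinner_ell2 (v j) y))\<^sup>2))"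
    unfolding 1 cinner_self by simp
  then show ?thesis by (simp only: of_real_eq_iff)
qed

lemma bessel: "orthonormal r v \<Longrightarrow> (\<Sum>j<r. (cmod (cinner_ell2 (v j) y))\<^sup>2) \<le> (norm y)\<^sup>2"
  using proj_defect[of r v y] zero_le_power2[of "norm (y - blinfun_apply (proj r v) y)"] by linarith

lemma proj_fixes_iff:
  "orthonormal r v \<Longrightarrow> blinfun_apply (proj r v) y = y \<longleftrightarrow> (\<Sum>j<r. (cmod (cinner_ell2 (v j) y))\<^sup>2) = (norm y)\<^sup>2"
  using proj_defect[of r v y] by fastforce

lemma orthonormal_norm: "orthonormal r v \<Longrightarrow> i < r \<Longrightarrow> norm (v i) = 1"
proof -
  assume "orthonormal r v" "i < r"
  then have "complex_of_real ((norm (v i))\<^sup>2) = of_real 1"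
    unfolding cinner_self[symmetric] by (simp add: orthonormal_def)
  then have "(norm (v i))\<^sup>2 = 1" by (simp only: of_real_eq_iff)
  then show ?thesis by (simp add: power2_eq_1_iff) (use norm_ge_zero[of "v i"] in linarith)
qed

text \<open>The double sum of the squares of the inner products of two orthonormal families of the same
  size equals that size; by Bessel this forces equality for each member of either family, so an
  inclusion of spans is an equality.\<close>

lemma proj_fixes_swap:
  assumes f: "orthonormal r f" and e: "orthonormal r e" and fix_e: "\<And>j. j < r \<Longrightarrow> blinfun_apply (proj r f) (e j) = e j"
    and i: "i < r"
  shows "blinfun_apply (proj r e) (f i) = f i"
proof -
  define b where "b i = (\<Sum>j<r. (cmod (cinner_ell2 (e j) (f i)))\<^sup>2)" for i
  have le: "b i \<le> 1" if "i < r" for i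
    using bessel[OF e, of "f i"] orthonormal_norm[OF f that] by (simp add: b_def)
  have sym: "cmod (cinner_ell2 (e j) (f i)) = cmod (cinner_ell2 (f i) (e j))" for i j
    by (metis cnj_cinner complex_mod_cnj)
  have "(\<Sum>i<r. b i) = (\<Sum>j<r. \<Sum>i<r. (cmod (cinner_ell2 (f i) (e j)))\<^sup>2)"
    unfolding b_def sym by (rule sum.swap)
  also have "\<dots> = (\<Sum>j<r. 1)"
  proof (rule sum.cong)
    fix j assume "j \<in> {..<r}"
    then show "(\<Sum>i<r. (cmod (cinner_ell2 (f i) (e j)))\<^sup>2) = (1::real)"
      using proj_fixes_iff[OF f, of "e j"] fix_e[of j] orthonormal_norm[OF e, of j] by simp
  qed simp
  finally have "(\<Sum>i<r. 1 - b i) = 0" by (simp add: sum_subtractf)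
  then have "1 - b i = 0"
    using sum_nonneg_eq_0_iff[of "{..<r}" "\<lambda>i. 1 - b i"] le i by auto
  then show ?thesis
    using proj_fixes_iff[OF e, of "f i"] orthonormal_norm[OF f i] by (simp add: b_def)
qed

text \<open>Both compositions of the two projections are known, and they are adjoint to each other.\<close>

lemma proj_eqI:
  assumes f: "orthonormal r f" and e: "orthonormal r e" and fix_e: "\<And>j. j < r \<Longrightarrow> blinfun_apply (proj r f) (e j) = e j"
  shows "proj r e = proj r f"
proof (rule blinfun_eqI, rule ell2_eq_by_cinner)
  fix x y
  let ?E = "blinfun_apply (proj r e)" and ?F = "blinfun_apply (proj r f)"
  have FE: "?F (?E x) = ?E x"
    unfolding proj_apply[of r e x] blinfun.sum_right proj_scaleC by (intro sum.cong refl) (simp add: fix_e)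
  have EF: "?E (?F y) = ?F y"
    unfolding proj_apply[of r f y] blinfun.sum_right proj_scaleC
    by (intro sum.cong refl) (simp add: proj_fixes_swap[OF f e fix_e])
  have "cinner_ell2 (?E x) y = cinner_ell2 (?F (?E x)) y" by (simp add: FE)
  also have "\<dots> = cinner_ell2 x (?E (?F y))" by (simp add: proj_selfadjoint)
  also have "\<dots> = cinner_ell2 (?F x) y" by (simp add: EF proj_selfadjoint)
  finally show "cinner_ell2 (?E x) y = cinner_ell2 (?F x) y" .
qed

lemma orthonormal_basis: "orthonormal r (\<lambda>j. ell2_basis (int j))"
  by (auto simp: orthonormal_def)

text \<open>A left inverse of a square matrix is a right inverse.  The columns are an orthonormal family in the span
  of the first \<open>r\<close> basis vectors, so this is an instance of the previous observation.\<close>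

lemma unitary_rows:
  fixes A :: "nat \<Rightarrow> nat \<Rightarrow> complex"
  assumes A: "\<And>i j. i < r \<Longrightarrow> j < r \<Longrightarrow> (\<Sum>k<r. cnj (A k i) * A k j) = (if i = j then 1 else 0)"
    and "i < r" "j < r"
  shows "(\<Sum>k<r. A i k * cnj (A j k)) = (if i = j then 1 else (0::complex))"
proof -
  let ?f = "\<lambda>j. ell2_basis (int j)"
  define e where "e j = (\<Sum>k<r. scaleC_ell2 (A k j) (?f k))" for j
  have nth_e: "ell2_nth (e k) (int i) = A i k" if "i < r" for i k
    using orthonormal_coeff[OF orthonormal_basis that, of "\<lambda>i. A i k"] by (simp add: e_def)
  have e: "orthonormal r e"
    unfolding orthonormal_def
  proof (intro allI impI)
    fix i j assume ij: "i < r" "j < r"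
    have "cinner_ell2 (e i) (e j) = (\<Sum>k<r. A k j * cinner_ell2 (e i) (?f k))"
      by (simp add: e_def[of j] cin.sum_right)
    also have "\<dots> = (\<Sum>k<r. cnj (A k i) * A k j)"
      by (intro sum.cong refl) (simp add: nth_e)
    also have "\<dots> = (if i = j then 1 else 0)" by (rule A[OF ij])
    finally show "cinner_ell2 (e i) (e j) = (if i = j then 1 else 0)" .
  qed
  have "blinfun_apply (proj r ?f) (e j) = e j" for j
    unfolding e_def by (rule proj_comb[OF orthonormal_basis])
  then have "blinfun_apply (proj r e) (?f j) = ?f j"
    by (rule proj_fixes_swap[OF orthonormal_basis e _ assms(3)])
  then have "ell2_nth (blinfun_apply (proj r e) (?f j)) (int i) = (if i = j then 1 else 0)"
    by simp
  then show ?thesis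
    by (simp add: proj_apply ell2_nth_sum scaleC_ell2.rep_eq nth_e[OF assms(2)] nth_e[OF assms(3)] mult.commute)
qed


section \<open>Lifting homotopies of projections to frames\<close>

definition frame_on :: "nat \<Rightarrow> 'x::topological_space set \<Rightarrow> ('x \<Rightarrow> (ell2 \<Rightarrow>\<^sub>L ell2)) \<Rightarrow> ('x \<Rightarrow> nat \<Rightarrow> ell2) \<Rightarrow> bool" where
  "frame_on r C P e \<longleftrightarrow>
     (\<forall>j<r. continuous_on C (\<lambda>x. e x j)) \<and> (\<forall>x\<in>C. orthonormal r (e x) \<and> proj r (e x) = P x)"

lemma is_rank_proj_scaleC: "is_rank_proj r Q \<Longrightarrow> blinfun_apply Q (scaleC_ell2 c y) = scaleC_ell2 c (blinfun_apply Q y)"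
  by (auto simp: is_rank_proj_def proj_scaleC)

text \<open>Gram--Schmidt, applied to the images under \<open>Q\<close> of the given frame of \<open>P\<close>.  These remain linearly independent:
  a vector \<open>y\<close> in the range of \<open>P\<close> with \<open>Q y = 0\<close> satisfies \<open>y = (P - Q) y\<close>, so it vanishes.  All steps are
  continuous, and they do nothing where \<open>P\<close> and \<open>Q\<close> agree.\<close>

lemma frame_on_nearby:
  fixes P Q :: "'x::topological_space \<Rightarrow> (ell2 \<Rightarrow>\<^sub>L ell2)"
  assumes e: "frame_on r C P e" and Q: "continuous_on C Q"
    and pr: "\<And>x. x \<in> C \<Longrightarrow> is_rank_proj r (Q x)" and near: "\<And>x. x \<in> C \<Longrightarrow> norm (P x - Q x) < 1"
  shows "\<exists>e'. frame_on r C Q e' \<and> (\<forall>x\<in>C. P x = Q x \<longrightarrow> (\<forall>j<r. e' x j = e x j))"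
proof -
  have ec: "continuous_on C (\<lambda>x. e x j)" if "j < r" for j using e that by (simp add: frame_on_def)
  have eo: "orthonormal r (e x)" "proj r (e x) = P x" if "x \<in> C" for x using e that by (simp_all add: frame_on_def)
  \<comment> \<open>Each new vector is \<open>Q y\<close> with \<open>y\<close> in the span of the first vectors of the old frame; this is what excludes
    that the next step divides by zero.\<close>
  have "\<exists>e'. (\<forall>j<k. continuous_on C (\<lambda>x. e' x j)) \<and>
      (\<forall>x\<in>C. orthonormal k (e' x) \<and>
         (\<forall>j<k. \<exists>y. e' x j = blinfun_apply (Q x) y \<and> blinfun_apply (P x) y = y \<and>
                   (\<forall>l. j < l \<and> l < r \<longrightarrow> cinner_ell2 (e x l) y = 0)) \<and>
         (P x = Q x \<longrightarrow> (\<forall>j<k. e' x j = e x j)))"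
    if "k \<le> r" for k :: nat
    using that
  proof (induction k)
    case 0
    show ?case by (simp add: orthonormal_def)
  next
    case (Suc k)
    then have k: "k < r" by simp
    obtain e' where H: "(\<forall>j<k. continuous_on C (\<lambda>x. e' x j)) \<and>
      (\<forall>x\<in>C. orthonormal k (e' x) \<and>
         (\<forall>j<k. \<exists>y. e' x j = blinfun_apply (Q x) y \<and> blinfun_apply (P x) y = y \<and>
                   (\<forall>l. j < l \<and> l < r \<longrightarrow> cinner_ell2 (e x l) y = 0)) \<and>
         (P x = Q x \<longrightarrow> (\<forall>j<k. e' x j = e x j)))"
      using Suc.IH Suc.prems by auto
    have c': "\<And>j. j < k \<Longrightarrow> continuous_on C (\<lambda>x. e' x j)"
      and ofs: "\<And>x. x \<in> C \<Longrightarrow> orthonormal k (e' x)"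
      and y': "\<And>x j. x \<in> C \<Longrightarrow> j < k \<Longrightarrow> \<exists>y. e' x j = blinfun_apply (Q x) y \<and> blinfun_apply (P x) y = y \<and>
                   (\<forall>l. j < l \<and> l < r \<longrightarrow> cinner_ell2 (e x l) y = 0)"
      and eq': "\<And>x j. x \<in> C \<Longrightarrow> P x = Q x \<Longrightarrow> j < k \<Longrightarrow> e' x j = e x j"
      using conjunct1[OF H] conjunct2[OF H, rule_format, THEN conjunct1]
        conjunct2[OF H, rule_format, THEN conjunct2, THEN conjunct1, rule_format]
        conjunct2[OF H, rule_format, THEN conjunct2, THEN conjunct2, rule_format] by simp_all
    define d where "d x i = cinner_ell2 (e' x i) (blinfun_apply (Q x) (e x k))" for x i
    define w where "w x = blinfun_apply (Q x) (e x k) - (\<Sum>i<k. scaleC_ell2 (d x i) (e' x i))" for x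
    have cQ: "continuous_on C (\<lambda>x. blinfun_apply (Q x) (e x k))"
      by (rule blinfun.continuous_on[OF Q ec[OF k]])
    have cw: "continuous_on C w"
      unfolding w_def d_def
      by (intro continuous_on_diff cQ continuous_on_sum scl.continuous_on[OF cin.continuous_on[OF c' cQ] c']) auto
    have wy: "\<exists>y. w x = blinfun_apply (Q x) y \<and> blinfun_apply (P x) y = y \<and>
       cinner_ell2 (e x k) y = 1 \<and> (\<forall>l. k < l \<and> l < r \<longrightarrow> cinner_ell2 (e x l) y = 0)" if x: "x \<in> C" for x
    proof -
      obtain Y where Y: "\<And>j. j < k \<Longrightarrow> e' x j = blinfun_apply (Q x) (Y j)"
        "\<And>j. j < k \<Longrightarrow> blinfun_apply (P x) (Y j) = Y j"
        "\<And>j l. j < k \<Longrightarrow> j < l \<Longrightarrow> l < r \<Longrightarrow> cinner_ell2 (e x l) (Y j) = 0"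
      proof -
        have "\<forall>j\<in>{..<k}. \<exists>y. e' x j = blinfun_apply (Q x) y \<and> blinfun_apply (P x) y = y \<and>
                   (\<forall>l. j < l \<and> l < r \<longrightarrow> cinner_ell2 (e x l) y = 0)"
          using y'[OF x] by blast
        from bchoice[OF this] show ?thesis using that by blast
      qed
      define y where "y = e x k - (\<Sum>i<k. scaleC_ell2 (d x i) (Y i))"
      have prP: "is_rank_proj r (P x)" using eo[OF x] by (auto simp: is_rank_proj_def)
      have "w x = blinfun_apply (Q x) y"
        unfolding w_def y_def blinfun.diff_right blinfun.sum_right
        by (simp add: is_rank_proj_scaleC[OF pr[OF x]] Y)
      moreover have "blinfun_apply (P x) y = y"
        unfolding y_def blinfun.diff_right blinfun.sum_right
        using proj_frame[OF eo(1)[OF x] k] by (simp add: is_rank_proj_scaleC[OF prP] Y eo(2)[OF x])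
      moreover have "cinner_ell2 (e x l) y = (if l = k then 1 else 0)" if "k \<le> l" "l < r" for l
        unfolding y_def cin.diff_right cin.sum_right
        using that k by (simp add: Y orthonormal_D[OF eo(1)[OF x]])
      ultimately show ?thesis using k by (intro exI[of _ y]) auto
    qed
    have w0: "w x \<noteq> 0" if x: "x \<in> C" for x
    proof
      assume "w x = 0"
      with wy[OF x] obtain y where y: "blinfun_apply (Q x) y = 0" "blinfun_apply (P x) y = y"
         "cinner_ell2 (e x k) y = 1" by metis
      then have "y = blinfun_apply (P x - Q x) y" by (simp add: blinfun.diff_left)
      then have "norm y \<le> norm (P x - Q x) * norm y" using norm_blinfun[of "P x - Q x" y] by simp
      moreover have "norm y > 0" using y(3) by (auto simp: cin.zero_right)
      ultimately show False using near[OF x] by (simp add: mult_le_cancel_right)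
    qed
    define e2 where "e2 x = (e' x)(k := inverse (norm (w x)) *\<^sub>R w x)" for x
    have orth: "cinner_ell2 (e' x i) (w x) = 0" if "x \<in> C" "i < k" for x i
      unfolding w_def cin.diff_right using orthonormal_coeff[OF ofs[OF that(1)] that(2), of "d x"] by (simp add: d_def)
    have "orthonormal (Suc k) (e2 x)" if x: "x \<in> C" for x
      unfolding orthonormal_def
    proof (intro allI impI)
      fix i j assume ij: "i < Suc k" "j < Suc k"
      have or: "cinner_ell2 (w x) (e' x i) = 0" if "i < k" for i
        using orth[OF x that] by (metis cnj_cinner complex_cnj_zero)
      have self: "cinner_ell2 (inverse (norm (w x)) *\<^sub>R w x) (inverse (norm (w x)) *\<^sub>R w x) = 1"
        using w0[OF x] by (simp add: cinner_self)
      show "cinner_ell2 (e2 x i) (e2 x j) = (if i = j then 1 else 0)"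
        using ij self orth[OF x] or orthonormal_D[OF ofs[OF x]]
        by (auto simp: e2_def less_Suc_eq cin.scaleR_left cin.scaleR_right)
    qed
    moreover have "continuous_on C (\<lambda>x. e2 x j)" if "j < Suc k" for j
    proof (cases "j = k")
      case True
      then show ?thesis using w0 by (auto simp: e2_def intro!: continuous_intros cw)
    next
      case False
      then show ?thesis using that c' by (simp add: e2_def)
    qed
    moreover have "\<exists>y. e2 x j = blinfun_apply (Q x) y \<and> blinfun_apply (P x) y = y \<and>
                   (\<forall>l. j < l \<and> l < r \<longrightarrow> cinner_ell2 (e x l) y = 0)" if x: "x \<in> C" and "j < Suc k" for x j
    proof (cases "j = k")
      case True
      obtain y where "w x = blinfun_apply (Q x) y" "blinfun_apply (P x) y = y"
        "\<forall>l. k < l \<and> l < r \<longrightarrow> cinner_ell2 (e x l) y = 0" using wy[OF x] by blast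
      then show ?thesis using True
        by (intro exI[of _ "inverse (norm (w x)) *\<^sub>R y"])
           (simp add: e2_def blinfun.scaleR_right cin.scaleR_right)
    next
      case False
      then show ?thesis using that y'[OF x] by (simp add: e2_def)
    qed
    moreover have "e2 x j = e x j" if x: "x \<in> C" and eq: "P x = Q x" and "j < Suc k" for x j
    proof -
      have Qe: "blinfun_apply (Q x) (e x k) = e x k" 
        using proj_frame[OF eo(1)[OF x] k] eo(2)[OF x] eq by simp
      have "d x i = 0" if "i < k" for i
        using that k orthonormal_D[OF eo(1)[OF x]] by (simp add: d_def eq'[OF x eq] Qe)
      then have "w x = e x k" by (simp add: w_def Qe)
      then show ?thesis using that orthonormal_norm[OF eo(1)[OF x] k] eq'[OF x eq] by (simp add: e2_def)
    qed
    ultimately show ?case by (intro exI[of _ e2] conjI allI ballI impI)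
  qed
  from this[OF order_refl] obtain e' where H: "(\<forall>j<r. continuous_on C (\<lambda>x. e' x j)) \<and>
      (\<forall>x\<in>C. orthonormal r (e' x) \<and>
         (\<forall>j<r. \<exists>y. e' x j = blinfun_apply (Q x) y \<and> blinfun_apply (P x) y = y \<and>
                   (\<forall>l. j < l \<and> l < r \<longrightarrow> cinner_ell2 (e x l) y = 0)) \<and>
         (P x = Q x \<longrightarrow> (\<forall>j<r. e' x j = e x j)))" ..
  have e':
    "\<And>j. j < r \<Longrightarrow> continuous_on C (\<lambda>x. e' x j)" "\<And>x. x \<in> C \<Longrightarrow> orthonormal r (e' x)"
    "\<And>x j. x \<in> C \<Longrightarrow> j < r \<Longrightarrow> \<exists>y. e' x j = blinfun_apply (Q x) y"
    "\<And>x j. x \<in> C \<Longrightarrow> P x = Q x \<Longrightarrow> j < r \<Longrightarrow> e' x j = e x j"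
    subgoal for j using H by simp
    subgoal for x using H by simp
    subgoal for x j using H by meson
    subgoal for x j using H by simp
    done
  have "proj r (e' x) = Q x" if x: "x \<in> C" for x
  proof -
    obtain f where f: "orthonormal r f" "Q x = proj r f" using pr[OF x] by (auto simp: is_rank_proj_def)
    have "blinfun_apply (proj r f) (e' x j) = e' x j" if "j < r" for j
      using e'(3)[OF x that] f proj_idem by metis
    then show ?thesis using proj_eqI[OF f(1) e'(2)[OF x]] f(2) by simp
  qed
  then show ?thesis using e' by (intro exI[of _ e']) (auto simp: frame_on_def)
qed

text \<open>Along a sufficiently fine subdivision of the homotopy, which exists by uniform continuity, consecutive
  projections are near enough for the previous lemma.\<close>

lemma frame_on_homotopy:
  fixes H :: "real \<Rightarrow> 'x::metric_space \<Rightarrow> (ell2 \<Rightarrow>\<^sub>L ell2)"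
  assumes C: "compact C" and H: "continuous_on ({0..1} \<times> C) (\<lambda>p. H (fst p) (snd p))"
    and pr: "\<And>t x. t \<in> {0..1} \<Longrightarrow> x \<in> C \<Longrightarrow> is_rank_proj r (H t x)"
    and e: "frame_on r C (H 0) e"
  shows "\<exists>e'. frame_on r C (H 1) e' \<and>
           (\<forall>x\<in>C. (\<forall>t\<in>{0..1}. H t x = H 0 x) \<longrightarrow> (\<forall>j<r. e' x j = e x j))"
proof -
  have "uniformly_continuous_on ({0..1} \<times> C) (\<lambda>p. H (fst p) (snd p))"
    by (rule compact_uniformly_continuous[OF H compact_Times[OF compact_Icc C]])
  then obtain \<delta> where \<delta>: "\<delta> > 0" and near: "\<And>p p'. p \<in> {0..1} \<times> C \<Longrightarrow> p' \<in> {0..1} \<times> C \<Longrightarrow>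
      dist p' p < \<delta> \<Longrightarrow> dist (H (fst p') (snd p')) (H (fst p) (snd p)) < 1"
    unfolding uniformly_continuous_on_def using zero_less_one by blast
  obtain n :: nat where n: "n > 0" "inverse (real n) < \<delta>"
    using \<delta> ex_inverse_of_nat_less by blast
  define t where "t k = real k / real n" for k
  have "t n = 1" using n by (simp add: t_def)
  have t01: "t k \<in> {0..1}" if "k \<le> n" for k using that n by (auto simp: t_def)
  have "\<exists>e'. frame_on r C (H (t k)) e' \<and>
           (\<forall>x\<in>C. (\<forall>t\<in>{0..1}. H t x = H 0 x) \<longrightarrow> (\<forall>j<r. e' x j = e x j))" if "k \<le> n" for k
    using that
  proof (induction k)
    case 0
    have "t 0 = 0" by (simp add: t_def)
    show ?case unfolding \<open>t 0 = 0\<close> using e by blast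
  next
    case (Suc k)
    obtain e1 where e1: "frame_on r C (H (t k)) e1"
       "\<forall>x\<in>C. (\<forall>t\<in>{0..1}. H t x = H 0 x) \<longrightarrow> (\<forall>j<r. e1 x j = e x j)"
      using Suc.IH[OF Suc_leD[OF Suc.prems]] by blast
    have kn: "t k \<in> {0..1}" "t (Suc k) \<in> {0..1}" using Suc.prems t01 by auto
    have step: "dist (t k) (t (Suc k)) < \<delta>"
    proof -
      have "t (Suc k) - t k = inverse (real n)" by (simp add: t_def divide_inverse algebra_simps)
      then show ?thesis using n unfolding dist_real_def abs_minus_commute[of "t k"] by simp
    qed
    have "norm (H (t k) x - H (t (Suc k)) x) < 1" if "x \<in> C" for x
      using near[of "(t (Suc k), x)" "(t k, x)"] kn that step by (simp add: dist_Pair_Pair dist_norm)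
    moreover have "continuous_on C (\<lambda>x. H (t (Suc k)) x)"
    proof -
      have "continuous_on C (\<lambda>x. (\<lambda>p. H (fst p) (snd p)) (t (Suc k), x))"
        by (rule continuous_on_compose2[OF H]) (use kn in \<open>auto intro!: continuous_intros\<close>)
      then show ?thesis by simp
    qed
    ultimately obtain e2 where e2: "frame_on r C (H (t (Suc k))) e2"
      "\<forall>x\<in>C. H (t k) x = H (t (Suc k)) x \<longrightarrow> (\<forall>j<r. e2 x j = e1 x j)"
      using frame_on_nearby[OF e1(1), of "H (t (Suc k))"] pr[OF kn(2)] by blast
    have "\<forall>j<r. e2 x j = e x j" if x: "x \<in> C" "\<forall>t\<in>{0..1}. H t x = H 0 x" for x
    proof -
      have "H (t k) x = H (t (Suc k)) x" using bspec[OF x(2) kn(1)] bspec[OF x(2) kn(2)] by (rule trans[OF _ sym])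
      then have "\<forall>j<r. e2 x j = e1 x j" using e2(2) x(1) by blast
      moreover have "\<forall>j<r. e1 x j = e x j" using e1(2) x by blast
      ultimately show ?thesis by simp
    qed
    then show ?case using e2(1) by blast
  qed
  from this[OF order_refl] show ?thesis unfolding \<open>t n = 1\<close> .
qed


section \<open>Two orthogonal copies of the Hilbert space and their rotation\<close>

lift_definition ell2_double :: "bool \<Rightarrow> ell2 \<Rightarrow> ell2" is
  "\<lambda>b f i. if i mod 2 = of_bool b then f (i div 2) else 0"
proof -
  fix b and f :: "int \<Rightarrow> complex" assume f: "(\<lambda>i. (cmod (f i))\<^sup>2) summable_on UNIV"
  let ?A = "{i::int. i mod 2 = of_bool b}"
  have "inj_on (\<lambda>i. i div 2) ?A" by (rule inj_onI) (metis (mono_tags) mem_Collect_eq mult_div_mod_eq)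
  moreover have "(\<lambda>i. (cmod (f i))\<^sup>2) summable_on (\<lambda>i. i div 2) ` ?A"
    by (rule summable_on_subset_banach[OF f]) simp
  ultimately have "(\<lambda>i. (cmod (f (i div 2)))\<^sup>2) summable_on ?A"
    by (simp add: summable_on_reindex o_def)
  also have "?this \<longleftrightarrow> (\<lambda>i. (cmod (if i mod 2 = of_bool b then f (i div 2) else 0))\<^sup>2) summable_on UNIV"
    by (rule summable_on_cong_neutral) auto
  finally show "(\<lambda>i. (cmod (if i mod 2 = of_bool b then f (i div 2) else 0))\<^sup>2) summable_on UNIV" .
qed

lift_definition ell2_half :: "bool \<Rightarrow> ell2 \<Rightarrow> ell2" is "\<lambda>b f i. f (2 * i + of_bool b)"
proof -
  fix b and f :: "int \<Rightarrow> complex" assume f: "(\<lambda>i. (cmod (f i))\<^sup>2) summable_on UNIV"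
  have "inj (\<lambda>i::int. 2 * i + of_bool b)" by (rule injI) simp
  moreover have "(\<lambda>i. (cmod (f i))\<^sup>2) summable_on range (\<lambda>i. 2 * i + of_bool b)"
    by (rule summable_on_subset_banach[OF f]) simp
  ultimately show "(\<lambda>i. (cmod (f (2 * i + of_bool b)))\<^sup>2) summable_on UNIV"
    by (simp add: summable_on_reindex o_def)
qed

lemma half_double: "ell2_half a (ell2_double b x) = (if a = b then x else 0)"
  by (rule ell2_eqI) (simp add: ell2_half.rep_eq ell2_double.rep_eq zero_ell2.rep_eq)

lemma cinner_double: "cinner_ell2 (ell2_double b x) y = cinner_ell2 x (ell2_half b y)"
proof -
  let ?A = "{i::int. i mod 2 = of_bool b}"
  have bij: "bij_betw (\<lambda>i. 2 * i + of_bool b) UNIV ?A"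
    by (rule bij_betwI[where g = "\<lambda>i. i div 2"]) (auto simp: minus_mod_eq_mult_div[symmetric])
  have "cinner_ell2 (ell2_double b x) y = (\<Sum>\<^sub>\<infinity>i\<in>?A. cnj (ell2_nth x (i div 2)) * ell2_nth y i)"
    unfolding cinner_ell2_def by (rule infsum_cong_neutral) (auto simp: ell2_double.rep_eq)
  also have "\<dots> = (\<Sum>\<^sub>\<infinity>i. cnj (ell2_nth x ((2 * i + of_bool b) div 2)) * ell2_nth y (2 * i + of_bool b))"
    by (rule infsum_reindex_bij_betw[OF bij, symmetric])
  also have "\<dots> = cinner_ell2 x (ell2_half b y)"
    unfolding cinner_ell2_def by (simp add: ell2_half.rep_eq)
  finally show ?thesis .
qed

lemma norm_double: "norm (ell2_double b x) = norm x"
proof -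
  have "complex_of_real ((norm (ell2_double b x))\<^sup>2) = of_real ((norm x)\<^sup>2)"
    unfolding cinner_self[symmetric] cinner_double half_double by simp
  then have "(norm (ell2_double b x))\<^sup>2 = (norm x)\<^sup>2" by (simp only: of_real_eq_iff)
  then show ?thesis by simp
qed

lemma norm_half: "norm (ell2_half b x) \<le> norm x"
proof -
  have "complex_of_real ((norm (ell2_half b x))\<^sup>2) = cinner_ell2 (ell2_double b (ell2_half b x)) x"
    by (simp only: cinner_self[symmetric] cinner_double)
  then have "norm (complex_of_real ((norm (ell2_half b x))\<^sup>2)) \<le> norm (ell2_half b x) * norm x"
    using cmod_cinner_le[of "ell2_double b (ell2_half b x)" x] by (simp add: norm_double)
  then have "norm (ell2_half b x) * norm (ell2_half b x) \<le> norm (ell2_half b x) * norm x"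
    by (simp add: power2_eq_square norm_mult)
  then show ?thesis by (cases "norm (ell2_half b x) = 0") (simp_all add: mult_le_cancel_left)
qed

lift_definition double_op :: "bool \<Rightarrow> (ell2 \<Rightarrow>\<^sub>L ell2)" is ell2_double
  by (rule bounded_linear_intro[where K = 1])
     (auto simp: norm_double intro!: ell2_eqI simp: ell2_double.rep_eq plus_ell2.rep_eq scaleR_ell2.rep_eq)

lift_definition half_op :: "bool \<Rightarrow> (ell2 \<Rightarrow>\<^sub>L ell2)" is ell2_half
  by (rule bounded_linear_intro[where K = 1])
     (auto simp: norm_half intro!: ell2_eqI simp: ell2_half.rep_eq plus_ell2.rep_eq scaleR_ell2.rep_eq)

text \<open>\<open>rot \<theta>\<close> embeds the Hilbert space as its tensor product with the unit vector of angle \<open>\<theta>\<close> in the plane;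
  the embeddings for two angles that differ by \<open>pi / 2\<close> have orthogonal ranges.  \<open>unrot \<theta>\<close> is the adjoint.\<close>

definition rot :: "real \<Rightarrow> (ell2 \<Rightarrow>\<^sub>L ell2)" where
  "rot \<theta> = cos \<theta> *\<^sub>R double_op False + sin \<theta> *\<^sub>R double_op True"

definition unrot :: "real \<Rightarrow> (ell2 \<Rightarrow>\<^sub>L ell2)" where
  "unrot \<theta> = cos \<theta> *\<^sub>R half_op False + sin \<theta> *\<^sub>R half_op True"

lemma cinner_rot: "cinner_ell2 (blinfun_apply (rot \<theta>) x) y = cinner_ell2 x (blinfun_apply (unrot \<theta>) y)"
  by (simp add: rot_def unrot_def blinfun.add_left blinfun.scaleR_left double_op.rep_eq half_op.rep_eq
      cin.add_left cin.add_right cin.scaleR_left cin.scaleR_right cinner_double)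

lemma unrot_rot: "blinfun_apply (unrot \<phi>) (blinfun_apply (rot \<theta>) x) = cos (\<phi> - \<theta>) *\<^sub>R x"
proof -
  have "blinfun_apply (half_op a) (blinfun_apply (double_op b) x) = (if a = b then x else 0)" for a b x
    by (simp add: double_op.rep_eq half_op.rep_eq half_double)
  then show ?thesis
    by (simp add: rot_def unrot_def blinfun.add_left blinfun.scaleR_left blinfun.add_right blinfun.scaleR_right
       cos_diff scaleR_add_left mult.commute)
qed

lemma ell2_double_scaleC: "ell2_double b (scaleC_ell2 c x) = scaleC_ell2 c (ell2_double b x)"
  by (rule ell2_eqI) (simp add: ell2_double.rep_eq scaleC_ell2.rep_eq)

lemma rot_scaleC: "blinfun_apply (rot \<theta>) (scaleC_ell2 c x) = scaleC_ell2 c (blinfun_apply (rot \<theta>) x)"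
  by (simp add: rot_def blinfun.add_left blinfun.scaleR_left double_op.rep_eq ell2_double_scaleC
      scal.scale_right_distrib scl.scaleR_right)

definition rot_conj :: "real \<Rightarrow> (ell2 \<Rightarrow>\<^sub>L ell2) \<Rightarrow> (ell2 \<Rightarrow>\<^sub>L ell2)" where
  "rot_conj \<theta> P = rot \<theta> o\<^sub>L P o\<^sub>L unrot \<theta>"

lemma proj_rot: "proj r (\<lambda>j. blinfun_apply (rot \<theta>) (v j)) = rot_conj \<theta> (proj r v)"
  by (rule blinfun_eqI) (simp add: rot_conj_def proj_apply cinner_rot blinfun.sum_right rot_scaleC)

text \<open>The internal direct sum of the ranges of \<open>P\<close> and \<open>Q\<close>, turned by the angle \<open>\<theta>\<close> in the plane
  spanned by the two copies.\<close>

definition plane_sum :: "real \<Rightarrow> (ell2 \<Rightarrow>\<^sub>L ell2) \<Rightarrow> (ell2 \<Rightarrow>\<^sub>L ell2) \<Rightarrow> (ell2 \<Rightarrow>\<^sub>L ell2)" where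
  "plane_sum \<theta> P Q = rot_conj \<theta> P + rot_conj (\<theta> + pi / 2) Q"

definition plane_frame :: "nat \<Rightarrow> real \<Rightarrow> (nat \<Rightarrow> ell2) \<Rightarrow> (nat \<Rightarrow> ell2) \<Rightarrow> (nat \<Rightarrow> ell2)" where
  "plane_frame m \<theta> v w = (\<lambda>j. if j < m then blinfun_apply (rot \<theta>) (v j) else blinfun_apply (rot (\<theta> + pi / 2)) (w (j - m)))"

lemma sum_lessThan_split: "(\<Sum>j<m + k. f j) = (\<Sum>j<m. f j) + (\<Sum>j<k. f (m + j :: nat) :: 'a::comm_monoid_add)"
  by (induction k) (simp_all add: add_ac)

lemma proj_plane_frame: "proj (m + m) (plane_frame m \<theta> v w) = plane_sum \<theta> (proj m v) (proj m w)"
  unfolding plane_sum_def proj_rot[symmetric]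
  by (simp add: proj_def sum_lessThan_split plane_frame_def)

lemma cinner_rot_rot: "cinner_ell2 (blinfun_apply (rot \<phi>) x) (blinfun_apply (rot \<theta>) y) = cos (\<phi> - \<theta>) *\<^sub>R cinner_ell2 x y"
  by (simp add: cinner_rot unrot_rot cin.scaleR_right)

lemma orthonormal_plane_frame: "orthonormal m v \<Longrightarrow> orthonormal m w \<Longrightarrow> orthonormal (m + m) (plane_frame m \<theta> v w)"
  by (auto simp: orthonormal_def plane_frame_def cinner_rot_rot)

lemma is_rank_proj_plane_sum: "is_rank_proj m P \<Longrightarrow> is_rank_proj m Q \<Longrightarrow> is_rank_proj (m + m) (plane_sum \<theta> P Q)"
  unfolding is_rank_proj_def using orthonormal_plane_frame proj_plane_frame by metis

text \<open>Explicit in the angle, so that identities between angles become identities between coefficients.\<close>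

lemma rot_conj_expand:
  "rot_conj \<theta> P = (cos \<theta>)\<^sup>2 *\<^sub>R (double_op False o\<^sub>L P o\<^sub>L half_op False) +
     (cos \<theta> * sin \<theta>) *\<^sub>R (double_op False o\<^sub>L P o\<^sub>L half_op True) +
     (cos \<theta> * sin \<theta>) *\<^sub>R (double_op True o\<^sub>L P o\<^sub>L half_op False) + (sin \<theta>)\<^sup>2 *\<^sub>R (double_op True o\<^sub>L P o\<^sub>L half_op True)"
  by (rule blinfun_eqI)
     (simp add: rot_conj_def rot_def unrot_def blinfun.add_left blinfun.scaleR_left blinfun.add_right
      blinfun.scaleR_right power2_eq_square scaleR_add_right mult.commute add_ac)

text \<open>The tensor product of a subspace with the plane is invariant under rotations of the plane.\<close>

lemma plane_sum_diag: "plane_sum \<theta> B B = plane_sum 0 B B"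
proof -
  have c: "cos (\<theta> + pi / 2) = - sin \<theta>" "sin (\<theta> + pi / 2) = cos \<theta>" by (simp_all add: cos_add sin_add)
  have "plane_sum \<theta> B B = ((cos \<theta>)\<^sup>2 + (sin \<theta>)\<^sup>2) *\<^sub>R (double_op False o\<^sub>L B o\<^sub>L half_op False)
      + ((cos \<theta>)\<^sup>2 + (sin \<theta>)\<^sup>2) *\<^sub>R (double_op True o\<^sub>L B o\<^sub>L half_op True)"
    unfolding plane_sum_def rot_conj_expand[of \<theta>] rot_conj_expand[of "\<theta> + pi / 2"] c scaleR_add_left
    by (simp add: mult.commute add_ac)
  also have "\<dots> = plane_sum 0 B B"
    unfolding plane_sum_def rot_conj_expand by simp
  finally show ?thesis .
qed

lemma plane_sum_quarter: "plane_sum (pi / 2) P Q = plane_sum 0 Q P"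
  unfolding plane_sum_def rot_conj_expand by (simp add: add.commute)

lemma continuous_on_plane_sum:
  fixes \<theta> :: "'x::t2_space \<Rightarrow> real"
  assumes "continuous_on S \<theta>" "continuous_on S P" "continuous_on S Q"
  shows "continuous_on S (\<lambda>x. plane_sum (\<theta> x) (P x) (Q x))"
  unfolding plane_sum_def rot_conj_def rot_def unrot_def
  by (intro continuous_on_add continuous_on_scaleR continuous_on_cos continuous_on_sin continuous_on_const
      assms bounded_bilinear.continuous_on[OF bounded_bilinear_blinfun_compose])


section \<open>Projections from points of the classifying space\<close>

lemma topspace_final_topology:
  assumes "\<And>i x. i \<in> I \<Longrightarrow> x \<in> topspace (X i) \<Longrightarrow> f i x \<in> S"
  shows "topspace (final_topology S I X f) = S"
proof -
  have "openin (final_topology S I X f) S"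
  proof -
    have "{x \<in> topspace (X i). f i x \<in> S} = topspace (X i)" if "i \<in> I" for i using assms that by auto
    then show ?thesis unfolding openin_final_topology by auto
  qed
  moreover have "topspace (final_topology S I X f) \<subseteq> S"
    using openin_topspace[of "final_topology S I X f"] unfolding openin_final_topology by blast
  ultimately show ?thesis using openin_subset by blast
qed

text \<open>The universal property of the final topology.\<close>

lemma continuous_map_from_final_topology:
  assumes into: "\<And>i x. i \<in> I \<Longrightarrow> x \<in> topspace (X i) \<Longrightarrow> f i x \<in> S"
    and onto: "\<And>s. s \<in> S \<Longrightarrow> \<exists>i\<in>I. \<exists>x\<in>topspace (X i). s = f i x"
    and g: "\<And>i. i \<in> I \<Longrightarrow> continuous_map (X i) Y (\<lambda>x. g (f i x))"
  shows "continuous_map (final_topology S I X f) Y g"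
proof -
  have top: "topspace (final_topology S I X f) = S"
    by (rule topspace_final_topology) (rule into)
  show ?thesis
  unfolding continuous_map_def top
proof (intro conjI allI impI)
  show "g \<in> S \<rightarrow> topspace Y"
  proof
    fix s assume "s \<in> S"
    then obtain i x where "i \<in> I" "x \<in> topspace (X i)" "s = f i x" using onto by blast
    then show "g s \<in> topspace Y" using continuous_map_funspace[OF g, of i] by auto
  qed
  fix U assume U: "openin Y U"
  have "openin (X i) {x \<in> topspace (X i). f i x \<in> {s \<in> S. g s \<in> U}}" if i: "i \<in> I" for i
  proof -
    have "{x \<in> topspace (X i). f i x \<in> {s \<in> S. g s \<in> U}} = {x \<in> topspace (X i). g (f i x) \<in> U}"
      using into[OF i] by auto
    then show ?thesis using openin_continuous_map_preimage[OF g[OF i] U] by simp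
  qed
  then show "openin (final_topology S I X f) {x \<in> S. g x \<in> U}"
    unfolding openin_final_topology by auto
qed
qed

lemma continuous_map_into_final_topology:
  assumes "i \<in> I" and into: "\<And>i x. i \<in> I \<Longrightarrow> x \<in> topspace (X i) \<Longrightarrow> f i x \<in> S"
  shows "continuous_map (X i) (final_topology S I X f) (f i)"
proof -
  have top: "topspace (final_topology S I X f) = S"
    by (rule topspace_final_topology) (rule into)
  show ?thesis
    unfolding continuous_map_def top using assms by (auto simp: openin_final_topology)
qed

definition emb :: "(nat \<Rightarrow> complex) \<Rightarrow> ell2" where
  "emb z = (\<Sum>k | z k \<noteq> 0. scaleC_ell2 (z k) (ell2_basis (int k)))"

lemma emb_cspace: "z \<in> cspace N \<Longrightarrow> emb z = (\<Sum>k<N. scaleC_ell2 (z k) (ell2_basis (int k)))"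
  unfolding emb_def by (rule sum.mono_neutral_left) (auto simp: cspace_def not_le[symmetric])

lemma continuous_on_emb: "continuous_on (cspace N) emb"
proof -
  have "continuous_on (cspace N) (\<lambda>z. \<Sum>k<N. scaleC_ell2 (z k) (ell2_basis (int k)))"
    by (intro continuous_on_sum scl.continuous_on continuous_on_const
        continuous_on_subset[OF continuous_on_product_coordinates]) auto
  then show ?thesis by (rule continuous_on_eq) (simp add: emb_cspace)
qed

lemma continuous_map_emb: "continuous_map cspace_infinity euclidean emb"
  unfolding cspace_infinity_def inductive_limit_def
  by (rule continuous_map_from_final_topology) (auto simp: continuous_on_emb)

lemma cinner_emb:
  assumes "z \<in> cspace N" "z' \<in> cspace N"
  shows "cinner_ell2 (emb z) (emb z') = (\<Sum>k<N. cnj (z k) * z' k)"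
proof -
  have "cinner_ell2 (emb z) (ell2_basis (int k)) = cnj (z k)" if "k < N" for k
  proof -
    have "ell2_nth (emb z) (int k) = z k"
      using orthonormal_coeff[OF orthonormal_basis that, of z] by (simp add: emb_cspace[OF assms(1)])
    then show ?thesis by simp
  qed
  then show ?thesis
    unfolding emb_cspace[OF assms(2)] cin.sum_right by (intro sum.cong) (auto simp: mult.commute)
qed

lemma stiefel_cspace: "v \<in> stiefel m N \<Longrightarrow> v j \<in> cspace N"
  by (cases "j < m") (auto simp: stiefel_def cspace_def)

lemma orthonormal_emb: "v \<in> stiefel m N \<Longrightarrow> orthonormal m (\<lambda>j. emb (v j))"
  unfolding orthonormal_def
  by (auto simp: cinner_emb[OF stiefel_cspace stiefel_cspace]) (auto simp: stiefel_def)

lemma emb_frame_comb: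
  assumes v: "v \<in> stiefel m N"
  shows "emb (frame_comb m v z) = (\<Sum>j<m. scaleC_ell2 (z j) (emb (v j)))"
proof -
  have "frame_comb m v z \<in> cspace N"
    using stiefel_cspace[OF v] by (auto simp: frame_comb_def cspace_def)
  then have "emb (frame_comb m v z) = (\<Sum>k<N. \<Sum>j<m. scaleC_ell2 (z j * v j k) (ell2_basis (int k)))"
    by (simp add: emb_cspace frame_comb_def scal.scale_sum_left)
  also have "\<dots> = (\<Sum>j<m. scaleC_ell2 (z j) (emb (v j)))"
    unfolding emb_cspace[OF stiefel_cspace[OF v]] scal.scale_sum_right
    by (subst sum.swap) simp
  finally show ?thesis .
qed

definition unit_seq :: "nat \<Rightarrow> nat \<Rightarrow> complex" where
  "unit_seq j = (\<lambda>k. if k = j then 1 else 0)"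

lemma unit_seq_cspace: "j < m \<Longrightarrow> unit_seq j \<in> cspace m"
  by (auto simp: unit_seq_def cspace_def)

lemma frame_comb_unit: "j < m \<Longrightarrow> frame_comb m v (unit_seq j) = v j"
  by (rule ext) (simp add: frame_comb_def unit_seq_def if_distrib[of "\<lambda>x. x * _"] cong: if_cong)

definition span_proj :: "nat \<Rightarrow> (nat \<Rightarrow> complex) set \<Rightarrow> (ell2 \<Rightarrow>\<^sub>L ell2)" where
  "span_proj m V = (SOME P. \<exists>N. \<exists>v\<in>stiefel m N. V = frame_span m v \<and> P = proj m (\<lambda>j. emb (v j)))"

text \<open>Two frames with the same span have the same projection, so the choice in the definition is immaterial.\<close>

lemma span_proj_frame_span:
  assumes v: "v \<in> stiefel m N"
  shows "span_proj m (frame_span m v) = proj m (\<lambda>j. emb (v j))"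
proof -
  have "\<exists>P. \<exists>N. \<exists>w\<in>stiefel m N. frame_span m v = frame_span m w \<and> P = proj m (\<lambda>j. emb (w j))"
    using v by blast
  from someI_ex[OF this] obtain M w where w: "w \<in> stiefel m M" "frame_span m v = frame_span m w"
    and P: "span_proj m (frame_span m v) = proj m (\<lambda>j. emb (w j))"
    unfolding span_proj_def by blast
  have "blinfun_apply (proj m (\<lambda>j. emb (w j))) (emb (v j)) = emb (v j)" if j: "j < m" for j
  proof -
    have "v j \<in> frame_span m v"
      unfolding frame_span_def using unit_seq_cspace[OF j] frame_comb_unit[OF j, of v] by (metis imageI)
    then obtain z where "v j = frame_comb m w z" unfolding w(2) unfolding frame_span_def by blast
    then have "emb (v j) = (\<Sum>i<m. scaleC_ell2 (z i) (emb (w i)))" using emb_frame_comb[OF w(1)] by simp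
    then show ?thesis using proj_comb[OF orthonormal_emb[OF w(1)], of z] by simp
  qed
  from proj_eqI[OF orthonormal_emb[OF w(1)] orthonormal_emb[OF v] this] P show ?thesis by simp
qed

lemma topspace_BU: "topspace (BU m) = (\<Union>N. frame_span m ` stiefel m N)"
  unfolding BU_def by (rule topspace_final_topology) auto

lemma is_rank_proj_span_proj: "V \<in> topspace (BU m) \<Longrightarrow> is_rank_proj m (span_proj m V)"
  unfolding topspace_BU using span_proj_frame_span orthonormal_emb by (fastforce simp: is_rank_proj_def)

text \<open>The topology of the classifying space is final with respect to the frames of the subspaces, and on frames
  the projection is a sum of products.\<close>

lemma continuous_map_span_proj: "continuous_map (BU m) euclidean (span_proj m)"
  unfolding BU_def
proof (rule continuous_map_from_final_topology)
  fix N
  have "continuous_on (stiefel m N) (\<lambda>v. emb (v j))" for j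
    by (rule continuous_on_compose2[OF continuous_on_emb])
       (auto intro: continuous_on_subset[OF continuous_on_product_coordinates] dest: stiefel_cspace)
  then have "continuous_on (stiefel m N) (\<lambda>v. proj m (\<lambda>j. emb (v j)))"
    unfolding proj_def by (intro continuous_on_sum outer.continuous_on)
  then have "continuous_on (stiefel m N) (\<lambda>v. span_proj m (frame_span m v))"
    by (rule continuous_on_eq) (simp add: span_proj_frame_span)
  then show "continuous_map (top_of_set (stiefel m N)) euclidean (\<lambda>v. span_proj m (frame_span m v))"
    by simp
qed auto


section \<open>Families of projections with frames that agree on a subset\<close>

text \<open>What remains of a homotopy relative to \<open>A\<close> when it is lifted to frames.  Such relations are composed
  without reparametrization.\<close>

definition frames_carry where
  "frames_carry r C A P P' \<longleftrightarrow> (\<forall>e. frame_on r C P e \<longrightarrow> (\<exists>e'. frame_on r C P' e' \<and> (\<forall>x\<in>A. \<forall>j<r. e' x j = e x j)))"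

definition frames_match where
  "frames_match r C A P P' \<longleftrightarrow> frames_carry r C A P P' \<and> frames_carry r C A P' P"

lemma frame_on_cong: "(\<And>x. x \<in> C \<Longrightarrow> P x = P' x) \<Longrightarrow> frame_on r C P e = frame_on r C P' e"
  by (auto simp: frame_on_def)

lemma frames_match_cong:
  assumes "\<And>x. x \<in> C \<Longrightarrow> P x = P1 x" "\<And>x. x \<in> C \<Longrightarrow> P' x = P1' x"
  shows "frames_match r C A P P' = frames_match r C A P1 P1'"
proof -
  have "frame_on r C P = frame_on r C P1" "frame_on r C P' = frame_on r C P1'"
    using frame_on_cong[of C P P1 r] frame_on_cong[of C P' P1' r] assms by blast+
  then show ?thesis by (simp only: frames_match_def frames_carry_def)
qed

lemma frames_match_sym: "frames_match r C A P P' \<Longrightarrow> frames_match r C A P' P"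
  by (auto simp: frames_match_def)

lemma frames_carry_trans:
  assumes "frames_carry r C A P P'" "frames_carry r C A P' P''" shows "frames_carry r C A P P''"
  unfolding frames_carry_def
proof (intro allI impI)
  fix e assume "frame_on r C P e"
  then obtain e' where e': "frame_on r C P' e'" "\<forall>x\<in>A. \<forall>j<r. e' x j = e x j"
    using assms(1) unfolding frames_carry_def by blast
  then obtain e'' where "frame_on r C P'' e''" "\<forall>x\<in>A. \<forall>j<r. e'' x j = e' x j"
    using assms(2) unfolding frames_carry_def by blast
  with e'(2) show "\<exists>e''. frame_on r C P'' e'' \<and> (\<forall>x\<in>A. \<forall>j<r. e'' x j = e x j)"
    by (intro exI[of _ e'']) simp
qed

lemma frames_match_trans: "frames_match r C A P P' \<Longrightarrow> frames_match r C A P' P'' \<Longrightarrow> frames_match r C A P P''"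
  unfolding frames_match_def using frames_carry_trans by blast

lemma frames_carry_homotopy:
  fixes C :: "'x::metric_space set" and H :: "real \<Rightarrow> 'x \<Rightarrow> (ell2 \<Rightarrow>\<^sub>L ell2)"
  assumes C: "compact C" "A \<subseteq> C" and H: "continuous_on ({0..1} \<times> C) (\<lambda>p. H (fst p) (snd p))"
    and pr: "\<And>t x. t \<in> {0..1} \<Longrightarrow> x \<in> C \<Longrightarrow> is_rank_proj r (H t x)"
    and rel: "\<And>t x. t \<in> {0..1} \<Longrightarrow> x \<in> A \<Longrightarrow> H t x = H 0 x"
  shows "frames_carry r C A (H 0) (H 1)"
  unfolding frames_carry_def
proof (intro allI impI)
  fix e assume "frame_on r C (H 0) e"
  from frame_on_homotopy[OF C(1) H pr this] obtain e' where e': "frame_on r C (H 1) e'"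
    "\<forall>x\<in>C. (\<forall>t\<in>{0..1}. H t x = H 0 x) \<longrightarrow> (\<forall>j<r. e' x j = e x j)" by blast
  have "\<forall>x\<in>A. \<forall>j<r. e' x j = e x j" using e'(2) rel C(2) by blast
  with e'(1) show "\<exists>e'. frame_on r C (H 1) e' \<and> (\<forall>x\<in>A. \<forall>j<r. e' x j = e x j)" by blast
qed

text \<open>Equivalence follows from the lifting of homotopies, applied to the homotopy and to its reverse.\<close>

lemma frames_match_homotopy:
  fixes C :: "'x::metric_space set" and H :: "real \<Rightarrow> 'x \<Rightarrow> (ell2 \<Rightarrow>\<^sub>L ell2)"
  assumes C: "compact C" "A \<subseteq> C" and H: "continuous_on ({0..1} \<times> C) (\<lambda>p. H (fst p) (snd p))"
    and pr: "\<And>t x. t \<in> {0..1} \<Longrightarrow> x \<in> C \<Longrightarrow> is_rank_proj r (H t x)"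
    and rel: "\<And>t x. t \<in> {0..1} \<Longrightarrow> x \<in> A \<Longrightarrow> H t x = H 0 x"
  shows "frames_match r C A (H 0) (H 1)"
proof -
  have "continuous_on ({0..1} \<times> C) (\<lambda>p. (\<lambda>p. H (fst p) (snd p)) (1 - fst p, snd p))"
    by (rule continuous_on_compose2[OF H]) (auto intro!: continuous_intros)
  then have H': "continuous_on ({0..1} \<times> C) (\<lambda>p. H (1 - fst p) (snd p))" by simp
  have rel': "H (1 - t) x = H (1 - 0) x" if "t \<in> {0..1}" "x \<in> A" for t x
  proof -
    have "H (1 - t) x = H 0 x" "H 1 x = H 0 x" using that by (auto intro!: rel)
    then show ?thesis by simp
  qed
  have "frames_carry r C A (H (1 - 0)) (H (1 - 1))"
    by (rule frames_carry_homotopy[OF C, of "\<lambda>t. H (1 - t)"]) (use H' pr rel' in auto)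
  moreover have "frames_carry r C A (H 0) (H 1)" by (rule frames_carry_homotopy[OF C H pr rel])
  ultimately show ?thesis by (simp add: frames_match_def)
qed

text \<open>If of two families one is constant where \<open>h \<ge> 1/2\<close> and the other one where \<open>h \<le> 1/2\<close>, then
  rotating the plane by a right angle, over the second region only, moves both nonconstant parts into the
  first summand; the rotation is not seen where both are constant.\<close>

lemma frames_match_rotate:
  fixes C :: "'x::metric_space set"
  assumes C: "compact C" "A \<subseteq> C" and h: "continuous_on C h"
    and P: "continuous_on C P" "\<And>x. x \<in> C \<Longrightarrow> is_rank_proj m (P x)" "\<And>x. x \<in> C \<Longrightarrow> h x \<ge> 1 / 2 \<Longrightarrow> P x = B"
    and Q: "continuous_on C Q" "\<And>x. x \<in> C \<Longrightarrow> is_rank_proj m (Q x)" "\<And>x. x \<in> C \<Longrightarrow> h x \<le> (1 / 2 :: real) \<Longrightarrow> Q x = B"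
    and A: "\<And>x. x \<in> A \<Longrightarrow> P x = B \<and> Q x = B"
  shows "frames_match (m + m) C A (\<lambda>x. plane_sum 0 (P x) (Q x)) (\<lambda>x. plane_sum 0 (if h x \<le> 1 / 2 then P x else Q x) B)"
proof -
  define H where "H t x = (if h x \<le> 1 / 2 then plane_sum 0 (P x) (Q x) else plane_sum (t * (pi / 2)) (P x) (Q x))" for t x
  have snd_C: "continuous_on ({0..1} \<times> C) (\<lambda>p. f (snd p))" if "continuous_on C f" for f :: "'x \<Rightarrow> 'z::topological_space"
    by (rule continuous_on_compose2[OF that]) (auto intro!: continuous_intros)
  have sub: "continuous_on T (\<lambda>p. plane_sum (g p) (P (snd p)) (Q (snd p)))"
    if "T \<subseteq> {0..1::real} \<times> C" "continuous_on ({0..1} \<times> C) g" for T and g :: "real \<times> 'x \<Rightarrow> real"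
    by (rule continuous_on_subset[OF continuous_on_plane_sum[OF that(2) snd_C[OF P(1)] snd_C[OF Q(1)]] that(1)])
  have "continuous_on ({0..1} \<times> C) (\<lambda>p. if h (snd p) \<le> 1 / 2 then plane_sum 0 (P (snd p)) (Q (snd p))
      else plane_sum (fst p * (pi / 2)) (P (snd p)) (Q (snd p)))"
  proof (rule continuous_on_cases_le)
    show "continuous_on ({0..1} \<times> C) (\<lambda>p. h (snd p))" by (rule snd_C[OF h])
    show "plane_sum 0 (P (snd p)) (Q (snd p)) = plane_sum (fst p * (pi / 2)) (P (snd p)) (Q (snd p))"
      if "p \<in> {0..1} \<times> C" "h (snd p) = 1 / 2" for p
    proof -
      have "P (snd p) = B" "Q (snd p) = B" using that P(3) Q(3) by auto
      then show ?thesis by (simp only: plane_sum_diag[of "fst p * (pi / 2)"])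
    qed
    show "continuous_on {p \<in> {0..1::real} \<times> C. h (snd p) \<le> 1 / 2} (\<lambda>p. plane_sum 0 (P (snd p)) (Q (snd p)))"
      by (rule sub[OF _ continuous_on_const]) blast
    show "continuous_on {p \<in> {0..1} \<times> C. 1 / 2 \<le> h (snd p)} (\<lambda>p. plane_sum (fst p * (pi / 2)) (P (snd p)) (Q (snd p)))"
      by (rule sub[OF _ continuous_on_mult_right[OF continuous_on_fst[OF continuous_on_id]]]) blast
  qed
  then have cH: "continuous_on ({0..1} \<times> C) (\<lambda>p. H (fst p) (snd p))" by (simp add: H_def)
  have "frames_match (m + m) C A (H 0) (H 1)"
  proof (rule frames_match_homotopy[OF C cH])
    show "is_rank_proj (m + m) (H t x)" if "x \<in> C" for t x
      using P(2)[OF that] Q(2)[OF that] by (simp add: H_def is_rank_proj_plane_sum)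
    show "H t x = H 0 x" if "x \<in> A" for t x
    proof -
      have "P x = B" "Q x = B" using A[OF that] by auto
      then show ?thesis
        by (simp only: H_def plane_sum_diag[of "t * (pi / 2)"] plane_sum_diag[of "0 * (pi / 2)"] if_cancel)
    qed
  qed
  also have "?this \<longleftrightarrow> ?thesis"
    by (rule frames_match_cong) (use P(3) Q(3) in \<open>auto simp: H_def plane_sum_quarter\<close>)
  finally show ?thesis .
qed


section \<open>Spheroids in the classifying space\<close>

lemma cube_eq: "cube m = top_of_set (topspace (cube m))"
  unfolding cube_def Euclidean_space_def euclidean_product_topology
  by (simp add: subtopology_subtopology)

lemma in_cube_iff: "x \<in> topspace (cube m) \<longleftrightarrow> (\<forall>i\<ge>m. x i = 0) \<and> (\<forall>i<m. 0 \<le> x i \<and> x i \<le> 1)"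
  unfolding cube_def topspace_subtopology topspace_Euclidean_space by auto

lemma compact_cube: "compact (topspace (cube m))"
proof -
  have "topspace (cube m) = PiE UNIV (\<lambda>i. if i < m then {0..1} else {0})"
  proof (rule Set.set_eqI)
    fix x :: "nat \<Rightarrow> real"
    have "(\<forall>i. x i \<in> (if i < m then {0..1} else {0})) \<longleftrightarrow> (\<forall>i. (m \<le> i \<longrightarrow> x i = 0) \<and> (i < m \<longrightarrow> 0 \<le> x i \<and> x i \<le> 1))"
      by (intro iff_allI) auto
    then show "x \<in> topspace (cube m) \<longleftrightarrow> x \<in> PiE UNIV (\<lambda>i. if i < m then {0..1} else {0})"
      unfolding in_cube_iff PiE_UNIV_domain Pi_iff by blast
  qed
  moreover have "compactin (product_topology (\<lambda>i. euclideanreal) UNIV) (PiE UNIV (\<lambda>i::nat. if i < m then {0..1} else {0}))"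
    by (simp add: compactin_PiE)
  ultimately show ?thesis by (simp add: euclidean_product_topology)
qed

lemma cube_boundary_subset: "cube_boundary m \<subseteq> topspace (cube m)"
  by (auto simp: cube_boundary_def)

lemma continuous_map_cube: "continuous_map (cube m) euclidean f \<longleftrightarrow> continuous_on (topspace (cube m)) f"
  by (metis cube_eq continuous_map_iff_continuous)

text \<open>Reparametrizations of the cube in the direction in which spheroids are joined.\<close>

definition reparam :: "(real \<Rightarrow> real) \<Rightarrow> (nat \<Rightarrow> real) \<Rightarrow> (nat \<Rightarrow> real)" where
  "reparam \<phi> x = x(0 := \<phi> (x 0))"

lemma reparam_cube:
  "m \<ge> 1 \<Longrightarrow> (\<And>s. s \<in> {0..1} \<Longrightarrow> \<phi> s \<in> {0..1}) \<Longrightarrow> x \<in> topspace (cube m) \<Longrightarrow> reparam \<phi> x \<in> topspace (cube m)"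
  by (auto simp: in_cube_iff reparam_def)

lemma reparam_boundary:
  "m \<ge> 1 \<Longrightarrow> (\<And>s. s \<in> {0..1} \<Longrightarrow> \<phi> s \<in> {0..1}) \<Longrightarrow> \<phi> 0 = 0 \<Longrightarrow> \<phi> 1 = 1 \<Longrightarrow>
   x \<in> cube_boundary m \<Longrightarrow> reparam \<phi> x \<in> cube_boundary m"
proof -
  assume m: "m \<ge> 1" and \<phi>: "\<And>s. s \<in> {0..1} \<Longrightarrow> \<phi> s \<in> {0..1}" "\<phi> 0 = 0" "\<phi> 1 = 1" and x: "x \<in> cube_boundary m"
  then obtain i where i: "i < m" "x i = 0 \<or> x i = 1" "x \<in> topspace (cube m)"
    unfolding cube_boundary_def by blast
  have "reparam \<phi> x \<in> topspace (cube m)" by (rule reparam_cube[OF m \<phi>(1) i(3)])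
  moreover have "reparam \<phi> x i = 0 \<or> reparam \<phi> x i = 1"
    using i(2) \<phi>(2,3) by (cases "i = 0") (auto simp: reparam_def)
  ultimately show "reparam \<phi> x \<in> cube_boundary m" using i(1) unfolding cube_boundary_def by blast
qed

lemma continuous_on_coordinate: "continuous_on S (\<lambda>x::nat \<Rightarrow> real. x i)"
  by (rule continuous_on_subset[OF continuous_on_product_coordinates]) simp

lemma continuous_on_reparam:
  assumes "continuous_on S f" "continuous_on S (\<lambda>x. \<phi> x (f x 0))"
  shows "continuous_on S (\<lambda>x. reparam (\<phi> x) (f x))"
proof (rule continuous_on_coordinatewise_then_product)
  fix i
  have "continuous_on S (\<lambda>x. f x i)"
    by (rule continuous_on_product_then_coordinatewise[OF assms(1)])
  then show "continuous_on S (\<lambda>x. reparam (\<phi> x) (f x) i)"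
    using assms(2) by (cases "i = 0") (auto simp: reparam_def)
qed

definition squeeze_left :: "real \<Rightarrow> real \<Rightarrow> real" where "squeeze_left t s = min 1 ((1 + t) * s)"
definition squeeze_right :: "real \<Rightarrow> real \<Rightarrow> real" where "squeeze_right t s = max 0 ((1 + t) * s - t)"

lemma continuous_on_squeeze:
  assumes "continuous_on S f" "continuous_on S g"
  shows "continuous_on S (\<lambda>x. squeeze_left (f x) (g x))" "continuous_on S (\<lambda>x. squeeze_right (f x) (g x))"
  unfolding squeeze_left_def squeeze_right_def
  by (intro continuous_on_min continuous_on_max continuous_on_diff continuous_on_mult continuous_on_add
      continuous_on_const assms)+

text \<open>For \<open>t\<close> from 0 to 1 these functions deform the identity of the interval, relative to the end points, to maps
  that are constant on the right and on the left half, respectively.\<close>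

lemma squeeze_left: "t \<in> {0..1} \<Longrightarrow> s \<in> {0..1} \<Longrightarrow> squeeze_left t s \<in> {0..1}"
  "t \<ge> 0 \<Longrightarrow> squeeze_left t 0 = 0" "t \<ge> 0 \<Longrightarrow> squeeze_left t 1 = 1"
  by (auto simp: squeeze_left_def)

lemma squeeze_right: "t \<in> {0..1} \<Longrightarrow> s \<in> {0..1} \<Longrightarrow> squeeze_right t s \<in> {0..1}"
  "t \<ge> 0 \<Longrightarrow> squeeze_right t 0 = 0" "t \<ge> 0 \<Longrightarrow> squeeze_right t 1 = 1"
proof -
  assume ts: "t \<in> {0..1}" "s \<in> {0..1}"
  then have "(1 + t) * s \<le> (1 + t) * 1" by (intro mult_left_mono) auto
  then show "squeeze_right t s \<in> {0..1}" by (auto simp: squeeze_right_def)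
qed (auto simp: squeeze_right_def)

lemma spheroid_D:
  assumes "spheroid m (BU m) b0 F"
  shows "continuous_on (topspace (cube m)) (\<lambda>x. span_proj m (F x))"
    "x \<in> topspace (cube m) \<Longrightarrow> is_rank_proj m (span_proj m (F x))"
    "x \<in> cube_boundary m \<Longrightarrow> F x = b0"
proof -
  have F: "continuous_map (cube m) (BU m) F" using assms by (simp add: spheroid_def)
  show "continuous_on (topspace (cube m)) (\<lambda>x. span_proj m (F x))"
    using continuous_map_compose[OF F continuous_map_span_proj] by (simp add: continuous_map_cube o_def)
  show "x \<in> topspace (cube m) \<Longrightarrow> is_rank_proj m (span_proj m (F x))"
    by (rule is_rank_proj_span_proj) (use continuous_map_funspace[OF F] in auto)
  show "x \<in> cube_boundary m \<Longrightarrow> F x = b0" using assms by (simp add: spheroid_def)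
qed

text \<open>The deformation of the interval sends the boundary of the cube into itself, so it is not seen there.\<close>

lemma frames_match_squeeze:
  assumes m: "m \<ge> 1" and F: "spheroid m (BU m) b0 F" and G: "spheroid m (BU m) b0 G"
  shows "frames_match (m + m) (topspace (cube m)) (cube_boundary m)
    (\<lambda>x. plane_sum 0 (span_proj m (F x)) (span_proj m (G x)))
    (\<lambda>x. plane_sum 0 (span_proj m (F (reparam (squeeze_left 1) x))) (span_proj m (G (reparam (squeeze_right 1) x))))"
proof -
  let ?C = "topspace (cube m)"
  define H where "H t x = plane_sum 0 (span_proj m (F (reparam (squeeze_left t) x))) (span_proj m (G (reparam (squeeze_right t) x)))" for t x
  let ?I = "{0..1::real} \<times> ?C"
  have c: "continuous_on ?I snd" "continuous_on ?I fst" "continuous_on ?I (\<lambda>p. snd p 0)"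
    by (intro continuous_on_snd continuous_on_fst continuous_on_id)+
       (rule continuous_on_compose2[OF continuous_on_coordinate[of ?C 0] continuous_on_snd[OF continuous_on_id]], auto)
  have cube: "reparam (squeeze_left t) x \<in> ?C" "reparam (squeeze_right t) x \<in> ?C" if "t \<in> {0..1}" "x \<in> ?C" for t x
    using reparam_cube[OF m squeeze_left(1)[OF that(1)] that(2)] reparam_cube[OF m squeeze_right(1)[OF that(1)] that(2)] by auto
  have "continuous_on ?I (\<lambda>p. span_proj m (F (reparam (squeeze_left (fst p)) (snd p))))"
    by (rule continuous_on_compose2[OF spheroid_D(1)[OF F] continuous_on_reparam[where \<phi> = "\<lambda>p. squeeze_left (fst p)", OF c(1) continuous_on_squeeze(1)[OF c(2,3)]]])
       (use cube in force)
  moreover have "continuous_on ?I (\<lambda>p. span_proj m (G (reparam (squeeze_right (fst p)) (snd p))))"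
    by (rule continuous_on_compose2[OF spheroid_D(1)[OF G] continuous_on_reparam[where \<phi> = "\<lambda>p. squeeze_right (fst p)", OF c(1) continuous_on_squeeze(2)[OF c(2,3)]]])
       (use cube in force)
  ultimately have cH: "continuous_on ({0..1} \<times> ?C) (\<lambda>p. H (fst p) (snd p))"
    unfolding H_def by (intro continuous_on_plane_sum continuous_on_const)
  have "frames_match (m + m) ?C (cube_boundary m) (H 0) (H 1)"
  proof (rule frames_match_homotopy[OF compact_cube cube_boundary_subset cH])
    show "is_rank_proj (m + m) (H t x)" if "t \<in> {0..1}" "x \<in> ?C" for t x
      unfolding H_def by (intro is_rank_proj_plane_sum spheroid_D(2)[OF F] spheroid_D(2)[OF G] cube that)
    have "H t x = plane_sum 0 (span_proj m b0) (span_proj m b0)" if "t \<in> {0..1}" "x \<in> cube_boundary m" for t x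
    proof -
      have "reparam (squeeze_left t) x \<in> cube_boundary m"
        by (rule reparam_boundary[OF m]) (use that squeeze_left in auto)
      moreover have "reparam (squeeze_right t) x \<in> cube_boundary m"
        by (rule reparam_boundary[OF m]) (use that squeeze_right in auto)
      ultimately show ?thesis by (simp add: H_def spheroid_D(3)[OF F] spheroid_D(3)[OF G])
    qed
    then show "H t x = H 0 x" if "t \<in> {0..1}" "x \<in> cube_boundary m" for t x
      using that by simp
  qed
  also have "?this \<longleftrightarrow> ?thesis"
  proof (rule frames_match_cong)
    fix x assume x: "x \<in> ?C"
    have "0 \<le> x 0 \<and> x 0 \<le> 1" using x m by (auto simp: in_cube_iff)
    then have "reparam (squeeze_left 0) x = x" "reparam (squeeze_right 0) x = x"
      by (auto simp: reparam_def squeeze_left_def squeeze_right_def fun_eq_iff)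
    then show "H 0 x = plane_sum 0 (span_proj m (F x)) (span_proj m (G x))" by (simp add: H_def)
  qed (simp add: H_def)
  finally show ?thesis .
qed

lemma spheroid_join_eq:
  assumes "m \<ge> 1" "x \<in> topspace (cube m)"
  shows "spheroid_join F G x = (if x 0 \<le> 1 / 2 then F (reparam (squeeze_left 1) x) else G (reparam (squeeze_right 1) x))"
  by (auto simp: spheroid_join_def reparam_def squeeze_left_def squeeze_right_def min_def max_def intro!: arg_cong[of _ _ F] arg_cong[of _ _ G])

lemma squeeze_constant:
  assumes m: "m \<ge> 1" and F: "spheroid m (BU m) b0 F" and x: "x \<in> topspace (cube m)"
  shows "x 0 \<ge> 1 / 2 \<Longrightarrow> F (reparam (squeeze_left 1) x) = b0"
    and "x 0 \<le> 1 / 2 \<Longrightarrow> F (reparam (squeeze_right 1) x) = b0"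
proof -
  have in_cube: "reparam (squeeze_left 1) x \<in> topspace (cube m)" "reparam (squeeze_right 1) x \<in> topspace (cube m)"
    using x squeeze_left squeeze_right by (auto intro!: reparam_cube[OF m])
  show "F (reparam (squeeze_left 1) x) = b0" if "x 0 \<ge> 1 / 2"
  proof (rule spheroid_D(3)[OF F])
    have "reparam (squeeze_left 1) x 0 = 1" using that by (simp add: reparam_def squeeze_left_def)
    then show "reparam (squeeze_left 1) x \<in> cube_boundary m"
      using in_cube m unfolding cube_boundary_def by (auto intro!: exI[of _ 0])
  qed
  show "F (reparam (squeeze_right 1) x) = b0" if "x 0 \<le> 1 / 2"
  proof (rule spheroid_D(3)[OF F])
    have "reparam (squeeze_right 1) x 0 = 0" using that by (simp add: reparam_def squeeze_right_def)
    then show "reparam (squeeze_right 1) x \<in> cube_boundary m"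
      using in_cube m unfolding cube_boundary_def by (auto intro!: exI[of _ 0])
  qed
qed

lemma continuous_map_reparam:
  assumes "m \<ge> 1" "continuous_on {0..1} \<phi>" "\<And>s. s \<in> {0..1} \<Longrightarrow> \<phi> s \<in> {0..1}"
  shows "continuous_map (cube m) (cube m) (reparam \<phi>)"
proof -
  have "continuous_on (topspace (cube m)) (\<lambda>x. \<phi> (x 0))"
    using assms(1) by (intro continuous_on_compose2[OF assms(2) continuous_on_coordinate]) (auto simp: in_cube_iff)
  then have "continuous_on (topspace (cube m)) (\<lambda>x. reparam \<phi> x)"
    by (intro continuous_on_reparam continuous_on_id)
  then have "continuous_map (top_of_set (topspace (cube m))) (top_of_set (topspace (cube m))) (reparam \<phi>)"
    using reparam_cube[OF assms(1,3)] by auto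
  then show ?thesis by (simp flip: cube_eq)
qed

lemma continuous_squeeze: "continuous_on S (squeeze_left t)" "continuous_on S (squeeze_right t)"
  by (intro continuous_on_squeeze continuous_on_const continuous_on_id)+

lemma spheroid_spheroid_join:
  assumes m: "m \<ge> 1" and F: "spheroid m (BU m) b0 F" and G: "spheroid m (BU m) b0 G"
  shows "spheroid m (BU m) b0 (spheroid_join F G)"
proof -
  have c: "continuous_map (cube m) (BU m) (\<lambda>x. F (reparam (squeeze_left 1) x))"
      "continuous_map (cube m) (BU m) (\<lambda>x. G (reparam (squeeze_right 1) x))"
    using continuous_map_compose[OF continuous_map_reparam[OF m continuous_squeeze(1)], of 1 "BU m" F]
      continuous_map_compose[OF continuous_map_reparam[OF m continuous_squeeze(2)], of 1 "BU m" G]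
      squeeze_left(1)[of 1] squeeze_right(1)[of 1] F G by (auto simp: spheroid_def o_def)
  have "continuous_on (topspace (cube m)) (\<lambda>x. x 0)" by (rule continuous_on_coordinate)
  then have c0: "continuous_map (cube m) euclideanreal (\<lambda>x. x 0)" by (simp add: continuous_map_cube)
  have "continuous_map (cube m) (BU m)
     (\<lambda>x. if x 0 \<le> 1 / 2 then F (reparam (squeeze_left 1) x) else G (reparam (squeeze_right 1) x))"
    by (rule continuous_map_cases_le[OF c0])
       (use squeeze_constant[OF m F] squeeze_constant[OF m G] in \<open>auto intro: continuous_map_from_subtopology c\<close>)
  then have "continuous_map (cube m) (BU m) (spheroid_join F G)"
    by (rule continuous_map_eq) (simp add: spheroid_join_eq[OF m])
  moreover have "spheroid_join F G x = b0" if x: "x \<in> cube_boundary m" for x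
  proof -
    have "x \<in> topspace (cube m)" using x cube_boundary_subset by blast
    moreover have "reparam (squeeze_left 1) x \<in> cube_boundary m"
      by (rule reparam_boundary[OF m]) (use x squeeze_left in auto)
    moreover have "reparam (squeeze_right 1) x \<in> cube_boundary m"
      by (rule reparam_boundary[OF m]) (use x squeeze_right in auto)
    ultimately show ?thesis using spheroid_D(3)[OF F] spheroid_D(3)[OF G] by (simp add: spheroid_join_eq[OF m])
  qed
  ultimately show ?thesis by (simp add: spheroid_def)
qed

text \<open>The argument of Eckmann and Hilton, with the rotation of the plane in place of a second
  composition law.\<close>

lemma frames_match_join:
  assumes m: "m \<ge> 1" and F: "spheroid m (BU m) b0 F" and G: "spheroid m (BU m) b0 G"
  shows "frames_match (m + m) (topspace (cube m)) (cube_boundary m)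
    (\<lambda>x. plane_sum 0 (span_proj m (F x)) (span_proj m (G x))) (\<lambda>x. plane_sum 0 (span_proj m (spheroid_join F G x)) (span_proj m b0))"
proof (rule frames_match_trans[OF frames_match_squeeze[OF m F G]])
  let ?C = "topspace (cube m)"
  let ?P = "\<lambda>x. span_proj m (F (reparam (squeeze_left 1) x))" and ?Q = "\<lambda>x. span_proj m (G (reparam (squeeze_right 1) x))"
  have lr: "continuous_on ?C (reparam (squeeze_left 1))" "continuous_on ?C (reparam (squeeze_right 1))"
    by (intro continuous_on_reparam continuous_on_squeeze continuous_on_id continuous_on_const continuous_on_coordinate)+
  have in_cube: "reparam (squeeze_left 1) x \<in> ?C" "reparam (squeeze_right 1) x \<in> ?C" if "x \<in> ?C" for x
    using that squeeze_left squeeze_right by (auto intro!: reparam_cube[OF m])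
  have bd: "reparam (squeeze_left 1) x \<in> cube_boundary m" "reparam (squeeze_right 1) x \<in> cube_boundary m"
    if "x \<in> cube_boundary m" for x
    using that squeeze_left squeeze_right by (auto intro!: reparam_boundary[OF m])
  have "frames_match (m + m) ?C (cube_boundary m) (\<lambda>x. plane_sum 0 (?P x) (?Q x)) (\<lambda>x. plane_sum 0 (if x 0 \<le> 1 / 2 then ?P x else ?Q x) (span_proj m b0))"
  proof (rule frames_match_rotate[OF compact_cube cube_boundary_subset])
    show "continuous_on ?C (\<lambda>x. x 0)" by (rule continuous_on_coordinate)
    show "continuous_on ?C ?P"
      by (rule continuous_on_compose2[OF spheroid_D(1)[OF F] lr(1)]) (use in_cube in auto)
    show "continuous_on ?C ?Q"
      by (rule continuous_on_compose2[OF spheroid_D(1)[OF G] lr(2)]) (use in_cube in auto)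
  qed (use in_cube bd in \<open>auto simp: squeeze_constant[OF m F] squeeze_constant[OF m G] spheroid_D(3)[OF F] spheroid_D(3)[OF G]
        intro: spheroid_D(2)[OF F] spheroid_D(2)[OF G]\<close>)
  also have "?this \<longleftrightarrow> frames_match (m + m) ?C (cube_boundary m) (\<lambda>x. plane_sum 0 (?P x) (?Q x)) (\<lambda>x. plane_sum 0 (span_proj m (spheroid_join F G x)) (span_proj m b0))"
    by (rule frames_match_cong) (auto simp: spheroid_join_eq[OF m])
  finally show "frames_match (m + m) ?C (cube_boundary m) (\<lambda>x. plane_sum 0 (?P x) (?Q x)) (\<lambda>x. plane_sum 0 (span_proj m (spheroid_join F G x)) (span_proj m b0))" .
qed

lemma homotopic_spheroids_span_proj:
  assumes "homotopic_with (\<lambda>h. \<forall>x\<in>cube_boundary m. h x = b0) (cube m) (BU m) F G"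
  shows "\<exists>H :: real \<Rightarrow> (nat \<Rightarrow> real) \<Rightarrow> (ell2 \<Rightarrow>\<^sub>L ell2).
    continuous_on ({0..1} \<times> topspace (cube m)) (\<lambda>p. H (fst p) (snd p)) \<and>
    (\<forall>t\<in>{0..1}. \<forall>x\<in>topspace (cube m). is_rank_proj m (H t x)) \<and>
    (\<forall>t\<in>{0..1}. \<forall>x\<in>cube_boundary m. H t x = span_proj m b0) \<and>
    (\<forall>x. H 0 x = span_proj m (F x)) \<and> (\<forall>x. H 1 x = span_proj m (G x))"
proof -
  obtain h where h: "continuous_map (prod_topology (top_of_set {0..1::real}) (cube m)) (BU m) h"
    "\<forall>x. h (0, x) = F x" "\<forall>x. h (1, x) = G x" "\<forall>t\<in>{0..1}. \<forall>x\<in>cube_boundary m. h (t, x) = b0"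
    using assms unfolding homotopic_with_def by (elim exE conjE)
  have top: "prod_topology (top_of_set {0..1}) (cube m) = top_of_set ({0..1::real} \<times> topspace (cube m))"
    unfolding prod_topology_subtopology_eu[symmetric] cube_eq[symmetric] ..
  show ?thesis
  proof (intro exI[of _ "\<lambda>t x. span_proj m (h (t, x))"] conjI ballI allI)
    show "continuous_on ({0..1} \<times> topspace (cube m)) (\<lambda>p. span_proj m (h (fst p, snd p)))"
      using continuous_map_compose[OF h(1) continuous_map_span_proj] unfolding top by (simp add: o_def)
    show "is_rank_proj m (span_proj m (h (t, x)))" if "t \<in> {0..1}" "x \<in> topspace (cube m)" for t x
      by (rule is_rank_proj_span_proj) (use continuous_map_funspace[OF h(1)] that in \<open>auto simp: Pi_iff\<close>)
  qed (use h in simp_all)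
qed

lemma frames_match_homotopic:
  assumes "homotopic_with (\<lambda>h. \<forall>x\<in>cube_boundary m. h x = b0) (cube m) (BU m) F G"
  shows "frames_match m (topspace (cube m)) (cube_boundary m) (\<lambda>x. span_proj m (F x)) (\<lambda>x. span_proj m (G x))"
proof -
  from homotopic_spheroids_span_proj[OF assms]
  obtain H :: "real \<Rightarrow> (nat \<Rightarrow> real) \<Rightarrow> (ell2 \<Rightarrow>\<^sub>L ell2)"
    where H: "continuous_on ({0..1} \<times> topspace (cube m)) (\<lambda>p. H (fst p) (snd p))"
    "\<And>t x. t \<in> {0..1} \<Longrightarrow> x \<in> topspace (cube m) \<Longrightarrow> is_rank_proj m (H t x)"
    "\<And>t x. t \<in> {0..1} \<Longrightarrow> x \<in> cube_boundary m \<Longrightarrow> H t x = span_proj m b0"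
    "\<And>x. H 0 x = span_proj m (F x)" "\<And>x. H 1 x = span_proj m (G x)"
    by blast
  have "frames_match m (topspace (cube m)) (cube_boundary m) (H 0) (H 1)"
    by (rule frames_match_homotopy[OF compact_cube cube_boundary_subset H(1) H(2)]) (simp_all add: H(3))
  moreover have "H 0 = (\<lambda>x. span_proj m (F x))" "H 1 = (\<lambda>x. span_proj m (G x))" using H(4,5) by auto
  ultimately show ?thesis by simp
qed

lemma frames_match_homotopic_plane_sum:
  assumes "homotopic_with (\<lambda>h. \<forall>x\<in>cube_boundary m. h x = b0) (cube m) (BU m) F G" and B: "is_rank_proj m B"
  shows "frames_match (m + m) (topspace (cube m)) (cube_boundary m) (\<lambda>x. plane_sum 0 (span_proj m (F x)) B) (\<lambda>x. plane_sum 0 (span_proj m (G x)) B)"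
proof -
  from homotopic_spheroids_span_proj[OF assms(1)]
  obtain H :: "real \<Rightarrow> (nat \<Rightarrow> real) \<Rightarrow> (ell2 \<Rightarrow>\<^sub>L ell2)"
    where H: "continuous_on ({0..1} \<times> topspace (cube m)) (\<lambda>p. H (fst p) (snd p))"
    "\<And>t x. t \<in> {0..1} \<Longrightarrow> x \<in> topspace (cube m) \<Longrightarrow> is_rank_proj m (H t x)"
    "\<And>t x. t \<in> {0..1} \<Longrightarrow> x \<in> cube_boundary m \<Longrightarrow> H t x = span_proj m b0"
    "\<And>x. H 0 x = span_proj m (F x)" "\<And>x. H 1 x = span_proj m (G x)"
    by blast
  have "frames_match (m + m) (topspace (cube m)) (cube_boundary m) (\<lambda>x. plane_sum 0 (H 0 x) B) (\<lambda>x. plane_sum 0 (H 1 x) B)"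
  proof (rule frames_match_homotopy[OF compact_cube cube_boundary_subset, where H = "\<lambda>t x. plane_sum 0 (H t x) B"])
    show "continuous_on ({0..1} \<times> topspace (cube m)) (\<lambda>p. plane_sum 0 (H (fst p) (snd p)) B)"
      by (rule continuous_on_plane_sum[OF continuous_on_const H(1) continuous_on_const])
  qed (simp_all add: H(3) is_rank_proj_plane_sum[OF H(2) B])
  then show ?thesis by (simp add: H(4,5))
qed


section \<open>The group law and direct sums\<close>

lemma homotopy_group_element:
  assumes "C \<in> carrier (homotopy_group m X x0)"
  obtains h where "C = spheroid_class m X x0 h"
  using assms by (auto simp: homotopy_group_def)

lemma mem_spheroid_class:
  "F \<in> spheroid_class m X x0 h \<longleftrightarrow> homotopic_with (\<lambda>h. \<forall>x\<in>cube_boundary m. h x = x0) (cube m) X h F"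
  by (simp add: spheroid_class_def)

lemma spheroid_of_class: "F \<in> spheroid_class m X x0 h \<Longrightarrow> spheroid m X x0 F"
  unfolding mem_spheroid_class spheroid_def
  using homotopic_with_imp_continuous_maps homotopic_with_imp_property by blast

lemma self_mem_spheroid_class: "spheroid m X x0 F \<Longrightarrow> F \<in> spheroid_class m X x0 F"
  by (simp add: mem_spheroid_class spheroid_def)

lemma spheroid_class_eq: "F \<in> spheroid_class m X x0 h \<Longrightarrow> spheroid_class m X x0 F = spheroid_class m X x0 h"
  unfolding set_eq_iff mem_spheroid_class by (meson homotopic_with_symD homotopic_with_trans)

context
  fixes m :: nat and b0 :: "(nat \<Rightarrow> complex) set" and \<iota> :: "int \<Rightarrow> ((nat \<Rightarrow> real) \<Rightarrow> (nat \<Rightarrow> complex) set) set"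
  assumes m: "m \<ge> 1" and \<iota>: "\<iota> \<in> iso integer_group (homotopy_group m (BU m) b0)"
begin

lemma class_spheroid: "F \<in> \<iota> k \<Longrightarrow> spheroid m (BU m) b0 F"
proof -
  assume F: "F \<in> \<iota> k"
  have "\<iota> k \<in> carrier (homotopy_group m (BU m) b0)"
    using \<iota> by (auto simp: iso_def bij_betw_def)
  then show ?thesis using F spheroid_of_class by (metis homotopy_group_element)
qed

lemma class_eq: "F \<in> \<iota> k \<Longrightarrow> \<iota> k = spheroid_class m (BU m) b0 F"
proof -
  assume F: "F \<in> \<iota> k"
  have "\<iota> k \<in> carrier (homotopy_group m (BU m) b0)"
    using \<iota> by (auto simp: iso_def bij_betw_def)
  then show ?thesis using F spheroid_class_eq by (metis homotopy_group_element)
qed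

lemma join_class:
  assumes F: "F \<in> \<iota> p" and G: "G \<in> \<iota> q"
  shows "spheroid_join F G \<in> \<iota> (p + q)"
proof -
  have "\<iota> (p + q) = \<iota> p \<otimes>\<^bsub>homotopy_group m (BU m) b0\<^esub> \<iota> q"
    using \<iota> hom_mult[of \<iota> integer_group "homotopy_group m (BU m) b0" p q] by (simp add: iso_def)
  also have "\<dots> = (\<Union>f\<in>\<iota> p. \<Union>g\<in>\<iota> q. spheroid_class m (BU m) b0 (spheroid_join f g))"
    by (simp add: homotopy_group_def)
  finally show ?thesis
    using F G self_mem_spheroid_class[OF spheroid_spheroid_join[OF m class_spheroid[OF F] class_spheroid[OF G]]] by blast
qed

lemma class_homotopic:
  "F \<in> \<iota> k \<Longrightarrow> G \<in> \<iota> k \<Longrightarrow> homotopic_with (\<lambda>h. \<forall>x\<in>cube_boundary m. h x = b0) (cube m) (BU m) F G"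
  using class_eq[of F k] mem_spheroid_class[of G] by simp

text \<open>The constant map is its own join, so it represents the only idempotent class.\<close>

lemma const_class:
  assumes b0: "b0 \<in> topspace (BU m)"
  shows "(\<lambda>_. b0) \<in> \<iota> 0"
proof -
  have s: "spheroid m (BU m) b0 (\<lambda>_. b0)" using b0 by (simp add: spheroid_def)
  then have "spheroid_class m (BU m) b0 (\<lambda>_. b0) \<in> carrier (homotopy_group m (BU m) b0)"
    by (simp add: homotopy_group_def)
  then have "spheroid_class m (BU m) b0 (\<lambda>_. b0) \<in> range \<iota>"
    using \<iota> by (simp add: iso_def bij_betw_def)
  then obtain k where k: "\<iota> k = spheroid_class m (BU m) b0 (\<lambda>_. b0)" by (metis imageE)
  then have ck: "(\<lambda>_. b0) \<in> \<iota> k" using self_mem_spheroid_class[OF s] by simp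
  have "spheroid_join (\<lambda>_. b0) (\<lambda>_. b0) = (\<lambda>_. b0)" by (simp add: spheroid_join_def)
  then have "(\<lambda>_. b0) \<in> \<iota> (k + k)" using join_class[OF ck ck] by simp
  then have "\<iota> (k + k) = \<iota> k" using class_eq ck by metis
  moreover have "inj \<iota>" using \<iota> by (simp add: iso_def bij_betw_def)
  ultimately have "k + k = k" by (simp only: inj_eq)
  then show ?thesis using ck by simp
qed

text \<open>Both sums are equivalent to the sum of a join and a constant, and the joins are homotopic as they represent
  the same class.\<close>

lemma frames_match_class_sum:
  assumes b0: "b0 \<in> topspace (BU m)"
    and FG: "F \<in> \<iota> p" "G \<in> \<iota> q" and FG': "F' \<in> \<iota> p'" "G' \<in> \<iota> q'" and eq: "p + q = p' + q'"
  shows "frames_match (m + m) (topspace (cube m)) (cube_boundary m)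
    (\<lambda>x. plane_sum 0 (span_proj m (F x)) (span_proj m (G x))) (\<lambda>x. plane_sum 0 (span_proj m (F' x)) (span_proj m (G' x)))"
proof -
  have "spheroid_join F' G' \<in> \<iota> (p + q)" using join_class[OF FG'] eq by simp
  note class_homotopic[OF join_class[OF FG] this]
  note frames_match_homotopic_plane_sum[OF this is_rank_proj_span_proj[OF b0]]
  note frames_match_trans[OF frames_match_join[OF m class_spheroid[OF FG(1)] class_spheroid[OF FG(2)]] this]
  from frames_match_trans[OF this frames_match_sym[OF frames_match_join[OF m class_spheroid[OF FG'(1)] class_spheroid[OF FG'(2)]]]]
  show ?thesis .
qed

lemma frames_match_class_zero:
  assumes b0: "b0 \<in> topspace (BU m)" and F: "F \<in> \<iota> 0"
  shows "frames_match m (topspace (cube m)) (cube_boundary m) (\<lambda>x. span_proj m (F x)) (\<lambda>_. span_proj m b0)"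
  using frames_match_homotopic[OF class_homotopic[OF F const_class[OF b0]]] .

end

text \<open>The cube is contractible, so a frame at the origin spreads over the whole cube.\<close>

lemma frame_on_cube_exists:
  assumes P: "continuous_on (topspace (cube m)) P" "\<And>x. x \<in> topspace (cube m) \<Longrightarrow> is_rank_proj r (P x)"
  shows "\<exists>e. frame_on r (topspace (cube m)) P e"
proof -
  let ?C = "topspace (cube m)"
  have in_cube: "(\<lambda>i. t * x i) \<in> ?C" if "t \<in> {0..1}" "x \<in> ?C" for t x
    using that by (auto simp: in_cube_iff mult_le_one)
  define H where "H t x = P (\<lambda>i. t * x i)" for t x
  have "continuous_on ({0..1} \<times> ?C) (\<lambda>p. P (\<lambda>i. fst p * snd p i))"
  proof (rule continuous_on_compose2[OF P(1)])
    show "continuous_on ({0..1} \<times> ?C) (\<lambda>p i. fst p * snd p i)"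
      by (rule continuous_on_coordinatewise_then_product)
         (rule continuous_on_mult[OF continuous_on_fst[OF continuous_on_id]
            continuous_on_compose2[OF continuous_on_coordinate[of UNIV] continuous_on_snd[OF continuous_on_id]]], simp)
  qed (use in_cube in auto)
  then have H: "continuous_on ({0..1} \<times> ?C) (\<lambda>p. H (fst p) (snd p))" by (simp add: H_def)
  have "(\<lambda>_. 0) \<in> ?C" by (simp add: in_cube_iff)
  then obtain v where v: "orthonormal r v" "P (\<lambda>_. 0) = proj r v" using P(2) by (force simp: is_rank_proj_def)
  then have "frame_on r ?C (H 0) (\<lambda>_. v)" by (simp add: frame_on_def H_def)
  moreover have "is_rank_proj r (H t x)" if "t \<in> {0..1}" "x \<in> ?C" for t x
    unfolding H_def by (rule P(2)[OF in_cube[OF that]])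
  ultimately obtain e where "frame_on r ?C (H 1) e" using frame_on_homotopy[OF compact_cube H] by blast
  moreover have "H 1 = P" by (simp add: H_def[abs_def])
  ultimately show ?thesis by auto
qed


section \<open>Descent from the cube to the sphere\<close>

lemma nsphere_eq: "nsphere m = top_of_set (topspace (nsphere m))"
  unfolding nsphere_def Euclidean_space_def euclidean_product_topology
  by (simp add: subtopology_subtopology)

lemma subtopology_nsphere: "U \<subseteq> topspace (nsphere m) \<Longrightarrow> subtopology (nsphere m) U = top_of_set U"
  by (metis nsphere_eq subtopology_subtopology inf.absorb_iff2 inf_commute)

lemma Hausdorff_nsphere: "Hausdorff_space (nsphere m)"
  unfolding nsphere_def by (intro Hausdorff_space_subtopology Hausdorff_Euclidean_space)

lemma quotient_cube_collapse:
  assumes q: "cube_collapse m s0 q"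
  shows "quotient_map (cube m) (nsphere m) q"
proof (rule T1_Spaces.continuous_imp_quotient_map)
  show c: "continuous_map (cube m) (nsphere m) q" using q by (simp add: cube_collapse_def)
  show "compact_space (cube m)"
    using compact_cube[of m] cube_eq[of m] by (metis compact_space_subtopology compactin_euclidean_iff)
  show "q ` topspace (cube m) = topspace (nsphere m)"
  proof
    show "q ` topspace (cube m) \<subseteq> topspace (nsphere m)"
      by (rule continuous_map_image_subset_topspace[OF c])
    have "topspace (nsphere m) - {s0} \<subseteq> q ` topspace (cube m)"
      using q unfolding cube_collapse_def bij_betw_def by blast
    moreover have "s0 \<in> q ` topspace (cube m)"
      using q cube_boundary_subset[of m] unfolding cube_collapse_def by blast
    ultimately show "topspace (nsphere m) \<subseteq> q ` topspace (cube m)" by blast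
  qed
qed (rule Hausdorff_nsphere)

text \<open>The sphere is a quotient of the cube, and so is each open subset of it of its preimage.\<close>

lemma continuous_on_descent:
  fixes g :: "(nat \<Rightarrow> real) \<Rightarrow> 'a::topological_space"
  assumes q: "cube_collapse m s0 q" and U: "openin (nsphere m) U"
    and g: "continuous_on {x \<in> topspace (cube m). q x \<in> U} (\<lambda>x. g (q x))"
  shows "continuous_on U g"
proof -
  let ?U = "{x \<in> topspace (cube m). q x \<in> U}"
  have sub: "U \<subseteq> topspace (nsphere m)" by (rule openin_subset[OF U])
  have "quotient_map (subtopology (cube m) ?U) (subtopology (nsphere m) U) q"
    by (rule quotient_map_restriction[OF quotient_cube_collapse[OF q]]) (use U in auto)
  moreover have "subtopology (cube m) ?U = top_of_set ?U"
    by (metis (no_types, lifting) cube_eq subtopology_subtopology inf.absorb_iff2 mem_Collect_eq subsetI)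
  ultimately have "quotient_map (top_of_set ?U) (top_of_set U) q"
    by (simp add: subtopology_nsphere[OF sub])
  then have "continuous_map (top_of_set U) euclidean g"
    by (rule continuous_compose_quotient_map) (use g in \<open>simp add: o_def\<close>)
  then show ?thesis by simp
qed

text \<open>The only identifications are those on the boundary.\<close>

lemma cube_collapse_eqD:
  assumes q: "cube_collapse m s0 q" and xy: "x \<in> topspace (cube m)" "y \<in> topspace (cube m)" "q x = q y"
  shows "x = y \<or> (x \<in> cube_boundary m \<and> y \<in> cube_boundary m)"
proof -
  let ?I = "topspace (cube m) - cube_boundary m"
  have b: "bij_betw q ?I (topspace (nsphere m) - {s0})" and s: "q ` cube_boundary m = {s0}"
    using q by (simp_all add: cube_collapse_def)
  have i: "q z \<noteq> s0" if "z \<in> ?I" for z using bij_betwE[OF b] that by blast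
  have "q z = s0" if "z \<in> cube_boundary m" for z using s that by blast
  then have "x \<in> cube_boundary m \<longleftrightarrow> y \<in> cube_boundary m" using i xy by (metis DiffI)
  then show ?thesis using xy b unfolding bij_betw_def inj_on_def by blast
qed

text \<open>Frames of two families over the cube that agree on the boundary define an isometry between the
  fibres over each point of the sphere; it is well defined over the image of the boundary, where it is the
  identity.  Its matrices with respect to local frames are continuous since the sphere is a quotient of
  the cube.\<close>

lemma isometries_from_frames_match:
  fixes V W :: "(nat \<Rightarrow> real) \<Rightarrow> (ell2 \<Rightarrow>\<^sub>L ell2)" and v w :: "'c \<Rightarrow> (nat \<Rightarrow> real) \<Rightarrow> nat \<Rightarrow> ell2"
  assumes q: "cube_collapse m s0 q" and N: "\<And>c. openin (nsphere m) (N c)"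
    and V: "continuous_on (topspace (cube m)) (\<lambda>x. V (q x))" "\<And>x. x \<in> topspace (cube m) \<Longrightarrow> is_rank_proj r (V (q x))"
    and frames_match: "frames_match r (topspace (cube m)) (cube_boundary m) (\<lambda>x. V (q x)) (\<lambda>x. W (q x))"
    and v: "\<And>c. frame_on r (N c) V (v c)" and w: "\<And>c. frame_on r (N c) W (w c)"
  shows "\<exists>M K. (\<forall>c. (\<forall>i<r. \<forall>j<r. continuous_on (N c) (\<lambda>s. M c s i j)) \<and>
     (\<forall>s\<in>N c. M c s \<in> unitary_matrices r \<and>
        (\<forall>z. (\<Sum>i<r. scaleC_ell2 (matrix_act r (M c s) z i) (w c s i)) = K s (\<Sum>j<r. scaleC_ell2 (z j) (v c s j)))))"
proof -
  let ?C = "topspace (cube m)"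
  obtain e where e: "frame_on r ?C (\<lambda>x. V (q x)) e" using frame_on_cube_exists[OF V] by blast
  then obtain e' where e': "frame_on r ?C (\<lambda>x. W (q x)) e'" "\<forall>x\<in>cube_boundary m. \<forall>j<r. e' x j = e x j"
    using frames_match unfolding frames_match_def frames_carry_def by blast
  have qC: "q ` ?C = topspace (nsphere m)"
    by (rule quotient_imp_surjective_map[OF quotient_cube_collapse[OF q]])
  have eo: "orthonormal r (e x)" "proj r (e x) = V (q x)" if "x \<in> ?C" for x using e that by (simp_all add: frame_on_def)
  have e'o: "orthonormal r (e' x)" "proj r (e' x) = W (q x)" if "x \<in> ?C" for x using e' that by (simp_all add: frame_on_def)
  have vo: "orthonormal r (v c s)" "proj r (v c s) = V s" if "s \<in> N c" for c s using v[of c] that by (simp_all add: frame_on_def)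
  have wo: "orthonormal r (w c s)" "proj r (w c s) = W s" if "s \<in> N c" for c s using w[of c] that by (simp_all add: frame_on_def)
  \<comment> \<open>The isometry between the fibres over \<open>q x\<close> that sends the frame \<open>e x\<close> to \<open>e' x\<close>, extended by zero to the
    complement.\<close>
  define k where "k x y = (\<Sum>l<r. scaleC_ell2 (cinner_ell2 (e x l) y) (e' x l))" for x y
  \<comment> \<open>On the boundary the two frames agree, which leaves the projection, an expression in \<open>q x\<close>.\<close>
  have k_bd: "k x y = blinfun_apply (V (q x)) y" if "x \<in> cube_boundary m" for x y
  proof -
    have x: "x \<in> ?C" using that cube_boundary_subset by blast
    have "k x y = blinfun_apply (proj r (e x)) y"
      unfolding k_def proj_apply using e'(2) that by (intro sum.cong) auto
    then show ?thesis by (simp add: eo(2)[OF x])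
  qed
  have k_eq: "k x y = k x' y" if "x \<in> ?C" "x' \<in> ?C" "q x = q x'" for x x' y
    using cube_collapse_eqD[OF q that] k_bd that(3) by metis
  define \<sigma> where "\<sigma> s = (SOME x. x \<in> ?C \<and> q x = s)" for s
  have \<sigma>: "\<sigma> s \<in> ?C" "q (\<sigma> s) = s" if "s \<in> topspace (nsphere m)" for s
  proof -
    have "\<exists>x. x \<in> ?C \<and> q x = s" using qC that by (metis imageE)
    from someI_ex[OF this] show "\<sigma> s \<in> ?C" "q (\<sigma> s) = s" by (simp_all add: \<sigma>_def)
  qed
  define K where "K s = k (\<sigma> s)" for s
  have K_q: "K (q x) = k x" if "x \<in> ?C" for x
  proof -
    have "q x \<in> topspace (nsphere m)" using that qC by blast
    then show ?thesis using k_eq[OF \<sigma>(1) that \<sigma>(2)] by (auto simp: K_def)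
  qed
  define M where "M c s i j = (if i < r \<and> j < r then cinner_ell2 (w c s i) (K s (v c s j)) else 0)" for c s i j
  have K_lin: "K s (\<Sum>j<r. scaleC_ell2 (z j) (y j)) = (\<Sum>j<r. scaleC_ell2 (z j) (K s (y j)))" for s z y
    unfolding K_def k_def cin.sum_right cinner_scaleC_right scal.scale_sum_left scal.scale_sum_right scal.scale_scale
    by (rule sum.swap)
  have "continuous_on (N c) (\<lambda>s. M c s i j)" if ij: "i < r" "j < r" for c i j
  proof (rule continuous_on_descent[OF q N])
    let ?U = "{x \<in> ?C. q x \<in> N c}"
    have "continuous_map (cube m) (nsphere m) q" using q by (simp add: cube_collapse_def)
    then have "continuous_map (cube m) euclidean q"
      by (subst (asm) nsphere_eq) (rule continuous_map_into_fulltopology)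
    then have qc: "continuous_on ?U q"
      unfolding continuous_map_cube by (rule continuous_on_subset) auto
    have vc: "continuous_on ?U (\<lambda>x. v c (q x) j)"
      by (rule continuous_on_compose2[of "N c" "\<lambda>s. v c s j", OF _ qc]) (use v[of c] ij in \<open>auto simp: frame_on_def\<close>)
    have wc: "continuous_on ?U (\<lambda>x. w c (q x) i)"
      by (rule continuous_on_compose2[of "N c" "\<lambda>s. w c s i", OF _ qc]) (use w[of c] ij in \<open>auto simp: frame_on_def\<close>)
    have ec: "continuous_on ?U (\<lambda>x. e x l)" "continuous_on ?U (\<lambda>x. e' x l)" if "l < r" for l
      using e e'(1) that by (auto simp: frame_on_def elim!: continuous_on_subset)
    have "continuous_on ?U (\<lambda>x. cinner_ell2 (w c (q x) i) (k x (v c (q x) j)))"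
      unfolding k_def
      by (intro cin.continuous_on[OF wc] continuous_on_sum scl.continuous_on[OF cin.continuous_on[OF ec(1) vc] ec(2)]) auto
    then show "continuous_on ?U (\<lambda>x. M c (q x) i j)"
      by (rule continuous_on_eq) (simp add: M_def ij K_q)
  qed
  moreover have "M c s \<in> unitary_matrices r" "(\<Sum>i<r. scaleC_ell2 (matrix_act r (M c s) z i) (w c s i)) = K s (\<Sum>j<r. scaleC_ell2 (z j) (v c s j))"
    if s: "s \<in> N c" for c s z
  proof -
    have S: "s \<in> topspace (nsphere m)" using s openin_subset[OF N] by blast
    note \<sigma>s = \<sigma>[OF S]
    have PW: "proj r (w c s) = proj r (e' (\<sigma> s))" and PV: "proj r (v c s) = proj r (e (\<sigma> s))"
      using wo(2)[OF s] vo(2)[OF s] e'o(2)[OF \<sigma>s(1)] eo(2)[OF \<sigma>s(1)] \<sigma>s(2) by simp_all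
    have PK: "blinfun_apply (proj r (w c s)) (K s y) = K s y" for y
      unfolding PW K_def k_def by (rule proj_comb[OF e'o(1)[OF \<sigma>s(1)]])
    have cK: "cinner_ell2 (K s x) (K s y) = cinner_ell2 (blinfun_apply (proj r (v c s)) x) y" for x y
    proof -
      have "cinner_ell2 (K s x) (K s y) = (\<Sum>l<r. cnj (cinner_ell2 (e (\<sigma> s) l) x) * cinner_ell2 (e' (\<sigma> s) l) (K s y))"
        by (simp add: K_def k_def[of _ x] cin.sum_left)
      also have "\<dots> = (\<Sum>l<r. cnj (cinner_ell2 (e (\<sigma> s) l) x) * cinner_ell2 (e (\<sigma> s) l) y)"
        unfolding K_def k_def by (intro sum.cong refl) (simp add: orthonormal_coeff[OF e'o(1)[OF \<sigma>s(1)]])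
      also have "\<dots> = cinner_ell2 (blinfun_apply (proj r (v c s)) x) y"
        by (simp add: PV proj_apply cin.sum_left)
      finally show ?thesis .
    qed
    have cKv: "cinner_ell2 (K s (v c s i)) (K s (v c s j)) = (if i = j then 1 else 0)" if "i < r" "j < r" for i j
      using that unfolding cK by (simp add: proj_frame[OF vo(1)[OF s]] orthonormal_D[OF vo(1)[OF s]])
    show "M c s \<in> unitary_matrices r"
      unfolding unitary_matrices_def
    proof (intro CollectI conjI allI impI)
      fix i j assume ij: "i < r" "j < r"
      have "(\<Sum>k<r. cnj (M c s k i) * M c s k j) = 
          (\<Sum>k<r. cinner_ell2 (K s (v c s i)) (w c s k) * cinner_ell2 (w c s k) (K s (v c s j)))"
        using ij by (intro sum.cong) (auto simp: M_def cnj_cinner)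
      also have "\<dots> = cinner_ell2 (K s (v c s i)) (blinfun_apply (proj r (w c s)) (K s (v c s j)))"
        by (simp add: proj_apply cin.sum_right mult.commute)
      also have "\<dots> = (if i = j then 1 else 0)" by (simp add: PK cKv ij)
      finally show "(\<Sum>k<r. cnj (M c s k i) * M c s k j) = (if i = j then 1 else 0)" .
    qed (auto simp: M_def)
    have "K s (\<Sum>j<r. scaleC_ell2 (z j) (v c s j)) = blinfun_apply (proj r (w c s)) (K s (\<Sum>j<r. scaleC_ell2 (z j) (v c s j)))"
      by (simp only: PK)
    also have "\<dots> = (\<Sum>i<r. scaleC_ell2 (matrix_act r (M c s) z i) (w c s i))"
      unfolding proj_apply K_lin
      by (intro sum.cong refl) (simp add: matrix_act_def M_def cin.sum_right mult.commute)
    finally show "(\<Sum>i<r. scaleC_ell2 (matrix_act r (M c s) z i) (w c s i)) = K s (\<Sum>j<r. scaleC_ell2 (z j) (v c s j))" ..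
  qed
  ultimately show ?thesis by (intro exI[of _ M] exI[of _ K]) blast
qed


section \<open>Realization of the bundles in the Hilbert space\<close>

definition vfst :: "nat \<Rightarrow> (nat \<Rightarrow> complex) \<Rightarrow> (nat \<Rightarrow> complex)" where
  "vfst m y = (\<lambda>k. if k < m then y k else 0)"

definition vsnd :: "nat \<Rightarrow> (nat \<Rightarrow> complex) \<Rightarrow> (nat \<Rightarrow> complex)" where
  "vsnd m y = (\<lambda>k. if k < m then y (m + k) else 0)"

lemma vfst_cspace: "vfst m y \<in> cspace m" and vsnd_cspace: "vsnd m y \<in> cspace m"
  by (auto simp: vfst_def vsnd_def cspace_def)

lemma sum_plane_frame:
  "(\<Sum>l<m + m. scaleC_ell2 (y l) (plane_frame m 0 v w l)) =
     blinfun_apply (rot 0) (\<Sum>j<m. scaleC_ell2 (vfst m y j) (v j)) +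
     blinfun_apply (rot (pi / 2)) (\<Sum>j<m. scaleC_ell2 (vsnd m y j) (w j))"
  by (simp add: sum_lessThan_split plane_frame_def vfst_def vsnd_def blinfun.sum_right rot_scaleC)

lemma rot_sum_eqD:
  assumes "blinfun_apply (rot 0) x + blinfun_apply (rot (pi / 2)) y = blinfun_apply (rot 0) x' + blinfun_apply (rot (pi / 2)) y'"
  shows "x = x' \<and> y = y'"
  using arg_cong[OF assms, of "blinfun_apply (unrot 0)"] arg_cong[OF assms, of "blinfun_apply (unrot (pi / 2))"]
  by (simp add: blinfun.add_right unrot_rot)

locale classified_bundles =
  fixes m :: nat
    and E :: "int \<Rightarrow> (hemisphere, nat \<Rightarrow> real, 'e, nat \<Rightarrow> complex) gbundle"
    and N :: "hemisphere \<Rightarrow> (nat \<Rightarrow> real) set"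
    and \<iota> :: "int \<Rightarrow> ((nat \<Rightarrow> real) \<Rightarrow> (nat \<Rightarrow> complex) set) set"
    and b0 :: "(nat \<Rightarrow> complex) set"
    and s0 :: "nat \<Rightarrow> real"
    and q :: "(nat \<Rightarrow> real) \<Rightarrow> (nat \<Rightarrow> real)"
  assumes m: "m \<ge> 1"
    and N_open: "\<And>c. openin (nsphere m) (N c)"
    and N_cover: "(\<Union>c. N c) = topspace (nsphere m)"
    and E: "\<And>k. hermitian_bundle m (nsphere m) (E k)"
    and E_cover: "\<And>k c. chart_dom (E k) c = N c"
    and b0: "b0 \<in> topspace (BU m)"
    and q: "cube_collapse m s0 q"
    and \<iota>: "\<iota> \<in> iso integer_group (homotopy_group m (BU m) b0)"
    and E_class: "\<And>k. \<exists>f. classified_by m (nsphere m) (E k) f \<and> f s0 = b0 \<and> f \<circ> q \<in> \<iota> k"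
begin

text \<open>A classifying map of \<open>E k\<close>, and the map from the total space to infinite-dimensional space that comes with it.
  The latter allows comparing vectors of one fibre that are given in different charts.\<close>

definition class_rep :: "int \<Rightarrow> (nat \<Rightarrow> real) \<Rightarrow> (nat \<Rightarrow> complex) set" where
  "class_rep k = (SOME f. classified_by m (nsphere m) (E k) f \<and> f \<circ> q \<in> \<iota> k)"

lemma class_rep: "classified_by m (nsphere m) (E k) (class_rep k)" "class_rep k \<circ> q \<in> \<iota> k"
proof -
  have "\<exists>f. classified_by m (nsphere m) (E k) f \<and> f \<circ> q \<in> \<iota> k" using E_class[of k] by blast
  from someI_ex[OF this] show "classified_by m (nsphere m) (E k) (class_rep k)" "class_rep k \<circ> q \<in> \<iota> k"
    by (simp_all add: class_rep_def)
qed

definition realization :: "int \<Rightarrow> 'e \<Rightarrow> (nat \<Rightarrow> complex)" where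
  "realization k = (SOME h. continuous_map (total (E k)) cspace_infinity h \<and>
        (\<forall>c. \<forall>x\<in>N c. \<exists>M. \<exists>v\<in>stiefel m M.
           class_rep k x = frame_span m v \<and> (\<forall>z\<in>cspace m. h (chart (E k) c (x, z)) = frame_comb m v z)))"

lemma realization: "continuous_map (total (E k)) cspace_infinity (realization k)"
    "s \<in> N c \<Longrightarrow> \<exists>M. \<exists>v\<in>stiefel m M. class_rep k s = frame_span m v \<and>
         (\<forall>z\<in>cspace m. realization k (chart (E k) c (s, z)) = frame_comb m v z)"
proof -
  have "\<exists>h. continuous_map (total (E k)) cspace_infinity h \<and>
        (\<forall>c. \<forall>x\<in>N c. \<exists>M. \<exists>v\<in>stiefel m M.
           class_rep k x = frame_span m v \<and> (\<forall>z\<in>cspace m. h (chart (E k) c (x, z)) = frame_comb m v z))"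
    using class_rep(1)[of k] unfolding classified_by_def E_cover by blast
  from someI_ex[OF this]
  have *: "continuous_map (total (E k)) cspace_infinity (realization k) \<and>
        (\<forall>c. \<forall>x\<in>N c. \<exists>M. \<exists>v\<in>stiefel m M.
           class_rep k x = frame_span m v \<and> (\<forall>z\<in>cspace m. realization k (chart (E k) c (x, z)) = frame_comb m v z))"
    unfolding realization_def[symmetric] .
  show "continuous_map (total (E k)) cspace_infinity (realization k)" using * by blast
  show "s \<in> N c \<Longrightarrow> \<exists>M. \<exists>v\<in>stiefel m M. class_rep k s = frame_span m v \<and>
         (\<forall>z\<in>cspace m. realization k (chart (E k) c (s, z)) = frame_comb m v z)" using * by blast
qed

definition chart_frame :: "int \<Rightarrow> hemisphere \<Rightarrow> (nat \<Rightarrow> real) \<Rightarrow> nat \<Rightarrow> ell2" where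
  "chart_frame k c s j = emb (realization k (chart (E k) c (s, unit_seq j)))"

definition realize :: "int \<Rightarrow> hemisphere \<Rightarrow> (nat \<Rightarrow> real) \<Rightarrow> (nat \<Rightarrow> complex) \<Rightarrow> ell2" where
  "realize k c s z = (\<Sum>j<m. scaleC_ell2 (z j) (chart_frame k c s j))"

lemma chart_frame:
  assumes s: "s \<in> N c"
  shows "orthonormal m (chart_frame k c s)" "proj m (chart_frame k c s) = span_proj m (class_rep k s)"
    and realize_eq: "z \<in> cspace m \<Longrightarrow> realize k c s z = emb (realization k (chart (E k) c (s, z)))"
proof -
  obtain M v where v: "v \<in> stiefel m M" "class_rep k s = frame_span m v"
    "\<forall>z\<in>cspace m. realization k (chart (E k) c (s, z)) = frame_comb m v z" using realization(2)[OF s] by blast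
  have f: "chart_frame k c s j = emb (v j)" if "j < m" for j
    using v(3) unit_seq_cspace[OF that] frame_comb_unit[OF that] by (simp add: chart_frame_def)
  show "orthonormal m (chart_frame k c s)" using orthonormal_emb[OF v(1)] orthonormal_cong[of m "chart_frame k c s" "\<lambda>j. emb (v j)"] f by simp
  show "proj m (chart_frame k c s) = span_proj m (class_rep k s)"
    using span_proj_frame_span[OF v(1)] proj_cong[of m "chart_frame k c s" "\<lambda>j. emb (v j)"] f v(2) by simp
  show "realize k c s z = emb (realization k (chart (E k) c (s, z)))" if "z \<in> cspace m"
    using v(3) that f by (simp add: realize_def emb_frame_comb[OF v(1)])
qed

lemma N_sub: "N c \<subseteq> topspace (nsphere m)"
  by (rule openin_subset[OF N_open])

lemma E_chart:
  "homeomorphic_map (prod_topology (subtopology (nsphere m) (N c)) (top_of_set (cspace m)))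
            (subtopology (total (E k)) {e \<in> topspace (total (E k)). base_proj (E k) e \<in> N c}) (chart (E k) c)"
  using E[of k] unfolding fibre_bundle_def E_cover by blast

lemma continuous_on_chart_frame:
  assumes j: "j < m"
  shows "continuous_on (N c) (\<lambda>s. chart_frame k c s j)"
proof -
  let ?B = "subtopology (nsphere m) (N c)"
  have 1: "continuous_map ?B (prod_topology ?B (top_of_set (cspace m))) (\<lambda>s. (s, unit_seq j))"
    by (intro continuous_map_pairedI continuous_map_id[unfolded id_def]) (simp add: unit_seq_cspace[OF j])
  have 2: "continuous_map (prod_topology ?B (top_of_set (cspace m))) (total (E k)) (chart (E k) c)"
    using homeomorphic_imp_continuous_map[OF E_chart] by (rule continuous_map_into_fulltopology)
  have "continuous_map ?B euclidean (\<lambda>s. chart_frame k c s j)"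
    using continuous_map_compose[OF continuous_map_compose[OF continuous_map_compose[OF 1 2] realization(1)] continuous_map_emb]
    by (simp add: o_def chart_frame_def)
  then show ?thesis by (simp add: subtopology_nsphere[OF N_sub])
qed

lemma frame_on_chart_frame: "frame_on m (N c) (\<lambda>s. span_proj m (class_rep k s)) (chart_frame k c)"
  unfolding frame_on_def using continuous_on_chart_frame chart_frame by blast

lemma E_transition:
  "\<exists>g. continuous_map (subtopology (nsphere m) (N c \<inter> N d)) (top_of_set (unitary_matrices m)) g \<and>
    (\<forall>s\<in>N c \<inter> N d. \<forall>z\<in>cspace m. chart (E k) c (s, z) = chart (E k) d (s, matrix_act m (g s) z))"
proof -
  have "\<exists>g. continuous_map (subtopology (nsphere m) (N c \<inter> N d)) (top_of_set (unitary_matrices m)) g \<and>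
        (\<forall>x\<in>N c \<inter> N d. \<forall>v\<in>topspace (top_of_set (cspace m)). chart (E k) c (x, v) = chart (E k) d (x, matrix_act m (g x) v))"
    using E[of k] unfolding fibre_bundle_def E_cover by blast
  then show ?thesis by simp
qed

lemma matrix_act_cspace: "A \<in> unitary_matrices r \<Longrightarrow> matrix_act r A z \<in> cspace r"
  by (auto simp: matrix_act_def cspace_def unitary_matrices_def)

text \<open>The map to the Hilbert space is injective on fibres, so it decides whether coordinates in two charts describe
  the same vector.\<close>

lemma chart_eq_iff:
  assumes s: "s \<in> N c" "s \<in> N d" and z: "z \<in> cspace m" "z' \<in> cspace m"
  shows "chart (E k) c (s, z) = chart (E k) d (s, z') \<longleftrightarrow> realize k c s z = realize k d s z'"
proof
  show "chart (E k) c (s, z) = chart (E k) d (s, z') \<Longrightarrow> realize k c s z = realize k d s z'"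
    by (simp add: realize_eq s z)
  assume eq: "realize k c s z = realize k d s z'"
  obtain g where g: "continuous_map (subtopology (nsphere m) (N c \<inter> N d)) (top_of_set (unitary_matrices m)) g"
    "\<And>s z. s \<in> N c \<inter> N d \<Longrightarrow> z \<in> cspace m \<Longrightarrow> chart (E k) c (s, z) = chart (E k) d (s, matrix_act m (g s) z)"
    using E_transition[of c d k] by blast
  have "s \<in> topspace (subtopology (nsphere m) (N c \<inter> N d))" using s N_sub by auto
  then have "g s \<in> unitary_matrices m" using continuous_map_funspace[OF g(1)] by auto
  then have cz: "matrix_act m (g s) z \<in> cspace m" by (rule matrix_act_cspace)
  have ch: "chart (E k) c (s, z) = chart (E k) d (s, matrix_act m (g s) z)" using g(2) s z by simp
  then have "realize k d s (matrix_act m (g s) z) = realize k d s z'"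
    using eq by (simp add: realize_eq s z cz)
  then have "matrix_act m (g s) z j = z' j" if "j < m" for j
    using orthonormal_coeff[OF chart_frame(1)[OF s(2)] that, of k] unfolding realize_def by metis
  then have "matrix_act m (g s) z = z'"
    using cz z(2) by (intro ext) (metis (mono_tags, lifting) cspace_def mem_Collect_eq not_le)
  then show "chart (E k) c (s, z) = chart (E k) d (s, z')" using ch by simp
qed

lemma chart_inj:
  assumes "s \<in> N c" "z \<in> cspace m" "z' \<in> cspace m" "chart (E k) c (s, z) = chart (E k) c (s, z')"
  shows "z = z'"
proof -
  have "realize k c s z = realize k c s z'" using chart_eq_iff assms by blast
  then have "z j = z' j" if "j < m" for j
    using orthonormal_coeff[OF chart_frame(1)[OF assms(1)] that, of k] unfolding realize_def by metis
  then show ?thesis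
    using assms(2,3) by (intro ext) (metis (mono_tags, lifting) cspace_def mem_Collect_eq not_le)
qed

lemma span_proj_class_rep:
  "continuous_on (topspace (cube m)) (\<lambda>x. span_proj m (class_rep k (q x)))"
  "x \<in> topspace (cube m) \<Longrightarrow> is_rank_proj m (span_proj m (class_rep k (q x)))"
  using spheroid_D[OF class_spheroid[OF m \<iota> class_rep(2)[of k]]] by (simp_all add: o_def)

text \<open>\<open>M\<close> gives the matrices, in all pairs of charts with the same index, of one isometry from the direct
  sum of the first two bundles to that of the other two; the two halves of a vector of length \<open>m + m\<close> are the
  coordinates in the two summands.\<close>

definition pair_isometry :: "int \<Rightarrow> int \<Rightarrow> int \<Rightarrow> int \<Rightarrow>
    (hemisphere \<Rightarrow> (nat \<Rightarrow> real) \<Rightarrow> nat \<Rightarrow> nat \<Rightarrow> complex) \<Rightarrow> bool" where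
  "pair_isometry p p2 k k2 M \<longleftrightarrow>
    (\<forall>c. (\<forall>i<m + m. \<forall>j<m + m. continuous_on (N c) (\<lambda>s. M c s i j)) \<and> (\<forall>s\<in>N c. M c s \<in> unitary_matrices (m + m))) \<and>
    (\<forall>c d s y y'. s \<in> N c \<longrightarrow> s \<in> N d \<longrightarrow>
       chart (E p) c (s, vfst m y) = chart (E p) d (s, vfst m y') \<longrightarrow>
       chart (E p2) c (s, vsnd m y) = chart (E p2) d (s, vsnd m y') \<longrightarrow>
       chart (E k) c (s, vfst m (matrix_act (m + m) (M c s) y)) = chart (E k) d (s, vfst m (matrix_act (m + m) (M d s) y')) \<and>
       chart (E k2) c (s, vsnd m (matrix_act (m + m) (M c s) y)) = chart (E k2) d (s, vsnd m (matrix_act (m + m) (M d s) y')))"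

text \<open>The two sums are equivalent over the cube relative to its boundary, so they are isometric over the sphere.
  Since the isometry acts on vectors in the Hilbert space, its matrices in two charts describe the same vector if
  the coordinates they are applied to do.\<close>

lemma pair_isometries:
  assumes eq: "p + p2 = k + k2"
  shows "\<exists>M. pair_isometry p p2 k k2 M"
proof -
  define V where "V s = plane_sum 0 (span_proj m (class_rep p s)) (span_proj m (class_rep p2 s))" for s
  define W where "W s = plane_sum 0 (span_proj m (class_rep k s)) (span_proj m (class_rep k2 s))" for s
  have fr: "frame_on (m + m) (N c) (\<lambda>s. plane_sum 0 (span_proj m (class_rep i s)) (span_proj m (class_rep j s))) (\<lambda>s. plane_frame m 0 (chart_frame i c s) (chart_frame j c s))" for i j c
    unfolding frame_on_def
  proof (intro conjI allI impI ballI)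
    fix l assume "l < m + m"
    then show "continuous_on (N c) (\<lambda>s. plane_frame m 0 (chart_frame i c s) (chart_frame j c s) l)"
      by (cases "l < m") (auto simp: plane_frame_def intro!: blinfun.continuous_on continuous_on_const continuous_on_chart_frame)
  qed (simp_all add: orthonormal_plane_frame proj_plane_frame chart_frame)
  have frames_match: "frames_match (m + m) (topspace (cube m)) (cube_boundary m) (\<lambda>x. V (q x)) (\<lambda>x. W (q x))"
    using frames_match_class_sum[OF m \<iota> b0 class_rep(2)[of p] class_rep(2)[of p2] class_rep(2)[of k] class_rep(2)[of k2] eq] by (simp add: V_def W_def)
  have cV: "continuous_on (topspace (cube m)) (\<lambda>x. V (q x))"
    unfolding V_def by (intro continuous_on_plane_sum continuous_on_const span_proj_class_rep)
  have iV: "is_rank_proj (m + m) (V (q x))" if "x \<in> topspace (cube m)" for x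
    unfolding V_def by (intro is_rank_proj_plane_sum span_proj_class_rep that)
  from isometries_from_frames_match[of _ _ _ N V "m + m" W "\<lambda>c s. plane_frame m 0 (chart_frame p c s) (chart_frame p2 c s)"
      "\<lambda>c s. plane_frame m 0 (chart_frame k c s) (chart_frame k2 c s)", OF q N_open cV iV frames_match fr[of _ p p2, folded V_def] fr[of _ k k2, folded W_def]]
  obtain M K where M: "\<And>c i j. i < m + m \<Longrightarrow> j < m + m \<Longrightarrow> continuous_on (N c) (\<lambda>s. M c s i j)"
      "\<And>c s. s \<in> N c \<Longrightarrow> M c s \<in> unitary_matrices (m + m)"
    and K: "\<And>c s z. s \<in> N c \<Longrightarrow> (\<Sum>i<m + m. scaleC_ell2 (matrix_act (m + m) (M c s) z i) (plane_frame m 0 (chart_frame k c s) (chart_frame k2 c s) i))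
       = K s (\<Sum>j<m + m. scaleC_ell2 (z j) (plane_frame m 0 (chart_frame p c s) (chart_frame p2 c s) j))" by blast
  have "chart (E k) c (s, vfst m (matrix_act (m + m) (M c s) y)) = chart (E k) d (s, vfst m (matrix_act (m + m) (M d s) y')) \<and>
       chart (E k2) c (s, vsnd m (matrix_act (m + m) (M c s) y)) = chart (E k2) d (s, vsnd m (matrix_act (m + m) (M d s) y'))"
    if s: "s \<in> N c" "s \<in> N d" and y: "chart (E p) c (s, vfst m y) = chart (E p) d (s, vfst m y')"
       "chart (E p2) c (s, vsnd m y) = chart (E p2) d (s, vsnd m y')" for c d s y y'
  proof -
    have r: "realize p c s (vfst m y) = realize p d s (vfst m y')" "realize p2 c s (vsnd m y) = realize p2 d s (vsnd m y')"
      using y chart_eq_iff[OF s] by (simp_all add: vfst_cspace vsnd_cspace)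
    let ?y = "matrix_act (m + m) (M c s) y" and ?y' = "matrix_act (m + m) (M d s) y'"
    have "blinfun_apply (rot 0) (realize k c s (vfst m ?y)) + blinfun_apply (rot (pi / 2)) (realize k2 c s (vsnd m ?y)) =
       blinfun_apply (rot 0) (realize k d s (vfst m ?y')) + blinfun_apply (rot (pi / 2)) (realize k2 d s (vsnd m ?y'))"
      using K[OF s(1), of y] K[OF s(2), of y'] r unfolding sum_plane_frame realize_def by simp
    from rot_sum_eqD[OF this] show ?thesis
      using chart_eq_iff[OF s] by (simp add: vfst_cspace vsnd_cspace)
  qed
  then have "pair_isometry p p2 k k2 M" using M unfolding pair_isometry_def by blast
  then show ?thesis by blast
qed

text \<open>The zero class is represented by the constant map, and a fixed frame of its value trivializes the constant
  family of subspaces.\<close>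

lemma zero_isometries:
  "\<exists>M. (\<forall>c. (\<forall>i<m. \<forall>j<m. continuous_on (N c) (\<lambda>s. M c s i j)) \<and> (\<forall>s\<in>N c. M c s \<in> unitary_matrices m)) \<and>
    (\<forall>c d s y y'. s \<in> N c \<longrightarrow> s \<in> N d \<longrightarrow> y \<in> cspace m \<longrightarrow> y' \<in> cspace m \<longrightarrow>
       chart (E 0) c (s, y) = chart (E 0) d (s, y') \<longrightarrow> matrix_act m (M c s) y = matrix_act m (M d s) y')"
proof -
  obtain u where u: "orthonormal m u" "span_proj m b0 = proj m u" using is_rank_proj_span_proj[OF b0] by (auto simp: is_rank_proj_def)
  have frames_match: "frames_match m (topspace (cube m)) (cube_boundary m) (\<lambda>x. span_proj m (class_rep 0 (q x))) (\<lambda>x. span_proj m b0)"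
    using frames_match_class_zero[OF m \<iota> b0 class_rep(2)[of 0]] by simp
  have fu: "frame_on m (N c) (\<lambda>s. span_proj m b0) (\<lambda>s. u)" for c by (simp add: frame_on_def u)
  from isometries_from_frames_match[of _ _ _ N "\<lambda>s. span_proj m (class_rep 0 s)" m "\<lambda>s. span_proj m b0" "chart_frame 0" "\<lambda>c s. u",
      OF q N_open span_proj_class_rep frames_match frame_on_chart_frame fu]
  obtain M K where M: "\<And>c i j. i < m \<Longrightarrow> j < m \<Longrightarrow> continuous_on (N c) (\<lambda>s. M c s i j)"
      "\<And>c s. s \<in> N c \<Longrightarrow> M c s \<in> unitary_matrices m"
    and K: "\<And>c s z. s \<in> N c \<Longrightarrow> (\<Sum>i<m. scaleC_ell2 (matrix_act m (M c s) z i) (u i)) = K s (\<Sum>j<m. scaleC_ell2 (z j) (chart_frame 0 c s j))"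
    by blast
  have "matrix_act m (M c s) y = matrix_act m (M d s) y'"
    if s: "s \<in> N c" "s \<in> N d" and y: "y \<in> cspace m" "y' \<in> cspace m" "chart (E 0) c (s, y) = chart (E 0) d (s, y')" for c d s y y'
  proof
    fix i
    have "realize 0 c s y = realize 0 d s y'" using chart_eq_iff[OF s] y by blast
    then have eq: "(\<Sum>i<m. scaleC_ell2 (matrix_act m (M c s) y i) (u i)) = (\<Sum>i<m. scaleC_ell2 (matrix_act m (M d s) y' i) (u i))"
      using K[OF s(1), of y] K[OF s(2), of y'] unfolding realize_def by simp
    show "matrix_act m (M c s) y i = matrix_act m (M d s) y' i"
    proof (cases "i < m")
      case True
      then show ?thesis using orthonormal_coeff[OF u(1) True] eq by metis
    next
      case False
      then show ?thesis using matrix_act_cspace[OF M(2)[OF s(1)]] matrix_act_cspace[OF M(2)[OF s(2)]] by (simp add: cspace_def)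
    qed
  qed
  then show ?thesis using M by (intro exI[of _ M]) blast
qed

end


section \<open>Block diagonal operators\<close>

text \<open>The offset is needed for grouping summands into pairs that begin at an odd index.\<close>

definition block :: "nat \<Rightarrow> int \<Rightarrow> ell2 \<Rightarrow> int \<Rightarrow> (nat \<Rightarrow> complex)" where
  "block r ofs w b = (\<lambda>l. if l < r then ell2_nth w (ofs + int r * b + int l) else 0)"

definition unblock :: "nat \<Rightarrow> int \<Rightarrow> (int \<Rightarrow> nat \<Rightarrow> complex) \<Rightarrow> ell2" where
  "unblock r ofs z = Abs_ell2 (\<lambda>i. z ((i - ofs) div int r) (nat ((i - ofs) mod int r)))"

lemma block_cspace: "block r ofs w b \<in> cspace r"
  by (simp add: block_def cspace_def)

lemma bij_blocks:
  assumes r: "r \<ge> 1"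
  shows "bij_betw (\<lambda>(b, l). ofs + int r * b + int l) (UNIV \<times> {..<r}) UNIV"
proof (rule bij_betwI[where g = "\<lambda>i. ((i - ofs) div int r, nat ((i - ofs) mod int r))"])
  show "(\<lambda>i. ((i - ofs) div int r, nat ((i - ofs) mod int r))) \<in> UNIV \<rightarrow> UNIV \<times> {..<r}"
    using r by (auto simp: nat_less_iff)
  fix x :: "int \<times> nat" assume "x \<in> UNIV \<times> {..<r}"
  then obtain b l where x: "x = (b, l)" "l < r" by auto
  have "(int r * b + int l) div int r = b" "(int r * b + int l) mod int r = int l"
    using x(2) by (simp_all add: div_pos_pos_trivial)
  then show "(((case x of (b, l) \<Rightarrow> ofs + int r * b + int l) - ofs) div int r,
      nat (((case x of (b, l) \<Rightarrow> ofs + int r * b + int l) - ofs) mod int r)) = x"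
    by (simp add: x(1) add.assoc)
next
  fix y
  have "int r * ((y - ofs) div int r) + (y - ofs) mod int r = y - ofs" by simp
  then show "(case ((y - ofs) div int r, nat ((y - ofs) mod int r)) of (b, l) \<Rightarrow> ofs + int r * b + int l) = y"
    using r by simp
qed simp

lemma summable_on_blocks:
  fixes f :: "int \<Rightarrow> real"
  assumes r: "r \<ge> 1" and f: "\<And>i. f i \<ge> 0"
  shows "f summable_on UNIV \<longleftrightarrow> (\<lambda>b. \<Sum>l<r. f (ofs + int r * b + int l)) summable_on UNIV"
proof -
  have re: "f summable_on UNIV \<longleftrightarrow> (\<lambda>(b, l). f (ofs + int r * b + int l)) summable_on UNIV \<times> {..<r}"
    using summable_on_reindex_bij_betw[OF bij_blocks[OF r], of f ofs] by (simp add: case_prod_unfold)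
  show ?thesis
  proof
    assume "f summable_on UNIV"
    then have "(\<lambda>b. infsum (\<lambda>l. f (ofs + int r * b + int l)) {..<r}) summable_on UNIV"
      unfolding re by (rule summable_on_Sigma_banach)
    then show "(\<lambda>b. \<Sum>l<r. f (ofs + int r * b + int l)) summable_on UNIV" by simp
  next
    assume g: "(\<lambda>b. \<Sum>l<r. f (ofs + int r * b + int l)) summable_on UNIV"
    show "f summable_on UNIV" unfolding re
    proof (rule summable_on_SigmaI[OF _ g])
      show "((\<lambda>l. case (b, l) of (b, l) \<Rightarrow> f (ofs + int r * b + int l)) has_sum (\<Sum>l<r. f (ofs + int r * b + int l))) {..<r}" for b
        by (simp add: has_sum_finite)
    qed (use f in auto)
  qed
qed

lemma infsum_blocks:
  fixes f :: "int \<Rightarrow> 'a::banach"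
  assumes r: "r \<ge> 1" and f: "f summable_on UNIV"
  shows "(\<Sum>\<^sub>\<infinity>i. f i) = (\<Sum>\<^sub>\<infinity>b. \<Sum>l<r. f (ofs + int r * b + int l))"
proof -
  have "(\<Sum>\<^sub>\<infinity>i. f i) = infsum (\<lambda>(b, l). f (ofs + int r * b + int l)) (UNIV \<times> {..<r})"
    using infsum_reindex_bij_betw[OF bij_blocks[OF r], of f ofs] by (simp add: case_prod_unfold)
  also have "\<dots> = (\<Sum>\<^sub>\<infinity>b. infsum (\<lambda>l. f (ofs + int r * b + int l)) {..<r})"
    by (rule infsum_Sigma'_banach[symmetric])
       (use summable_on_reindex_bij_betw[OF bij_blocks[OF r], of f ofs] f in \<open>simp add: case_prod_unfold\<close>)
  finally show ?thesis by simp
qed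

lemma summable_block: "r \<ge> 1 \<Longrightarrow> (\<lambda>b. \<Sum>l<r. (cmod (block r ofs w b l))\<^sup>2) summable_on UNIV"
  using summable_on_blocks[of r "\<lambda>i. (cmod (ell2_nth w i))\<^sup>2" ofs] ell2_nth_summable[of w] by (simp add: block_def)

lemma norm_block:
  assumes "r \<ge> 1"
  shows "(norm w)\<^sup>2 = (\<Sum>\<^sub>\<infinity>b. \<Sum>l<r. (cmod (block r ofs w b l))\<^sup>2)"
  using infsum_blocks[OF assms ell2_nth_summable[of w], of ofs]
  by (simp add: power2_norm_eq_inner inner_ell2_self block_def)

lemma cinner_block:
  assumes "r \<ge> 1"
  shows "cinner_ell2 w w' = (\<Sum>\<^sub>\<infinity>b. \<Sum>l<r. cnj (block r ofs w b l) * block r ofs w' b l)"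
  using infsum_blocks[OF assms ell2_cinner_summable[of w w'], of ofs]
  by (simp add: cinner_ell2_def block_def)

lemma block_unblock:
  assumes r: "r \<ge> 1" and z: "(\<lambda>b. \<Sum>l<r. (cmod (z b l))\<^sup>2) summable_on UNIV"
  shows "block r ofs (unblock r ofs z) b = (\<lambda>l. if l < r then z b l else 0)"
proof -
  let ?f = "\<lambda>i. z ((i - ofs) div int r) (nat ((i - ofs) mod int r))"
  have idx: "?f (ofs + int r * b + int l) = z b l" if "l < r" for b l
  proof -
    have "(int r * b + int l) div int r = b" "(int r * b + int l) mod int r = int l"
      using that by (simp_all add: div_pos_pos_trivial)
    then show ?thesis by (simp add: add.assoc)
  qed
  have "(\<lambda>i. (cmod (?f i))\<^sup>2) summable_on UNIV"
    unfolding summable_on_blocks[OF r, of "\<lambda>i. (cmod (?f i))\<^sup>2" ofs, OF zero_le_power2]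
    using z by (simp add: idx)
  then have "ell2_nth (unblock r ofs z) = ?f"
    unfolding unblock_def by (intro Abs_ell2_inverse) simp
  then show ?thesis by (auto simp: block_def idx)
qed

lemma block_eqI:
  assumes r: "r \<ge> 1" and eq: "\<And>b. block r ofs w b = block r ofs w' b"
  shows "w = w'"
proof (rule ell2_eqI)
  fix i
  obtain b l where "i = ofs + int r * b + int l" "l < r"
    using bij_betw_imp_surj_on[OF bij_blocks[OF r, of ofs]] by force
  then show "ell2_nth w i = ell2_nth w' i" using fun_cong[OF eq[of b], of l] by (simp add: block_def)
qed

lemma block_add: "block r ofs (w + w') b = (\<lambda>l. block r ofs w b l + block r ofs w' b l)"
  and block_scaleC: "block r ofs (scaleC_ell2 c w) b = (\<lambda>l. c * block r ofs w b l)"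
  and block_minus: "block r ofs (w - w') b = (\<lambda>l. block r ofs w b l - block r ofs w' b l)"
  by (auto simp: block_def plus_ell2.rep_eq minus_ell2.rep_eq scaleC_ell2.rep_eq)

text \<open>Operators with uniformly bounded blocks; the Hilbert--Schmidt norm is a convenient bound.\<close>

definition hs_bound :: "nat \<Rightarrow> (int \<Rightarrow> nat \<Rightarrow> nat \<Rightarrow> complex) \<Rightarrow> real \<Rightarrow> bool" where
  "hs_bound r \<beta> c \<longleftrightarrow> c \<ge> 0 \<and> (\<forall>b. (\<Sum>k<r. \<Sum>l<r. (cmod (\<beta> b k l))\<^sup>2) \<le> c\<^sup>2)"

definition block_op :: "nat \<Rightarrow> int \<Rightarrow> (int \<Rightarrow> nat \<Rightarrow> nat \<Rightarrow> complex) \<Rightarrow> (ell2 \<Rightarrow>\<^sub>L ell2)" where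
  "block_op r ofs \<beta> = Blinfun (\<lambda>w. unblock r ofs (\<lambda>b. matrix_act r (\<beta> b) (block r ofs w b)))"

text \<open>Cauchy--Schwarz in each row.\<close>

lemma matrix_act_bound:
  "(\<Sum>k<r. (cmod (matrix_act r A z k))\<^sup>2) \<le> (\<Sum>k<r. \<Sum>l<r. (cmod (A k l))\<^sup>2) * (\<Sum>l<r. (cmod (z l))\<^sup>2)"
proof -
  have "(cmod (matrix_act r A z k))\<^sup>2 \<le> (\<Sum>l<r. (cmod (A k l))\<^sup>2) * (\<Sum>l<r. (cmod (z l))\<^sup>2)" for k
  proof -
    have "cmod (matrix_act r A z k) \<le> (\<Sum>l<r. cmod (A k l) * cmod (z l))"
      unfolding matrix_act_def by (rule order_trans[OF norm_sum]) (simp add: norm_mult)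
    then have "(cmod (matrix_act r A z k))\<^sup>2 \<le> (\<Sum>l<r. cmod (A k l) * cmod (z l))\<^sup>2"
      by (intro power_mono) auto
    also have "\<dots> \<le> (\<Sum>l<r. (cmod (A k l))\<^sup>2) * (\<Sum>l<r. (cmod (z l))\<^sup>2)"
      by (rule Cauchy_Schwarz_ineq_sum)
    finally show ?thesis .
  qed
  then show ?thesis by (simp add: sum_distrib_right sum_mono)
qed

lemma block_op_raw:
  fixes ofs :: int
  assumes r: "r \<ge> 1" and h: "hs_bound r \<beta> c"
  defines "T \<equiv> \<lambda>w. unblock r ofs (\<lambda>b. matrix_act r (\<beta> b) (block r ofs w b))"
  shows "block r ofs (T w) b = (\<lambda>k. if k < r then matrix_act r (\<beta> b) (block r ofs w b) k else 0)"
    and "bounded_linear T" and "norm (T w) \<le> c * norm w"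
proof -
  have le: "(\<Sum>k<r. (cmod (matrix_act r (\<beta> b) (block r ofs w b) k))\<^sup>2) \<le> c\<^sup>2 * (\<Sum>l<r. (cmod (block r ofs w b l))\<^sup>2)" for w b
    by (rule order_trans[OF matrix_act_bound mult_right_mono]) (use h in \<open>auto simp: hs_bound_def intro: sum_nonneg\<close>)
  have sm: "(\<lambda>b. \<Sum>k<r. (cmod (matrix_act r (\<beta> b) (block r ofs w b) k))\<^sup>2) summable_on UNIV" for w
    by (rule summable_on_comparison_test[OF summable_on_cmult_right[OF summable_block[OF r]] le])
       (auto intro: sum_nonneg)
  show B: "block r ofs (T w) b = (\<lambda>k. if k < r then matrix_act r (\<beta> b) (block r ofs w b) k else 0)" for w b
    unfolding T_def by (rule block_unblock[OF r sm])
  have N: "norm (T w) \<le> c * norm w" for w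
  proof -
    have "(norm (T w))\<^sup>2 = (\<Sum>\<^sub>\<infinity>b. \<Sum>k<r. (cmod (matrix_act r (\<beta> b) (block r ofs w b) k))\<^sup>2)"
      unfolding norm_block[OF r, of _ ofs] B by simp
    also have "\<dots> \<le> (\<Sum>\<^sub>\<infinity>b. c\<^sup>2 * (\<Sum>l<r. (cmod (block r ofs w b l))\<^sup>2))"
      by (rule infsum_mono[OF sm summable_on_cmult_right[OF summable_block[OF r]] le])
    also have "\<dots> = (c * norm w)\<^sup>2"
      by (simp add: infsum_cmult_right' norm_block[OF r, of w ofs] power_mult_distrib)
    finally show ?thesis by (rule power2_le_imp_le) (use h in \<open>simp add: hs_bound_def\<close>)
  qed
  then show "norm (T w) \<le> c * norm w" .
  show "bounded_linear T"
  proof (rule bounded_linear_intro)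
    show "T (x + y) = T x + T y" for x y
      by (rule block_eqI[OF r, of ofs]) (auto simp: B block_add matrix_act_def algebra_simps sum.distrib)
    show "T (s *\<^sub>R x) = s *\<^sub>R T x" for s x
      by (rule block_eqI[OF r, of ofs])
         (auto simp: B scaleR_conv_scaleC block_scaleC matrix_act_def algebra_simps sum_distrib_left)
    show "norm (T x) \<le> norm x * c" for x using N by (simp add: mult.commute)
  qed
qed

lemma block_op_block:
  assumes r: "r \<ge> 1" and h: "hs_bound r \<beta> c"
  shows "block r ofs (blinfun_apply (block_op r ofs \<beta>) w) b = (\<lambda>k. if k < r then matrix_act r (\<beta> b) (block r ofs w b) k else 0)"
  unfolding block_op_def using block_op_raw[OF r h] by (simp add: bounded_linear_Blinfun_apply)

lemma norm_block_op:
  assumes r: "r \<ge> 1" and h: "hs_bound r \<beta> c"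
  shows "norm (block_op r ofs \<beta>) \<le> c"
proof (rule norm_blinfun_bound)
  show "c \<ge> 0" using h by (simp add: hs_bound_def)
  show "norm (blinfun_apply (block_op r ofs \<beta>) w) \<le> c * norm w" for w
    unfolding block_op_def using block_op_raw[OF r h] by (simp add: bounded_linear_Blinfun_apply)
qed

lemma block_op_diff:
  assumes r: "r \<ge> 1" and h: "hs_bound r \<beta> c" "hs_bound r \<beta>' c'" "hs_bound r (\<lambda>b k l. \<beta> b k l - \<beta>' b k l) d"
  shows "block_op r ofs \<beta> - block_op r ofs \<beta>' = block_op r ofs (\<lambda>b k l. \<beta> b k l - \<beta>' b k l)"
  by (rule blinfun_eqI, rule block_eqI[OF r, of ofs])
     (auto simp: blinfun.diff_left block_minus block_op_block[OF r h(1)] block_op_block[OF r h(2)] block_op_block[OF r h(3)]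
       matrix_act_def left_diff_distrib sum_subtractf)

lemma hs_unitary:
  assumes "A \<in> unitary_matrices r" shows "(\<Sum>k<r. \<Sum>l<r. (cmod (A k l))\<^sup>2) = real r"
proof -
  have "complex_of_real (\<Sum>l<r. \<Sum>k<r. (cmod (A k l))\<^sup>2) = (\<Sum>l<r. \<Sum>k<r. cnj (A k l) * A k l)"
    unfolding of_real_sum by (intro sum.cong refl) (simp add: complex_norm_square mult.commute flip: of_real_power)
  also have "\<dots> = (\<Sum>l<r. 1)"
    using assms by (intro sum.cong) (auto simp: unitary_matrices_def)
  finally have "complex_of_real (\<Sum>l<r. \<Sum>k<r. (cmod (A k l))\<^sup>2) = of_real (real r)" by simp
  then have "(\<Sum>l<r. \<Sum>k<r. (cmod (A k l))\<^sup>2) = real r" by (simp only: of_real_eq_iff)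
  then show ?thesis by (subst sum.swap)
qed

lemma hs_bound_unitary: "(\<And>b. \<beta> b \<in> unitary_matrices r) \<Longrightarrow> hs_bound r \<beta> (sqrt (real r))"
  by (simp add: hs_bound_def hs_unitary)

lemma block_op_block_unitary:
  assumes r: "r \<ge> 1" and \<beta>: "\<And>b. \<beta> b \<in> unitary_matrices r"
  shows "block r ofs (blinfun_apply (block_op r ofs \<beta>) w) b = matrix_act r (\<beta> b) (block r ofs w b)"
  unfolding block_op_block[OF r hs_bound_unitary[OF \<beta>]]
  using \<beta> by (auto simp: matrix_act_def unitary_matrices_def fun_eq_iff)

definition adjoint_matrix :: "nat \<Rightarrow> (nat \<Rightarrow> nat \<Rightarrow> complex) \<Rightarrow> (nat \<Rightarrow> nat \<Rightarrow> complex)" where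
  "adjoint_matrix r A i j = (if i < r \<and> j < r then cnj (A j i) else 0)"

lemma adjoint_matrix_unitary:
  assumes A: "A \<in> unitary_matrices r" shows "adjoint_matrix r A \<in> unitary_matrices r"
proof -
  have "(\<Sum>k<r. A i k * cnj (A j k)) = (if i = j then 1 else 0)" if "i < r" "j < r" for i j
    by (rule unitary_rows[of r A]) (use A that in \<open>auto simp: unitary_matrices_def\<close>)
  then show ?thesis by (auto simp: unitary_matrices_def adjoint_matrix_def)
qed

lemma adjoint_matrix_adjoint_matrix: "A \<in> unitary_matrices r \<Longrightarrow> adjoint_matrix r (adjoint_matrix r A) = A"
  by (auto simp: adjoint_matrix_def unitary_matrices_def fun_eq_iff)

lemma adjoint_matrix_act:
  assumes A: "A \<in> unitary_matrices r" and z: "z \<in> cspace r"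
  shows "matrix_act r (adjoint_matrix r A) (matrix_act r A z) = z"
proof
  fix i
  show "matrix_act r (adjoint_matrix r A) (matrix_act r A z) i = z i"
  proof (cases "i < r")
    case True
    have "matrix_act r (adjoint_matrix r A) (matrix_act r A z) i = (\<Sum>l<r. (\<Sum>k<r. cnj (A k i) * A k l) * z l)"
      unfolding matrix_act_def sum_distrib_left sum_distrib_right
      by (subst sum.swap) (simp add: adjoint_matrix_def True mult.assoc)
    also have "\<dots> = (\<Sum>l<r. if i = l then z l else 0)"
      using A True by (intro sum.cong) (auto simp: unitary_matrices_def)
    finally show ?thesis using True by simp
  next
    case False
    then show ?thesis using z by (simp add: matrix_act_def adjoint_matrix_def cspace_def)
  qed
qed

lemma block_op_inverse:
  assumes r: "r \<ge> 1" and \<beta>: "\<And>b. \<beta> b \<in> unitary_matrices r"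
  shows "blinfun_apply (block_op r ofs (\<lambda>b. adjoint_matrix r (\<beta> b))) (blinfun_apply (block_op r ofs \<beta>) w) = w"
    "blinfun_apply (block_op r ofs \<beta>) (blinfun_apply (block_op r ofs (\<lambda>b. adjoint_matrix r (\<beta> b))) w) = w"
proof -
  note ad = adjoint_matrix_unitary[OF \<beta>]
  show "blinfun_apply (block_op r ofs (\<lambda>b. adjoint_matrix r (\<beta> b))) (blinfun_apply (block_op r ofs \<beta>) w) = w"
    by (rule block_eqI[OF r, of ofs]) (simp add: block_op_block_unitary[OF r \<beta>] block_op_block_unitary[OF r ad] adjoint_matrix_act[OF \<beta> block_cspace])
  show "blinfun_apply (block_op r ofs \<beta>) (blinfun_apply (block_op r ofs (\<lambda>b. adjoint_matrix r (\<beta> b))) w) = w"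
    by (rule block_eqI[OF r, of ofs])
       (use adjoint_matrix_act[OF ad block_cspace] in \<open>simp add: block_op_block_unitary[OF r \<beta>] block_op_block_unitary[OF r ad] adjoint_matrix_adjoint_matrix[OF \<beta>]\<close>)
qed

lemma unitary_block_op:
  assumes r: "r \<ge> 1" and \<beta>: "\<And>b. \<beta> b \<in> unitary_matrices r"
  shows "unitary_ell2 (block_op r ofs \<beta>)"
  unfolding unitary_ell2_def
proof (intro conjI allI)
  note B = block_op_block_unitary[OF r \<beta>]
  show "blinfun_apply (block_op r ofs \<beta>) (scaleC_ell2 c x) = scaleC_ell2 c (blinfun_apply (block_op r ofs \<beta>) x)" for c x
    by (rule block_eqI[OF r, of ofs]) (auto simp: B block_scaleC matrix_act_def sum_distrib_left mult_ac)
  show "surj (blinfun_apply (block_op r ofs \<beta>))"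
    by (rule surjI[where f = "blinfun_apply (block_op r ofs (\<lambda>b. adjoint_matrix r (\<beta> b)))"]) (rule block_op_inverse(2)[OF r \<beta>])
  show "cinner_ell2 (blinfun_apply (block_op r ofs \<beta>) x) (blinfun_apply (block_op r ofs \<beta>) y) = cinner_ell2 x y" for x y
  proof -
    have "(\<Sum>k<r. cnj (matrix_act r (\<beta> b) z k) * matrix_act r (\<beta> b) z' k) = (\<Sum>l<r. cnj (z l) * z' l)"
      if "z' \<in> cspace r" for b z z'
    proof -
      have "(\<Sum>k<r. cnj (matrix_act r (\<beta> b) z k) * matrix_act r (\<beta> b) z' k) =
            (\<Sum>l<r. cnj (z l) * matrix_act r (adjoint_matrix r (\<beta> b)) (matrix_act r (\<beta> b) z') l)"
        unfolding matrix_act_def[of r "\<beta> b" z] matrix_act_def[of r "adjoint_matrix r (\<beta> b)"] cnj_sum sum_distrib_left sum_distrib_right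
        by (subst sum.swap) (intro sum.cong refl, simp add: adjoint_matrix_def mult_ac)
      then show ?thesis by (simp add: adjoint_matrix_act[OF \<beta> that])
    qed
    then show ?thesis unfolding cinner_block[OF r, of _ _ ofs] B by (simp add: block_cspace)
  qed
qed

text \<open>An entry of the operator vanishes unless its row and its column belong to the same block.\<close>

lemma op_entry_block_op:
  assumes r: "r \<ge> 1" and \<beta>: "\<And>b. \<beta> b \<in> unitary_matrices r" and ne: "op_entry (block_op r ofs \<beta>) i j \<noteq> 0"
  shows "nat \<bar>i - j\<bar> \<le> r"
proof -
  obtain b k where i: "i = ofs + int r * b + int k" "k < r"
    using bij_betw_imp_surj_on[OF bij_blocks[OF r, of ofs]] by force
  have "ell2_nth (blinfun_apply (block_op r ofs \<beta>) (ell2_basis j)) i = block r ofs (blinfun_apply (block_op r ofs \<beta>) (ell2_basis j)) b k"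
    using i by (simp add: block_def)
  also have "\<dots> = (\<Sum>l<r. \<beta> b k l * block r ofs (ell2_basis j) b l)"
    unfolding block_op_block_unitary[OF r \<beta>] matrix_act_def ..
  finally have "(\<Sum>l<r. \<beta> b k l * block r ofs (ell2_basis j) b l) \<noteq> 0" using ne by (simp add: op_entry_def)
  then obtain l where "l < r" "block r ofs (ell2_basis j) b l \<noteq> 0"
    by (metis (no_types, lifting) lessThan_iff mult_zero_right sum.neutral)
  then have "j = ofs + int r * b + int l" "l < r" by (auto simp: block_def split: if_splits)
  with i show ?thesis by simp
qed

lemma propagation_le_iff: "propagation U \<le> enat L \<longleftrightarrow> (\<forall>i j. op_entry U i j \<noteq> 0 \<longrightarrow> nat \<bar>i - j\<bar> \<le> L)"
  unfolding propagation_def by (auto simp: SUP_le_iff)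

lemma block_op_finite_prop:
  assumes r: "r \<ge> 1" and \<beta>: "\<And>b. \<beta> b \<in> unitary_matrices r"
  shows "block_op r ofs \<beta> \<in> finite_prop_unitaries r"
  unfolding finite_prop_unitaries_def propagation_le_iff
  by (intro CollectI conjI allI impI unitary_block_op[OF r \<beta>] op_entry_block_op[OF r \<beta>])

text \<open>Only finitely many different matrix functions occur among the blocks, so that continuity of the
  blocks is uniform.\<close>

lemma continuous_on_block_op:
  fixes M :: "'k \<Rightarrow> 'x::t2_space \<Rightarrow> nat \<Rightarrow> nat \<Rightarrow> complex"
  assumes r: "r \<ge> 1" and K: "finite K" "\<And>b. key b \<in> K"
    and c: "\<And>\<kappa> k l. \<kappa> \<in> K \<Longrightarrow> k < r \<Longrightarrow> l < r \<Longrightarrow> continuous_on S (\<lambda>x. M \<kappa> x k l)"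
    and u: "\<And>\<kappa> x. \<kappa> \<in> K \<Longrightarrow> x \<in> S \<Longrightarrow> M \<kappa> x \<in> unitary_matrices r"
  shows "continuous_on S (\<lambda>x. block_op r ofs (\<lambda>b. M (key b) x))"
  unfolding continuous_on_def
proof
  fix x0 assume x0: "x0 \<in> S"
  \<comment> \<open>Summing over the finite set of keys bounds all blocks at once.\<close>
  define D where "D x = (\<Sum>\<kappa>\<in>K. \<Sum>k<r. \<Sum>l<r. (cmod (M \<kappa> x k l - M \<kappa> x0 k l))\<^sup>2)" for x
  have "continuous_on S (\<lambda>x. (cmod (M \<kappa> x k l - M \<kappa> x0 k l))\<^sup>2)" if "\<kappa> \<in> K" "k \<in> {..<r}" "l \<in> {..<r}" for \<kappa> k l
    by (rule continuous_on_power[OF continuous_on_norm[OF continuous_on_diff[OF c continuous_on_const]]])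
       (use that in simp_all)
  then have "continuous_on S D"
    unfolding D_def by (intro continuous_on_sum)
  then have "(D \<longlongrightarrow> D x0) (at x0 within S)" using x0 by (simp add: continuous_on_def)
  moreover have "D x0 = 0" by (simp add: D_def)
  ultimately have lim: "((\<lambda>x. sqrt (D x)) \<longlongrightarrow> 0) (at x0 within S)"
    using tendsto_real_sqrt[of D 0 "at x0 within S"] by (simp only: real_sqrt_zero)
  have "norm (block_op r ofs (\<lambda>b. M (key b) x) - block_op r ofs (\<lambda>b. M (key b) x0)) \<le> sqrt (D x)" if x: "x \<in> S" for x
  proof -
    have h: "hs_bound r (\<lambda>b. M (key b) x) (sqrt (real r))" if "x \<in> S" for x
      by (rule hs_bound_unitary) (rule u[OF K(2) that])
    have D0: "D x \<ge> 0" unfolding D_def by (intro sum_nonneg) auto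
    have hd: "hs_bound r (\<lambda>b k l. M (key b) x k l - M (key b) x0 k l) (sqrt (D x))"
      unfolding hs_bound_def
    proof (intro conjI allI)
      fix b
      have "(\<Sum>k<r. \<Sum>l<r. (cmod (M (key b) x k l - M (key b) x0 k l))\<^sup>2) \<le> D x"
        unfolding D_def
        by (rule member_le_sum[OF K(2), where f = "\<lambda>\<kappa>. \<Sum>k<r. \<Sum>l<r. (cmod (M \<kappa> x k l - M \<kappa> x0 k l))\<^sup>2"])
           (simp_all add: sum_nonneg K(1))
      then show "(\<Sum>k<r. \<Sum>l<r. (cmod (M (key b) x k l - M (key b) x0 k l))\<^sup>2) \<le> (sqrt (D x))\<^sup>2"
        using D0 by simp
    qed (use D0 in simp)
    show ?thesis
      unfolding block_op_diff[OF r h[OF x] h[OF x0] hd] by (rule norm_block_op[OF r hd])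
  qed
  then have "\<forall>\<^sub>F x in at x0 within S. norm (block_op r ofs (\<lambda>b. M (key b) x) - block_op r ofs (\<lambda>b. M (key b) x0)) \<le> sqrt (D x)"
    unfolding eventually_at_filter by simp
  from Lim_null_comparison[OF this lim]
  have "((\<lambda>x. block_op r ofs (\<lambda>b. M (key b) x) - block_op r ofs (\<lambda>b. M (key b) x0)) \<longlongrightarrow> 0) (at x0 within S)" .
  then show "((\<lambda>x. block_op r ofs (\<lambda>b. M (key b) x)) \<longlongrightarrow> block_op r ofs (\<lambda>b. M (key b) x0)) (at x0 within S)"
    unfolding Lim_null[of "\<lambda>x. block_op r ofs (\<lambda>b. M (key b) x)"] .
qed

text \<open>The image of a basis vector is a finite combination of nearby basis vectors, so the entries of a composition
  are finite sums of products.\<close>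

lemma finite_prop_compose:
  assumes U: "U \<in> finite_prop_unitaries L" and V: "V \<in> finite_prop_unitaries L'"
  shows "U o\<^sub>L V \<in> finite_prop_unitaries (L + L')"
proof -
  have uU: "unitary_ell2 U" and uV: "unitary_ell2 V" using U V by (auto simp: finite_prop_unitaries_def)
  have pU: "op_entry U i j \<noteq> 0 \<Longrightarrow> nat \<bar>i - j\<bar> \<le> L" and pV: "op_entry V i j \<noteq> 0 \<Longrightarrow> nat \<bar>i - j\<bar> \<le> L'" for i j
    using U V by (auto simp: finite_prop_unitaries_def propagation_le_iff)
  have "unitary_ell2 (U o\<^sub>L V)"
    using uU uV unfolding unitary_ell2_def by (auto simp: surj_def) metis
  moreover have "nat \<bar>i - j\<bar> \<le> L + L'" if ne: "op_entry (U o\<^sub>L V) i j \<noteq> 0" for i j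
  proof -
    let ?J = "{j - int L'..j + int L'}"
    have "blinfun_apply V (ell2_basis j) = (\<Sum>k\<in>?J. scaleC_ell2 (op_entry V k j) (ell2_basis k))"
    proof (rule ell2_eqI)
      fix i
      have "op_entry V i j = 0" if "i \<notin> ?J" using pV[of i j] that by force
      then show "ell2_nth (blinfun_apply V (ell2_basis j)) i = ell2_nth (\<Sum>k\<in>?J. scaleC_ell2 (op_entry V k j) (ell2_basis k)) i"
        by (cases "i \<in> ?J") (auto simp: ell2_nth_sum scaleC_ell2.rep_eq op_entry_def if_distrib[of "\<lambda>x. _ * x"] cong: if_cong)
    qed
    then have "blinfun_apply U (blinfun_apply V (ell2_basis j)) = (\<Sum>k\<in>?J. scaleC_ell2 (op_entry V k j) (blinfun_apply U (ell2_basis k)))"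
      using uU by (simp only: blinfun.sum_right unitary_ell2_def)
    then have "op_entry (U o\<^sub>L V) i j = (\<Sum>k\<in>?J. op_entry V k j * op_entry U i k)"
      by (simp only: op_entry_def[of "U o\<^sub>L V"] op_entry_def[of U] blinfun_apply_blinfun_compose o_apply ell2_nth_sum scaleC_ell2.rep_eq)
    with ne obtain k where "op_entry V k j \<noteq> 0" "op_entry U i k \<noteq> 0"
      by (metis (no_types, lifting) mult_eq_0_iff sum.neutral)
    then show ?thesis using pU[of i k] pV[of k j] by linarith
  qed
  ultimately show ?thesis by (simp add: finite_prop_unitaries_def propagation_le_iff)
qed


section \<open>Completed sums as bundles with end\<close>

text \<open>Continuity into the inductive limit is clear for maps into one of its stages.\<close>

lemma continuous_map_end_unitary_group:
  assumes T: "continuous_on S T" and fp: "\<And>x. x \<in> S \<Longrightarrow> T x \<in> finite_prop_unitaries L"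
  shows "continuous_map (top_of_set S) end_unitary_group T"
proof -
  have "continuous_map (top_of_set (finite_prop_unitaries L)) end_unitary_group (\<lambda>x. x)"
    unfolding end_unitary_group_def inductive_limit_def
    using continuous_map_into_final_topology[of L UNIV "\<lambda>L. top_of_set (finite_prop_unitaries L)" "\<lambda>_ x. x" "\<Union>L. finite_prop_unitaries L"]
    by auto
  moreover have "continuous_map (top_of_set S) (top_of_set (finite_prop_unitaries L)) T"
    using assms by (auto simp: continuous_map_in_subtopology)
  ultimately have "continuous_map (top_of_set S) end_unitary_group ((\<lambda>x. x) \<circ> T)"
    by (rule continuous_map_compose[rotated])
  then show ?thesis by (simp add: o_def)
qed

lemma continuous_on_action:
  assumes "continuous_on S T"
  shows "continuous_on (S \<times> UNIV) (\<lambda>p. (fst p, blinfun_apply (T (fst p)) (snd p)))"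
  by (rule continuous_on_Pair[OF continuous_on_fst[OF continuous_on_id]
        blinfun.continuous_on[OF continuous_on_compose2[OF assms continuous_on_fst[OF continuous_on_id]]
          continuous_on_snd[OF continuous_on_id]]]) auto

lemma continuous_map_action:
  assumes "continuous_on S T"
  shows "continuous_map (top_of_set (S \<times> UNIV)) (top_of_set (S \<times> UNIV)) (\<lambda>p. (fst p, blinfun_apply (T (fst p)) (snd p)))"
  using continuous_on_action[OF assms] by (auto simp: continuous_map_in_subtopology)

lemma prod_nsphere:
  "U \<subseteq> topspace (nsphere m) \<Longrightarrow> prod_topology (subtopology (nsphere m) U) euclidean = top_of_set (U \<times> (UNIV :: 'a::topological_space set))"
  using prod_topology_subtopology_eu[of U "UNIV :: 'a set"] by (simp only: subtopology_nsphere subtopology_UNIV)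

lemma id_finite_prop: "id_blinfun \<in> finite_prop_unitaries 0"
  by (auto simp: finite_prop_unitaries_def propagation_le_iff unitary_ell2_def op_entry_def)

lemma ell2_block_eq: "ell2_block m w i = block m 0 w i"
  by (rule ext) (simp add: ell2_block_def block_def)

lemma bounded_int_seqs_finite_range:
  assumes "a \<in> bounded_int_seqs" shows "finite (range a)"
proof -
  obtain C where "\<forall>i. \<bar>a i\<bar> \<le> C" using assms by (auto simp: bounded_int_seqs_def)
  then have "range a \<subseteq> {-C..C}" by (auto simp: abs_le_iff minus_le_iff)
  then show ?thesis by (rule finite_subset) simp
qed

context classified_bundles
begin

abbreviation sum_bundle :: "(int \<Rightarrow> int) \<Rightarrow> (hemisphere, nat \<Rightarrow> real, int \<Rightarrow> 'e, ell2) gbundle" where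
  "sum_bundle a \<equiv> completed_sum m (nsphere m) N E a"

abbreviation sum_chart :: "(int \<Rightarrow> int) \<Rightarrow> hemisphere \<Rightarrow> (nat \<Rightarrow> real) \<times> ell2 \<Rightarrow> (int \<Rightarrow> 'e)" where
  "sum_chart \<equiv> completed_sum_chart m E"

lemma sum_chart_eq_iff:
  "sum_chart a c (x, w) = sum_chart a d (x, w') \<longleftrightarrow> (\<forall>i. chart (E (a i)) c (x, block m 0 w i) = chart (E (a i)) d (x, block m 0 w' i))"
  by (simp add: completed_sum_chart_def ell2_block_eq fun_eq_iff)

lemma sum_chart_inj: "x \<in> N c \<Longrightarrow> sum_chart a c (x, w) = sum_chart a c (x, w') \<Longrightarrow> w = w'"
  unfolding sum_chart_eq_iff by (rule block_eqI[OF m]) (blast intro: chart_inj block_cspace)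

lemma base_proj_chart: "x \<in> N c \<Longrightarrow> z \<in> cspace m \<Longrightarrow> base_proj (E k) (chart (E k) c (x, z)) = x"
  using E[of k] unfolding fibre_bundle_def E_cover by simp

lemma base_proj_sum_chart: "x \<in> N c \<Longrightarrow> base_proj (E (a 0)) (sum_chart a c (x, w) 0) = x"
  by (simp add: completed_sum_chart_def ell2_block_eq base_proj_chart block_cspace)

definition sum_total :: "(int \<Rightarrow> int) \<Rightarrow> (int \<Rightarrow> 'e) set" where
  "sum_total a = (\<Union>x\<in>topspace (nsphere m). completed_sum_fibre m E a x)"

text \<open>A square summable family of coordinates in the summands is the family of blocks of one vector.\<close>

lemma sum_total_iff: "v \<in> sum_total a \<longleftrightarrow> (\<exists>c x w. x \<in> N c \<and> v = sum_chart a c (x, w))"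
proof
  assume "v \<in> sum_total a"
  then obtain x c z where z: "\<forall>i. x \<in> N c \<and> z i \<in> cspace m \<and> v i = chart (E (a i)) c (x, z i)"
    and s: "(\<lambda>i. \<Sum>k<m. (cmod (z i k))\<^sup>2) summable_on UNIV"
    unfolding sum_total_def completed_sum_fibre_def E_cover by blast
  have be: "block m 0 (unblock m 0 z) i = z i" for i
    unfolding block_unblock[OF m s] using z by (auto simp: cspace_def fun_eq_iff)
  have "v = sum_chart a c (x, unblock m 0 z)"
    using z by (intro ext) (simp add: completed_sum_chart_def ell2_block_eq be)
  then show "\<exists>c x w. x \<in> N c \<and> v = sum_chart a c (x, w)" using z by blast
next
  assume "\<exists>c x w. x \<in> N c \<and> v = sum_chart a c (x, w)"
  then obtain c x w where v: "x \<in> N c" "v = sum_chart a c (x, w)" by blast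
  have "v \<in> completed_sum_fibre m E a x"
    unfolding completed_sum_fibre_def E_cover
    using v summable_block[OF m, of 0 w]
    by (intro CollectI exI[of _ c] exI[of _ "block m 0 w"]) (simp add: completed_sum_chart_def ell2_block_eq block_cspace)
  then show "v \<in> sum_total a" unfolding sum_total_def using v(1) N_sub[of c] by blast
qed

lemma sum_chart_sum_total: "x \<in> N c \<Longrightarrow> sum_chart a c (x, w) \<in> sum_total a"
  using sum_total_iff by blast

lemma total_sum_bundle: "total (sum_bundle a) = final_topology (sum_total a) UNIV (\<lambda>c. top_of_set (N c \<times> UNIV)) (sum_chart a)"
  by (simp add: completed_sum_def sum_total_def prod_nsphere[OF N_sub])

lemma topspace_sum_bundle: "topspace (total (sum_bundle a)) = sum_total a"
  unfolding total_sum_bundle by (rule topspace_final_topology) (auto simp: sum_chart_sum_total)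

lemma continuous_map_from_sum_bundle:
  assumes "\<And>c. continuous_map (top_of_set (N c \<times> UNIV)) Y (\<lambda>p. h (sum_chart a c p))"
  shows "continuous_map (total (sum_bundle a)) Y h"
  unfolding total_sum_bundle
proof (rule continuous_map_from_final_topology)
  show "\<exists>i\<in>UNIV. \<exists>x\<in>topspace (top_of_set (N i \<times> UNIV)). s = sum_chart a i x" if "s \<in> sum_total a" for s
    using that unfolding sum_total_iff by auto
qed (use assms in \<open>auto simp: sum_chart_sum_total\<close>)

lemma continuous_map_sum_chart: "continuous_map (top_of_set (N c \<times> UNIV)) (total (sum_bundle a)) (sum_chart a c)"
  unfolding total_sum_bundle by (rule continuous_map_into_final_topology) (auto simp: sum_chart_sum_total)

definition trans_mat :: "int \<Rightarrow> hemisphere \<Rightarrow> hemisphere \<Rightarrow> (nat \<Rightarrow> real) \<Rightarrow> nat \<Rightarrow> nat \<Rightarrow> complex" where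
  "trans_mat k c d = (SOME g. continuous_map (subtopology (nsphere m) (N c \<inter> N d)) (top_of_set (unitary_matrices m)) g \<and>
    (\<forall>s\<in>N c \<inter> N d. \<forall>z\<in>cspace m. chart (E k) c (s, z) = chart (E k) d (s, matrix_act m (g s) z)))"

lemma trans_mat:
  "continuous_on (N c \<inter> N d) (\<lambda>x. trans_mat k c d x i j)"
  "x \<in> N c \<inter> N d \<Longrightarrow> trans_mat k c d x \<in> unitary_matrices m"
  "x \<in> N c \<inter> N d \<Longrightarrow> z \<in> cspace m \<Longrightarrow> chart (E k) c (x, z) = chart (E k) d (x, matrix_act m (trans_mat k c d x) z)"
proof -
  from someI_ex[OF E_transition[of c d k]]
  have g: "continuous_map (subtopology (nsphere m) (N c \<inter> N d)) (top_of_set (unitary_matrices m)) (trans_mat k c d)"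
     "\<forall>s\<in>N c \<inter> N d. \<forall>z\<in>cspace m. chart (E k) c (s, z) = chart (E k) d (s, matrix_act m (trans_mat k c d s) z)"
    unfolding trans_mat_def[symmetric] by blast+
  have "subtopology (nsphere m) (N c \<inter> N d) = top_of_set (N c \<inter> N d)"
    by (rule subtopology_nsphere) (use N_sub in blast)
  then have g1: "continuous_on (N c \<inter> N d) (trans_mat k c d)" "trans_mat k c d \<in> N c \<inter> N d \<rightarrow> unitary_matrices m"
    using g(1) by (auto simp: continuous_map_in_subtopology)
  show "continuous_on (N c \<inter> N d) (\<lambda>x. trans_mat k c d x i j)"
    by (rule continuous_on_product_then_coordinatewise[OF continuous_on_product_then_coordinatewise[OF g1(1)]])
  show "x \<in> N c \<inter> N d \<Longrightarrow> trans_mat k c d x \<in> unitary_matrices m" using g1(2) by auto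
  show "x \<in> N c \<inter> N d \<Longrightarrow> z \<in> cspace m \<Longrightarrow> chart (E k) c (x, z) = chart (E k) d (x, matrix_act m (trans_mat k c d x) z)"
    using g(2) by blast
qed

definition trans_op :: "(int \<Rightarrow> int) \<Rightarrow> hemisphere \<Rightarrow> hemisphere \<Rightarrow> (nat \<Rightarrow> real) \<Rightarrow> (ell2 \<Rightarrow>\<^sub>L ell2)" where
  "trans_op a c d x = block_op m 0 (\<lambda>i. trans_mat (a i) c d x)"

lemma trans_op:
  "a \<in> bounded_int_seqs \<Longrightarrow> continuous_on (N c \<inter> N d) (trans_op a c d)"
  "x \<in> N c \<inter> N d \<Longrightarrow> trans_op a c d x \<in> finite_prop_unitaries m"
  "x \<in> N c \<inter> N d \<Longrightarrow> sum_chart a c (x, w) = sum_chart a d (x, blinfun_apply (trans_op a c d x) w)"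
proof -
  show "continuous_on (N c \<inter> N d) (trans_op a c d)" if "a \<in> bounded_int_seqs"
    unfolding trans_op_def
    by (rule continuous_on_block_op[OF m bounded_int_seqs_finite_range[OF that], of a "N c \<inter> N d" "\<lambda>k. trans_mat k c d"])
       (simp_all add: trans_mat)
  assume x: "x \<in> N c \<inter> N d"
  show "trans_op a c d x \<in> finite_prop_unitaries m"
    unfolding trans_op_def by (rule block_op_finite_prop[OF m]) (rule trans_mat(2)[OF x])
  show "sum_chart a c (x, w) = sum_chart a d (x, blinfun_apply (trans_op a c d x) w)"
    unfolding sum_chart_eq_iff trans_op_def block_op_block_unitary[OF m trans_mat(2)[OF x]] using trans_mat(3)[OF x] block_cspace by blast
qed

text \<open>The image of an open set is open, since its preimage under another chart is given by the change of
  coordinates, which is continuous.\<close>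

lemma sum_chart_homeomorphic:
  assumes a: "a \<in> bounded_int_seqs"
  shows "homeomorphic_map (top_of_set (N c \<times> UNIV))
     (subtopology (total (sum_bundle a)) {e \<in> sum_total a. base_proj (E (a 0)) (e 0) \<in> N c}) (sum_chart a c)"
proof (rule bijective_open_imp_homeomorphic_map)
  let ?S = "{e \<in> sum_total a. base_proj (E (a 0)) (e 0) \<in> N c}"
  show "continuous_map (top_of_set (N c \<times> UNIV)) (subtopology (total (sum_bundle a)) ?S) (sum_chart a c)"
    unfolding continuous_map_in_subtopology using continuous_map_sum_chart[of c a] by (auto simp: sum_chart_sum_total base_proj_sum_chart)
  show im: "sum_chart a c ` topspace (top_of_set (N c \<times> UNIV)) = topspace (subtopology (total (sum_bundle a)) ?S)"
  proof
    show "sum_chart a c ` topspace (top_of_set (N c \<times> UNIV)) \<subseteq> topspace (subtopology (total (sum_bundle a)) ?S)"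
      by (auto simp: topspace_sum_bundle sum_chart_sum_total base_proj_sum_chart)
    show "topspace (subtopology (total (sum_bundle a)) ?S) \<subseteq> sum_chart a c ` topspace (top_of_set (N c \<times> UNIV))"
    proof
      fix e assume "e \<in> topspace (subtopology (total (sum_bundle a)) ?S)"
      then have "e \<in> sum_total a" "base_proj (E (a 0)) (e 0) \<in> N c" by (auto simp: topspace_sum_bundle)
      then obtain d x w where e: "x \<in> N d" "x \<in> N c" "e = sum_chart a d (x, w)"
        unfolding sum_total_iff using base_proj_sum_chart by metis
      then have "e = sum_chart a c (x, blinfun_apply (trans_op a d c x) w)" using trans_op(3)[of x d c a w] by simp
      then show "e \<in> sum_chart a c ` topspace (top_of_set (N c \<times> UNIV))" using e(2) by auto
    qed
  qed
  show "inj_on (sum_chart a c) (topspace (top_of_set (N c \<times> UNIV)))"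
  proof (rule inj_onI)
    fix p p' assume pp: "p \<in> topspace (top_of_set (N c \<times> (UNIV::ell2 set)))" "p' \<in> topspace (top_of_set (N c \<times> (UNIV::ell2 set)))" "sum_chart a c p = sum_chart a c p'"
    then have *: "fst p \<in> N c" "fst p' \<in> N c" by auto
    have "fst p = fst p'"
      using base_proj_sum_chart[OF *(1), of a "snd p"] base_proj_sum_chart[OF *(2), of a "snd p'"] pp(3) by simp
    moreover have "snd p = snd p'"
      using sum_chart_inj[OF *(1), of a "snd p" "snd p'"] pp(3) calculation by (metis prod.collapse)
    ultimately show "p = p'" by (simp add: prod_eq_iff)
  qed
  show "open_map (top_of_set (N c \<times> UNIV)) (subtopology (total (sum_bundle a)) ?S) (sum_chart a c)"
    unfolding open_map_def
  proof (intro allI impI)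
    fix U :: "((nat \<Rightarrow> real) \<times> ell2) set" assume U: "openin (top_of_set (N c \<times> UNIV)) U"
    have US: "U \<subseteq> N c \<times> UNIV" using openin_subset[OF U] by simp
    have "openin (total (sum_bundle a)) (sum_chart a c ` U)"
      unfolding total_sum_bundle openin_final_topology
    proof (intro conjI ballI)
      show "sum_chart a c ` U \<subseteq> sum_total a" using US sum_chart_sum_total by fastforce
      fix d
      let ?\<phi> = "\<lambda>p. (fst p, blinfun_apply (trans_op a d c (fst p)) (snd p))"
      let ?D = "(N d \<inter> N c) \<times> (UNIV :: ell2 set)"
      have cont: "continuous_on ?D ?\<phi>" by (rule continuous_on_action[OF trans_op(1)[OF a]])
      have "openin (top_of_set ?D) (?D \<inter> ?\<phi> -` U)"
        by (rule continuous_openin_preimage[OF cont _ U]) auto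
      also have "openin (top_of_set (N d \<times> UNIV)) ?D"
      proof (rule openin_Times)
        have "openin (subtopology (nsphere m) (N d)) (N d \<inter> N c)"
          using N_open[of c] by (simp add: openin_subtopology_Int2)
        then show "openin (top_of_set (N d)) (N d \<inter> N c)" by (simp add: subtopology_nsphere[OF N_sub])
      qed simp
      finally have "openin (top_of_set (N d \<times> UNIV)) (?D \<inter> ?\<phi> -` U)" .
      also have "?D \<inter> ?\<phi> -` U = {p \<in> topspace (top_of_set (N d \<times> UNIV)). sum_chart a d p \<in> sum_chart a c ` U}"
      proof (intro equalityI subsetI)
        fix p assume p: "p \<in> ?D \<inter> ?\<phi> -` U"
        then have "sum_chart a d (fst p, snd p) = sum_chart a c (?\<phi> p)" using trans_op(3)[of "fst p" d c a "snd p"] by auto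
        then show "p \<in> {p \<in> topspace (top_of_set (N d \<times> UNIV)). sum_chart a d p \<in> sum_chart a c ` U}" using p by auto
      next
        fix p assume p: "p \<in> {p \<in> topspace (top_of_set (N d \<times> UNIV)). sum_chart a d p \<in> sum_chart a c ` U}"
        then obtain u where u: "u \<in> U" "sum_chart a d p = sum_chart a c u" by auto
        have xd: "fst p \<in> N d" using p by auto
        have xc: "fst u \<in> N c" using u(1) US by auto
        have x: "fst p = fst u"
          using base_proj_sum_chart[OF xd, of a "snd p"] base_proj_sum_chart[OF xc, of a "snd u"] u(2) by simp
        have I: "fst p \<in> N d \<inter> N c" using xd xc x by (simp only: Int_iff simp_thms)
        have "sum_chart a c (fst u, snd u) = sum_chart a d (fst p, snd p)" by (simp add: u(2))
        from trans[OF this trans_op(3)[OF I]]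
        have "sum_chart a c (fst u, snd u) = sum_chart a c (fst u, snd (?\<phi> p))" unfolding x snd_conv .
        then have "snd u = snd (?\<phi> p)" by (rule sum_chart_inj[OF xc])
        then have "?\<phi> p = u" using x by (simp add: prod_eq_iff)
        then show "p \<in> ?D \<inter> ?\<phi> -` U" using u(1) xd xc x by (auto simp: mem_Times_iff)
      qed
      finally show "openin (top_of_set (N d \<times> UNIV)) {p \<in> topspace (top_of_set (N d \<times> UNIV)). sum_chart a d p \<in> sum_chart a c ` U}" .
    qed
    moreover have "sum_chart a c ` U \<subseteq> ?S" using US sum_chart_sum_total base_proj_sum_chart by fastforce
    ultimately show "openin (subtopology (total (sum_bundle a)) ?S) (sum_chart a c ` U)"
      using openin_subtopology_Int[of "total (sum_bundle a)" "sum_chart a c ` U" ?S] by (simp only: Int_absorb2)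
  qed
qed

lemma sum_bundle_simps: "chart_dom (sum_bundle a) = N" "chart (sum_bundle a) = sum_chart a" "base_proj (sum_bundle a) e = base_proj (E (a 0)) (e 0)"
  by (simp_all add: completed_sum_def)

lemma bundle_sum_bundle:
  assumes a: "a \<in> bounded_int_seqs"
  shows "bundle_with_end (nsphere m) (sum_bundle a)"
  unfolding fibre_bundle_def sum_bundle_simps
proof (intro conjI allI ballI)
  show "continuous_map (total (sum_bundle a)) (nsphere m) (\<lambda>e. base_proj (E (a 0)) (e 0))"
  proof (rule continuous_map_from_sum_bundle)
    fix c
    have "continuous_map (prod_topology (subtopology (nsphere m) (N c)) (euclidean :: ell2 topology)) (nsphere m) fst"
      by (rule continuous_map_into_fulltopology[OF continuous_map_fst])
    then have "continuous_map (top_of_set (N c \<times> (UNIV :: ell2 set))) (nsphere m) fst"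
      by (simp only: prod_nsphere[OF N_sub])
    then show "continuous_map (top_of_set (N c \<times> UNIV)) (nsphere m) (\<lambda>p. base_proj (E (a 0)) (sum_chart a c p 0))"
      by (rule continuous_map_eq) (auto simp: base_proj_sum_chart)
  qed
  show "homeomorphic_map (prod_topology (subtopology (nsphere m) (N c)) euclidean)
      (subtopology (total (sum_bundle a)) {e \<in> topspace (total (sum_bundle a)). base_proj (E (a 0)) (e 0) \<in> N c}) (sum_chart a c)" for c
    unfolding prod_nsphere[OF N_sub] topspace_sum_bundle by (rule sum_chart_homeomorphic[OF a])
  show "\<exists>g. continuous_map (subtopology (nsphere m) (N c \<inter> N d)) end_unitary_group g \<and>
      (\<forall>x\<in>N c \<inter> N d. \<forall>v\<in>topspace euclidean. sum_chart a c (x, v) = sum_chart a d (x, blinfun_apply (g x) v))" for c d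
  proof (intro exI[of _ "trans_op a c d"] conjI ballI)
    have "subtopology (nsphere m) (N c \<inter> N d) = top_of_set (N c \<inter> N d)"
      by (rule subtopology_nsphere) (use N_sub in blast)
    then show "continuous_map (subtopology (nsphere m) (N c \<inter> N d)) end_unitary_group (trans_op a c d)"
      using continuous_map_end_unitary_group[OF trans_op(1)[OF a] trans_op(2)] by simp
  qed (rule trans_op(3))
  show "openin (nsphere m) (N c)" for c by (rule N_open)
  show "\<Union> (range N) = topspace (nsphere m)" by (rule N_cover)
  show "base_proj (E (a 0)) (sum_chart a c (x, v) 0) = x" if "x \<in> N c" for c x v by (rule base_proj_sum_chart[OF that])
qed


section \<open>Isomorphisms given by families of operators of finite propagation\<close>

text \<open>Operators in the charts that are to define an isomorphism.  A common bound for the propagation is part of the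
  notion since it yields continuity into the inductive limit.\<close>

definition unitary_family :: "nat \<Rightarrow> (hemisphere \<Rightarrow> (nat \<Rightarrow> real) \<Rightarrow> (ell2 \<Rightarrow>\<^sub>L ell2)) \<Rightarrow>
    (hemisphere \<Rightarrow> (nat \<Rightarrow> real) \<Rightarrow> (ell2 \<Rightarrow>\<^sub>L ell2)) \<Rightarrow> bool" where
  "unitary_family L T T' \<longleftrightarrow> (\<forall>c. continuous_on (N c) (T c) \<and> continuous_on (N c) (T' c) \<and>
     (\<forall>x\<in>N c. T c x \<in> finite_prop_unitaries L \<and>
       (\<forall>w. blinfun_apply (T' c x) (blinfun_apply (T c x) w) = w \<and> blinfun_apply (T c x) (blinfun_apply (T' c x) w) = w)))"

text \<open>The operators in different charts fit together to a map of completed sums.\<close>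

definition intertwines :: "(hemisphere \<Rightarrow> (nat \<Rightarrow> real) \<Rightarrow> (ell2 \<Rightarrow>\<^sub>L ell2)) \<Rightarrow> (int \<Rightarrow> int) \<Rightarrow> (int \<Rightarrow> int) \<Rightarrow> bool" where
  "intertwines T a a' \<longleftrightarrow> (\<forall>c d x w w'. x \<in> N c \<longrightarrow> x \<in> N d \<longrightarrow> sum_chart a c (x, w) = sum_chart a d (x, w') \<longrightarrow>
     sum_chart a' c (x, blinfun_apply (T c x) w) = sum_chart a' d (x, blinfun_apply (T d x) w'))"

text \<open>The operators in different charts fit together to a map to the product bundle.\<close>

definition trivializes :: "(hemisphere \<Rightarrow> (nat \<Rightarrow> real) \<Rightarrow> (ell2 \<Rightarrow>\<^sub>L ell2)) \<Rightarrow> (int \<Rightarrow> int) \<Rightarrow> bool" where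
  "trivializes T a \<longleftrightarrow> (\<forall>c d x w w'. x \<in> N c \<longrightarrow> x \<in> N d \<longrightarrow> sum_chart a c (x, w) = sum_chart a d (x, w') \<longrightarrow>
     blinfun_apply (T c x) w = blinfun_apply (T d x) w')"

lemma unitary_familyD:
  assumes "unitary_family L T T'"
  shows "continuous_on (N c) (T c)" "continuous_on (N c) (T' c)" "x \<in> N c \<Longrightarrow> T c x \<in> finite_prop_unitaries L"
    "x \<in> N c \<Longrightarrow> blinfun_apply (T' c x) (blinfun_apply (T c x) w) = w"
    "x \<in> N c \<Longrightarrow> blinfun_apply (T c x) (blinfun_apply (T' c x) w) = w"
  using assms unfolding unitary_family_def by blast+

lemma unitary_family_compose:
  assumes T: "unitary_family L T T'" and S: "unitary_family K S S'"
  shows "unitary_family (K + L) (\<lambda>c x. S c x o\<^sub>L T c x) (\<lambda>c x. T' c x o\<^sub>L S' c x)"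
  unfolding unitary_family_def
proof (intro allI conjI ballI)
  fix c
  note comp = bounded_bilinear.continuous_on[OF bounded_bilinear_blinfun_compose]
  show "continuous_on (N c) (\<lambda>x. S c x o\<^sub>L T c x)"
    by (rule comp[OF unitary_familyD(1)[OF S] unitary_familyD(1)[OF T]])
  show "continuous_on (N c) (\<lambda>x. T' c x o\<^sub>L S' c x)"
    by (rule comp[OF unitary_familyD(2)[OF T] unitary_familyD(2)[OF S]])
  fix x w assume x: "x \<in> N c"
  show "S c x o\<^sub>L T c x \<in> finite_prop_unitaries (K + L)"
    by (rule finite_prop_compose[OF unitary_familyD(3)[OF S x] unitary_familyD(3)[OF T x]])
  show "blinfun_apply (T' c x o\<^sub>L S' c x) (blinfun_apply (S c x o\<^sub>L T c x) w) = w"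
    "blinfun_apply (S c x o\<^sub>L T c x) (blinfun_apply (T' c x o\<^sub>L S' c x) w) = w"
    by (simp_all add: unitary_familyD(4,5)[OF T x] unitary_familyD(4,5)[OF S x])
qed

lemma intertwines_compose: "intertwines T a b \<Longrightarrow> intertwines S b c \<Longrightarrow> intertwines (\<lambda>c x. S c x o\<^sub>L T c x) a c"
  unfolding intertwines_def blinfun_apply_blinfun_compose o_apply by blast

lemma trivializes_compose: "intertwines T a b \<Longrightarrow> trivializes S b \<Longrightarrow> trivializes (\<lambda>c x. S c x o\<^sub>L T c x) a"
  unfolding intertwines_def trivializes_def blinfun_apply_blinfun_compose o_apply by blast

text \<open>Compatibility of the inverses: coordinates in the second chart can be computed from those in the first one,
  and charts are injective.\<close>

lemma intertwines_inverse:
  assumes T: "unitary_family L T T'" and i: "intertwines T a a'"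
  shows "intertwines T' a' a"
  unfolding intertwines_def
proof (intro allI impI)
  fix c d x w w' assume x: "x \<in> N c" "x \<in> N d" and eq: "sum_chart a' c (x, w) = sum_chart a' d (x, w')"
  let ?u = "blinfun_apply (T' c x) w" let ?u' = "blinfun_apply (trans_op a c d x) ?u"
  have u: "sum_chart a c (x, ?u) = sum_chart a d (x, ?u')" by (rule trans_op(3)) (use x in simp)
  then have "sum_chart a' c (x, blinfun_apply (T c x) ?u) = sum_chart a' d (x, blinfun_apply (T d x) ?u')"
    using i x unfolding intertwines_def by blast
  then have "sum_chart a' d (x, w') = sum_chart a' d (x, blinfun_apply (T d x) ?u')"
    using eq by (simp add: unitary_familyD(5)[OF T x(1)])
  then have "w' = blinfun_apply (T d x) ?u'" by (rule sum_chart_inj[OF x(2)])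
  then have "blinfun_apply (T' d x) w' = ?u'" by (simp add: unitary_familyD(4)[OF T x(2)])
  then show "sum_chart a c (x, ?u) = sum_chart a d (x, blinfun_apply (T' d x) w')" using u by simp
qed

text \<open>Meaningful if the values of the functions \<open>f c\<close> agree for coordinates of the same point.\<close>

definition glue :: "(int \<Rightarrow> int) \<Rightarrow> (hemisphere \<Rightarrow> (nat \<Rightarrow> real) \<Rightarrow> ell2 \<Rightarrow> 't) \<Rightarrow> (int \<Rightarrow> 'e) \<Rightarrow> 't" where
  "glue a f e = (SOME y. \<exists>c x w. x \<in> N c \<and> e = sum_chart a c (x, w) \<and> y = f c x w)"

lemma glue_eq:
  assumes f: "\<And>c d x w w'. x \<in> N c \<Longrightarrow> x \<in> N d \<Longrightarrow> sum_chart a c (x, w) = sum_chart a d (x, w') \<Longrightarrow> f c x w = f d x w'"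
    and x: "x \<in> N c"
  shows "glue a f (sum_chart a c (x, w)) = f c x w"
proof -
  have "\<exists>y. \<exists>d x' w'. x' \<in> N d \<and> sum_chart a c (x, w) = sum_chart a d (x', w') \<and> y = f d x' w'" using x by blast
  from someI_ex[OF this] obtain d x' w' where d: "x' \<in> N d" "sum_chart a c (x, w) = sum_chart a d (x', w')"
    "glue a f (sum_chart a c (x, w)) = f d x' w'" unfolding glue_def[symmetric] by blast
  have "x = x'" using base_proj_sum_chart[OF x, of a w] base_proj_sum_chart[OF d(1), of a w'] d(2) by simp
  then show ?thesis using f[OF x, of d w w'] d by simp
qed

lemma continuous_map_glue:
  assumes f: "\<And>c d x w w'. x \<in> N c \<Longrightarrow> x \<in> N d \<Longrightarrow> sum_chart a c (x, w) = sum_chart a d (x, w') \<Longrightarrow> f c x w = f d x w'"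
    and c: "\<And>c. continuous_map (top_of_set (N c \<times> UNIV)) Y (\<lambda>p. f c (fst p) (snd p))"
  shows "continuous_map (total (sum_bundle a)) Y (glue a f)"
  by (rule continuous_map_from_sum_bundle, rule continuous_map_eq[OF c]) (auto simp: glue_eq[of a f, OF f])

lemma sum_bundle_iso:
  assumes a: "a \<in> bounded_int_seqs" "a' \<in> bounded_int_seqs"
    and T: "unitary_family L T T'" and i: "intertwines T a a'"
  shows "end_bundle_iso (nsphere m) (sum_bundle a) (sum_bundle a')"
proof -
  define F where "F c x w = sum_chart a' c (x, blinfun_apply (T c x) w)" for c x w
  define F' where "F' c x w = sum_chart a c (x, blinfun_apply (T' c x) w)" for c x w
  note i' = intertwines_inverse[OF T i]
  have cF: "continuous_map (top_of_set (N c \<times> UNIV)) (total (sum_bundle a')) (\<lambda>p. F c (fst p) (snd p))" for c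
    using continuous_map_compose[OF continuous_map_action[OF unitary_familyD(1)[OF T, of c]] continuous_map_sum_chart[of c a']]
    unfolding F_def by (simp only: o_def)
  have cF': "continuous_map (top_of_set (N c \<times> UNIV)) (total (sum_bundle a)) (\<lambda>p. F' c (fst p) (snd p))" for c
    using continuous_map_compose[OF continuous_map_action[OF unitary_familyD(2)[OF T, of c]] continuous_map_sum_chart[of c a]]
    unfolding F'_def by (simp only: o_def)
  have F: "F c x w = F d x w'" if "x \<in> N c" "x \<in> N d" "sum_chart a c (x, w) = sum_chart a d (x, w')" for c d x w w'
    using i that unfolding intertwines_def F_def by blast
  have F': "F' c x w = F' d x w'" if "x \<in> N c" "x \<in> N d" "sum_chart a' c (x, w) = sum_chart a' d (x, w')" for c d x w w'
    using i' that unfolding intertwines_def F'_def by blast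
  define h where "h = glue a F"
  define h' where "h' = glue a' F'"
  have h: "h (sum_chart a c (x, w)) = sum_chart a' c (x, blinfun_apply (T c x) w)" if "x \<in> N c" for c x w
    unfolding h_def by (rule trans[OF glue_eq[of a F, OF F that] F_def])
  have h': "h' (sum_chart a' c (x, w)) = sum_chart a c (x, blinfun_apply (T' c x) w)" if "x \<in> N c" for c x w
    unfolding h'_def by (rule trans[OF glue_eq[of a' F', OF F' that] F'_def])
  have hc: "continuous_map (total (sum_bundle a)) (total (sum_bundle a')) h"
    unfolding h_def by (rule continuous_map_glue[of a F, OF F cF])
  have h'c: "continuous_map (total (sum_bundle a')) (total (sum_bundle a)) h'"
    unfolding h'_def by (rule continuous_map_glue[of a' F', OF F' cF'])
  have "homeomorphic_maps (total (sum_bundle a)) (total (sum_bundle a')) h h'"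
    unfolding homeomorphic_maps_def topspace_sum_bundle
  proof (intro conjI hc h'c ballI)
    fix e assume "e \<in> sum_total a"
    then obtain c x w where x: "x \<in> N c" and e: "e = sum_chart a c (x, w)" unfolding sum_total_iff by blast
    show "h' (h e) = e" unfolding e h[OF x] h'[OF x] unitary_familyD(4)[OF T x] ..
  next
    fix e assume "e \<in> sum_total a'"
    then obtain c x w where x: "x \<in> N c" and e: "e = sum_chart a' c (x, w)" unfolding sum_total_iff by blast
    show "h (h' e) = e" unfolding e h[OF x] h'[OF x] unitary_familyD(5)[OF T x] ..
  qed
  then have hom: "homeomorphic_map (total (sum_bundle a)) (total (sum_bundle a')) h" by (rule homeomorphic_maps_imp_map)
  show ?thesis
    unfolding bundle_iso_def
  proof (intro conjI bundle_sum_bundle a exI[of _ h] hom ballI allI)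
    fix e assume "e \<in> topspace (total (sum_bundle a))"
    then obtain c x w where "x \<in> N c" "e = sum_chart a c (x, w)" unfolding topspace_sum_bundle sum_total_iff by blast
    then show "base_proj (sum_bundle a') (h e) = base_proj (sum_bundle a) e" by (simp add: h sum_bundle_simps base_proj_sum_chart)
  next
    fix c d
    let ?g = "\<lambda>x. trans_op a' c d x o\<^sub>L T c x"
    have "subtopology (nsphere m) (N c \<inter> N d) = top_of_set (N c \<inter> N d)"
      by (rule subtopology_nsphere) (use N_sub in blast)
    moreover have "continuous_map (top_of_set (N c \<inter> N d)) end_unitary_group ?g"
    proof (rule continuous_map_end_unitary_group)
      show "continuous_on (N c \<inter> N d) ?g"
        by (rule bounded_bilinear.continuous_on[OF bounded_bilinear_blinfun_compose trans_op(1)[OF a(2)]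
            continuous_on_subset[OF unitary_familyD(1)[OF T]]]) blast
      show "?g x \<in> finite_prop_unitaries (m + L)" if "x \<in> N c \<inter> N d" for x
        by (rule finite_prop_compose[OF trans_op(2)[OF that] unitary_familyD(3)[OF T]]) (use that in blast)
    qed
    moreover have "h (sum_chart a c (x, v)) = sum_chart a' d (x, blinfun_apply (?g x) v)" if "x \<in> N c \<inter> N d" for x v
    proof -
      have "x \<in> N c" using that by blast
      then show ?thesis using trans_op(3)[OF that, of a' "blinfun_apply (T c x) v"] by (simp add: h)
    qed
    ultimately show "\<exists>g. continuous_map (subtopology (nsphere m) (chart_dom (sum_bundle a) c \<inter> chart_dom (sum_bundle a') d)) end_unitary_group g \<and>
           (\<forall>x\<in>chart_dom (sum_bundle a) c \<inter> chart_dom (sum_bundle a') d. \<forall>v\<in>topspace euclidean.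
               h (chart (sum_bundle a) c (x, v)) = chart (sum_bundle a') d (x, blinfun_apply (g x) v))"
      unfolding sum_bundle_simps by (intro exI[of _ ?g]) simp
  qed
qed

lemma bundle_product: "bundle_with_end (nsphere m) (product_bundle (nsphere m) euclidean)"
proof -
  have "continuous_map (nsphere m) end_unitary_group (\<lambda>_. id_blinfun)"
    using continuous_map_end_unitary_group[of "topspace (nsphere m)" "\<lambda>_. id_blinfun" 0] id_finite_prop
    by (simp flip: nsphere_eq)
  moreover have "subtopology (prod_topology (nsphere m) (euclidean :: ell2 topology)) (topspace (nsphere m) \<times> UNIV) = prod_topology (nsphere m) euclidean"
    using subtopology_topspace[of "prod_topology (nsphere m) (euclidean :: ell2 topology)"] by simp
  moreover have "{e. e \<in> topspace (nsphere m) \<times> (UNIV :: ell2 set) \<and> fst e \<in> topspace (nsphere m)} = topspace (nsphere m) \<times> UNIV"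
    by auto
  ultimately show ?thesis
    unfolding fibre_bundle_def product_bundle_def
    by (auto simp: continuous_map_fst homeomorphic_map_id[unfolded id_def] intro!: exI[of _ "\<lambda>_. id_blinfun"])
qed

text \<open>The inverse, defined on the product, is continuous since it is so over each of the open sets \<open>N c\<close>.\<close>

lemma sum_bundle_trivial:
  assumes a: "a \<in> bounded_int_seqs" and T: "unitary_family L T T'" and t: "trivializes T a"
  shows "end_bundle_trivial (nsphere m) (sum_bundle a)"
proof -
  let ?P = "prod_topology (nsphere m) (euclidean :: ell2 topology)"
  define F where "F c x w = (x, blinfun_apply (T c x) w)" for c x w
  let ?g = "\<lambda>c p. sum_chart a c (fst p, blinfun_apply (T' c (fst p)) (snd p))"
  have sub: "subtopology ?P (N c \<times> UNIV) = top_of_set (N c \<times> UNIV)" for c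
    using prod_nsphere[OF N_sub, of c] subtopology_Times[of "nsphere m" "euclidean :: ell2 topology" "N c" UNIV] by simp
  have F: "F c x w = F d x w'" if "x \<in> N c" "x \<in> N d" "sum_chart a c (x, w) = sum_chart a d (x, w')" for c d x w w'
    using t that unfolding trivializes_def F_def prod.inject by blast
  define h where "h = glue a F"
  have h: "h (sum_chart a c (x, w)) = (x, blinfun_apply (T c x) w)" if "x \<in> N c" for c x w
    unfolding h_def by (rule trans[OF glue_eq[of a F, OF F that] F_def])
  have "continuous_map (top_of_set (N c \<times> UNIV)) (subtopology ?P (N c \<times> UNIV)) (\<lambda>p. F c (fst p) (snd p))" for c
    unfolding sub F_def by (rule continuous_map_action[OF unitary_familyD(1)[OF T]])
  then have cF: "continuous_map (top_of_set (N c \<times> UNIV)) ?P (\<lambda>p. F c (fst p) (snd p))" for c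
    by (rule continuous_map_into_fulltopology)
  have hc: "continuous_map (total (sum_bundle a)) ?P h"
    unfolding h_def by (rule continuous_map_glue[of a F, OF F cF])
  have gg: "?g c (x, w) = ?g d (x, w)" if x: "x \<in> N c" "x \<in> N d" for c d x w
  proof -
    let ?u = "blinfun_apply (T' c x) w"
    have u: "sum_chart a c (x, ?u) = sum_chart a d (x, blinfun_apply (trans_op a c d x) ?u)" by (rule trans_op(3)) (use x in simp)
    then have "blinfun_apply (T c x) ?u = blinfun_apply (T d x) (blinfun_apply (trans_op a c d x) ?u)"
      using t x unfolding trivializes_def by blast
    then have "blinfun_apply (trans_op a c d x) ?u = blinfun_apply (T' d x) w"
      using unitary_familyD(4)[OF T x(2)] unitary_familyD(5)[OF T x(1)] by metis
    then show ?thesis using u by simp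
  qed
  define pick where "pick x = (SOME c. x \<in> N c)" for x
  have pick: "x \<in> N (pick x)" if "x \<in> topspace (nsphere m)" for x
  proof -
    have "\<exists>c. x \<in> N c" using that N_cover by blast
    then show ?thesis unfolding pick_def by (rule someI_ex)
  qed
  define h' where "h' p = ?g (pick (fst p)) p" for p
  have h': "h' (x, w) = sum_chart a c (x, blinfun_apply (T' c x) w)" if x: "x \<in> N c" for c x w
    using gg[OF pick x] N_sub x by (auto simp: h'_def)
  have h'c: "continuous_map ?P (total (sum_bundle a)) h'"
  proof (rule pasting_lemma[where I = UNIV and T = "\<lambda>c. N c \<times> UNIV" and f = ?g])
    show "openin ?P (N c \<times> UNIV)" for c using N_open by (simp add: openin_prod_Times_iff)
    show "continuous_map (subtopology ?P (N c \<times> UNIV)) (total (sum_bundle a)) (?g c)" for c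
      unfolding sub
      using continuous_map_compose[OF continuous_map_action[OF unitary_familyD(2)[OF T]] continuous_map_sum_chart[of c a]]
      by (simp only: o_def)
    show "?g c p = ?g d p" if "p \<in> topspace ?P \<inter> N c \<times> UNIV \<inter> N d \<times> UNIV" for c d p
      using gg[of "fst p" c d "snd p"] that by auto
    show "\<exists>c. c \<in> UNIV \<and> p \<in> N c \<times> UNIV \<and> h' p = ?g c p" if "p \<in> topspace ?P" for p
      using that pick by (intro exI[of _ "pick (fst p)"]) (auto simp: h'_def mem_Times_iff)
  qed
  have "homeomorphic_maps (total (sum_bundle a)) ?P h h'"
    unfolding homeomorphic_maps_def topspace_sum_bundle
  proof (intro conjI hc h'c ballI)
    fix e assume "e \<in> sum_total a"
    then obtain c x w where x: "x \<in> N c" and e: "e = sum_chart a c (x, w)" unfolding sum_total_iff by blast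
    show "h' (h e) = e" unfolding e h[OF x] h'[OF x] unitary_familyD(4)[OF T x] ..
  next
    fix p assume p: "p \<in> topspace ?P"
    then have x: "fst p \<in> N (pick (fst p))" using pick by (simp add: mem_Times_iff)
    have "h (h' (fst p, snd p)) = (fst p, snd p)"
      unfolding h'[OF x] h[OF x] by (simp add: unitary_familyD(5)[OF T x])
    then show "h (h' p) = p" by simp
  qed
  then have hom: "homeomorphic_map (total (sum_bundle a)) ?P h" by (rule homeomorphic_maps_imp_map)
  have pb: "total (product_bundle (nsphere m) (euclidean :: ell2 topology)) = ?P"
     "base_proj (product_bundle (nsphere m) (euclidean :: ell2 topology)) = fst"
     "chart_dom (product_bundle (nsphere m) (euclidean :: ell2 topology)) d = topspace (nsphere m)"
     "chart (product_bundle (nsphere m) (euclidean :: ell2 topology)) d p = p" for d p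
    by (simp_all add: product_bundle_def)
  show ?thesis
    unfolding end_bundle_trivial_def bundle_iso_def pb
  proof (intro conjI bundle_sum_bundle a bundle_product exI[of _ h] hom ballI allI)
    fix e assume "e \<in> topspace (total (sum_bundle a))"
    then obtain c x w where "x \<in> N c" "e = sum_chart a c (x, w)" unfolding topspace_sum_bundle sum_total_iff by blast
    then show "fst (h e) = base_proj (sum_bundle a) e" by (simp add: h sum_bundle_simps base_proj_sum_chart)
  next
    fix c and d :: unit
    have "N c \<inter> topspace (nsphere m) = N c" using N_sub by blast
    moreover have "continuous_map (subtopology (nsphere m) (N c)) end_unitary_group (T c)"
      unfolding subtopology_nsphere[OF N_sub]
      by (rule continuous_map_end_unitary_group[OF unitary_familyD(1)[OF T] unitary_familyD(3)[OF T]])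
    ultimately show "\<exists>g. continuous_map (subtopology (nsphere m) (chart_dom (sum_bundle a) c \<inter> topspace (nsphere m))) end_unitary_group g \<and>
           (\<forall>x\<in>chart_dom (sum_bundle a) c \<inter> topspace (nsphere m). \<forall>v\<in>topspace euclidean.
               h (chart (sum_bundle a) c (x, v)) = (x, blinfun_apply (g x) v))"
      unfolding sum_bundle_simps by (intro exI[of _ "T c"]) (simp add: h)
  qed
qed


section \<open>The swindle\<close>

lemma adjoint_matrix_continuous:
  assumes "\<And>k l. k < r \<Longrightarrow> l < r \<Longrightarrow> continuous_on S (\<lambda>x. M x k l)" "k < r" "l < r"
  shows "continuous_on S (\<lambda>x. adjoint_matrix r (M x) k l)"
  using assms by (simp add: adjoint_matrix_def continuous_on_cnj)

lemma unitary_family_block_op: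
  fixes M :: "'k \<Rightarrow> hemisphere \<Rightarrow> (nat \<Rightarrow> real) \<Rightarrow> nat \<Rightarrow> nat \<Rightarrow> complex"
  assumes r: "r \<ge> 1" and K: "finite K" "\<And>b. key b \<in> K"
    and c: "\<And>\<kappa> c k l. \<kappa> \<in> K \<Longrightarrow> k < r \<Longrightarrow> l < r \<Longrightarrow> continuous_on (N c) (\<lambda>x. M \<kappa> c x k l)"
    and u: "\<And>\<kappa> c x. \<kappa> \<in> K \<Longrightarrow> x \<in> N c \<Longrightarrow> M \<kappa> c x \<in> unitary_matrices r"
  shows "unitary_family r (\<lambda>c x. block_op r ofs (\<lambda>b. M (key b) c x)) (\<lambda>c x. block_op r ofs (\<lambda>b. adjoint_matrix r (M (key b) c x)))"
  unfolding unitary_family_def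
proof (intro allI conjI ballI)
  fix c
  show "continuous_on (N c) (\<lambda>x. block_op r ofs (\<lambda>b. M (key b) c x))"
    by (rule continuous_on_block_op[where M = "\<lambda>\<kappa>. M \<kappa> c", OF r K]) (simp_all add: c u)
  show "continuous_on (N c) (\<lambda>x. block_op r ofs (\<lambda>b. adjoint_matrix r (M (key b) c x)))"
    by (rule continuous_on_block_op[where M = "\<lambda>\<kappa> x. adjoint_matrix r (M \<kappa> c x)", OF r K])
       (simp_all add: adjoint_matrix_continuous c adjoint_matrix_unitary u)
  fix x w assume x: "x \<in> N c"
  note ux = u[OF K(2) x]
  show "block_op r ofs (\<lambda>b. M (key b) c x) \<in> finite_prop_unitaries r" by (rule block_op_finite_prop[OF r ux])
  show "blinfun_apply (block_op r ofs (\<lambda>b. adjoint_matrix r (M (key b) c x))) (blinfun_apply (block_op r ofs (\<lambda>b. M (key b) c x)) w) = w"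
    "blinfun_apply (block_op r ofs (\<lambda>b. M (key b) c x)) (blinfun_apply (block_op r ofs (\<lambda>b. adjoint_matrix r (M (key b) c x))) w) = w"
    by (rule block_op_inverse[OF r ux])+
qed

lemma block_pair:
  "vfst m (block (m + m) (int m * e) w b) = block m 0 w (2 * b + e)"
  "vsnd m (block (m + m) (int m * e) w b) = block m 0 w (2 * b + e + 1)"
  by (auto simp: vfst_def vsnd_def block_def fun_eq_iff algebra_simps)

text \<open>Applying the isometries of pairs to all pairs of neighbours simultaneously.  Since the sequences are
  bounded, only finitely many different isometries occur.\<close>

lemma pair_step:
  assumes a: "a \<in> bounded_int_seqs" "a' \<in> bounded_int_seqs"
    and eq: "\<And>b. a (2 * b + e) + a (2 * b + e + 1) = a' (2 * b + e) + a' (2 * b + e + 1)"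
  shows "\<exists>T T'. unitary_family (m + m) T T' \<and> intertwines T a a'"
proof -
  define K where "K = {(p, p2, k, k2). (p, p2, k, k2) \<in> range a \<times> range a \<times> range a' \<times> range a' \<and> p + p2 = k + k2}"
  have K: "finite K"
    by (rule finite_subset[of _ "range a \<times> range a \<times> range a' \<times> range a'"])
       (auto simp: K_def bounded_int_seqs_finite_range a)
  define key where "key b = (a (2 * b + e), a (2 * b + e + 1), a' (2 * b + e), a' (2 * b + e + 1))" for b
  have key: "key b \<in> K" for b using eq by (simp add: K_def key_def)
  have "\<forall>\<kappa>\<in>K. \<exists>M. case \<kappa> of (p, p2, k, k2) \<Rightarrow> pair_isometry p p2 k k2 M"
    unfolding K_def using pair_isometries by simp
  from bchoice[OF this] obtain M where M: "\<forall>\<kappa>\<in>K. case \<kappa> of (p, p2, k, k2) \<Rightarrow> pair_isometry p p2 k k2 (M \<kappa>)"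
    by blast
  have cM: "continuous_on (N c) (\<lambda>s. M \<kappa> c s i j)" if "\<kappa> \<in> K" "i < m + m" "j < m + m" for \<kappa> c i j
    using bspec[OF M that(1)] that(2,3) by (auto simp: pair_isometry_def split: prod.splits)
  have uM: "M \<kappa> c s \<in> unitary_matrices (m + m)" if "\<kappa> \<in> K" "s \<in> N c" for \<kappa> c s
    using bspec[OF M that(1)] that(2) by (auto simp: pair_isometry_def split: prod.splits)
  have iM: "chart (E (a' (2 * b + e))) c (s, vfst m (matrix_act (m + m) (M (key b) c s) y)) =
       chart (E (a' (2 * b + e))) d (s, vfst m (matrix_act (m + m) (M (key b) d s) y')) \<and>
       chart (E (a' (2 * b + e + 1))) c (s, vsnd m (matrix_act (m + m) (M (key b) c s) y)) =
       chart (E (a' (2 * b + e + 1))) d (s, vsnd m (matrix_act (m + m) (M (key b) d s) y'))"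
    if "s \<in> N c" "s \<in> N d" "chart (E (a (2 * b + e))) c (s, vfst m y) = chart (E (a (2 * b + e))) d (s, vfst m y')"
      "chart (E (a (2 * b + e + 1))) c (s, vsnd m y) = chart (E (a (2 * b + e + 1))) d (s, vsnd m y')" for b c d s y y'
    using bspec[OF M key[of b], unfolded key_def prod.case pair_isometry_def, folded key_def] that by blast
  have r: "m + m \<ge> 1" using m by simp
  let ?T = "\<lambda>c x. block_op (m + m) (int m * e) (\<lambda>b. M (key b) c x)"
  have "unitary_family (m + m) ?T (\<lambda>c x. block_op (m + m) (int m * e) (\<lambda>b. adjoint_matrix (m + m) (M (key b) c x)))"
    by (rule unitary_family_block_op[OF r K key cM uM])
  moreover have "intertwines ?T a a'"
    unfolding intertwines_def
  proof (intro allI impI)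
    fix c d x w w' assume x: "x \<in> N c" "x \<in> N d" and w: "sum_chart a c (x, w) = sum_chart a d (x, w')"
    have B: "block (m + m) (int m * e) (blinfun_apply (?T c x) w) b = matrix_act (m + m) (M (key b) c x) (block (m + m) (int m * e) w b)"
      if "x \<in> N c" for c w b
      by (rule block_op_block_unitary[OF r uM[OF key that]])
    have *: "chart (E (a' (2 * b + e))) c (x, block m 0 (blinfun_apply (?T c x) w) (2 * b + e)) =
        chart (E (a' (2 * b + e))) d (x, block m 0 (blinfun_apply (?T d x) w') (2 * b + e)) \<and>
        chart (E (a' (2 * b + e + 1))) c (x, block m 0 (blinfun_apply (?T c x) w) (2 * b + e + 1)) =
        chart (E (a' (2 * b + e + 1))) d (x, block m 0 (blinfun_apply (?T d x) w') (2 * b + e + 1))" for b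
      unfolding block_pair[symmetric] B[OF x(1)] B[OF x(2)]
      by (rule iM[OF x]) (use w in \<open>simp_all add: sum_chart_eq_iff block_pair\<close>)
    show "sum_chart a' c (x, blinfun_apply (?T c x) w) = sum_chart a' d (x, blinfun_apply (?T d x) w')"
      unfolding sum_chart_eq_iff
    proof
      fix i :: int
      have "i = 2 * ((i - e) div 2) + e \<or> i = 2 * ((i - e) div 2) + e + 1" by presburger
      then show "chart (E (a' i)) c (x, block m 0 (blinfun_apply (?T c x) w) i) = chart (E (a' i)) d (x, block m 0 (blinfun_apply (?T d x) w') i)"
        using *[of "(i - e) div 2"] by metis
    qed
  qed
  ultimately show ?thesis by blast
qed

text \<open>The pairs beginning at even indices and then those beginning at odd indices: the surplus \<open>D i\<close> is moved from the
  summand \<open>i + 1\<close> to the summand \<open>i\<close>.\<close>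

lemma swindle:
  assumes a: "a \<in> bounded_int_seqs" "a' \<in> bounded_int_seqs" and fin: "finite {i. a i \<noteq> a' i}"
  shows "\<exists>L T T'. unitary_family L T T' \<and> intertwines T a a'"
proof -
  let ?S = "{i. a i \<noteq> a' i}"
  define D where "D i = (\<Sum>j\<in>?S \<inter> {..i}. a' j - a j)" for i
  have D: "D i = D (i - 1) + (a' i - a i)" for i
  proof (cases "i \<in> ?S")
    case True
    then have "?S \<inter> {..i} = insert i (?S \<inter> {..i - 1})" by force
    moreover have "finite (?S \<inter> {..i - 1})" using fin by blast
    moreover have "i \<notin> ?S \<inter> {..i - 1}" by simp
    ultimately show ?thesis unfolding D_def by (simp only: sum.insert) simp
  next
    case False
    then have "?S \<inter> {..i} = ?S \<inter> {..i - 1}" by (force simp: order.order_iff_strict)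
    then show ?thesis using False by (simp add: D_def)
  qed
  define C where "C = (\<Sum>j\<in>?S. \<bar>a' j - a j\<bar>)"
  \<comment> \<open>Far to the right \<open>D\<close> is constant, but not zero in general: the change is not cancelled but moved to infinity.\<close>
  have DC: "\<bar>D i\<bar> \<le> C" for i
  proof -
    have "\<bar>D i\<bar> \<le> (\<Sum>j\<in>?S \<inter> {..i}. \<bar>a' j - a j\<bar>)" unfolding D_def by (rule sum_abs)
    also have "\<dots> \<le> C" unfolding C_def by (rule sum_mono2) (use fin in auto)
    finally show ?thesis .
  qed
  \<comment> \<open>The sequence between the two steps, when only the transfers from odd to even indices have been made.\<close>
  define b where "b i = (if even i then a i + D i else a i - D (i - 1))" for i
  have b: "b \<in> bounded_int_seqs"
  proof -
    obtain A where A: "\<And>i. \<bar>a i\<bar> \<le> A" using a(1) by (auto simp: bounded_int_seqs_def)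
    have "\<bar>b i\<bar> \<le> A + C" for i using A[of i] DC[of i] DC[of "i - 1"] by (auto simp: b_def)
    then show ?thesis by (auto simp: bounded_int_seqs_def)
  qed
  have "a (2 * j + 0) + a (2 * j + 0 + 1) = b (2 * j + 0) + b (2 * j + 0 + 1)" for j
    by (simp add: b_def)
  from pair_step[OF a(1) b this] obtain T T' where T: "unitary_family (m + m) T T'" "intertwines T a b" by blast
  have "b (2 * j + 1) + b (2 * j + 1 + 1) = a' (2 * j + 1) + a' (2 * j + 1 + 1)" for j
  proof -
    have "b (2 * j + 1) = a (2 * j + 1) - D (2 * j)" "b (2 * j + 1 + 1) = a (2 * j + 1 + 1) + D (2 * j + 1 + 1)"
      by (simp_all add: b_def)
    moreover have "D (2 * j + 1) = D (2 * j) + (a' (2 * j + 1) - a (2 * j + 1))"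
      "D (2 * j + 1 + 1) = D (2 * j + 1) + (a' (2 * j + 1 + 1) - a (2 * j + 1 + 1))"
      using D[of "2 * j + 1"] D[of "2 * j + 1 + 1"] by (simp_all only: add_diff_cancel_right')
    ultimately show ?thesis by linarith
  qed
  from pair_step[OF b a(2) this] obtain S S' where S: "unitary_family (m + m) S S'" "intertwines S b a'" by blast
  show ?thesis
    using unitary_family_compose[OF T(1) S(1)] intertwines_compose[OF T(2) S(2)] by blast
qed

lemma zero_trivial: "\<exists>T T'. unitary_family m T T' \<and> trivializes T (\<lambda>_. 0)"
proof -
  obtain M where M: "\<And>c i j. i < m \<Longrightarrow> j < m \<Longrightarrow> continuous_on (N c) (\<lambda>s. M c s i j)"
      "\<And>c s. s \<in> N c \<Longrightarrow> M c s \<in> unitary_matrices m"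
    and t: "\<And>c d s y y'. s \<in> N c \<Longrightarrow> s \<in> N d \<Longrightarrow> y \<in> cspace m \<Longrightarrow> y' \<in> cspace m \<Longrightarrow>
       chart (E 0) c (s, y) = chart (E 0) d (s, y') \<Longrightarrow> matrix_act m (M c s) y = matrix_act m (M d s) y'"
    using zero_isometries by blast
  let ?T = "\<lambda>c x. block_op m 0 (\<lambda>_. M c x)"
  have "unitary_family m ?T (\<lambda>c x. block_op m 0 (\<lambda>_. adjoint_matrix m (M c x)))"
    by (rule unitary_family_block_op[OF m, of "UNIV :: unit set" "\<lambda>_. ()" "\<lambda>_. M"]) (simp_all add: M)
  moreover have "trivializes ?T (\<lambda>_. 0)"
    unfolding trivializes_def
  proof (intro allI impI)
    fix c d x w w' assume x: "x \<in> N c" "x \<in> N d" and w: "sum_chart (\<lambda>_. 0) c (x, w) = sum_chart (\<lambda>_. 0) d (x, w')"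
    show "blinfun_apply (?T c x) w = blinfun_apply (?T d x) w'"
    proof (rule block_eqI[OF m])
      show "block m 0 (blinfun_apply (?T c x) w) b = block m 0 (blinfun_apply (?T d x) w') b" for b
        unfolding block_op_block_unitary[OF m M(2)[OF x(1)]] block_op_block_unitary[OF m M(2)[OF x(2)]]
        by (rule t[OF x block_cspace block_cspace]) (use w in \<open>simp add: sum_chart_eq_iff\<close>)
    qed
  qed
  ultimately show ?thesis by blast
qed

lemma sum_bundle_iso_finite_change:
  assumes "a \<in> bounded_int_seqs" "a' \<in> bounded_int_seqs" "finite {i. a i \<noteq> a' i}"
  shows "end_bundle_iso (nsphere m) (sum_bundle a) (sum_bundle a')"
  using swindle[OF assms] sum_bundle_iso[OF assms(1,2)] by blast

lemma sum_bundle_trivial_finite_support: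
  assumes a: "a \<in> bounded_int_seqs" and fin: "finite {i. a i \<noteq> 0}"
  shows "end_bundle_trivial (nsphere m) (sum_bundle a)"
proof -
  have "(\<lambda>_. 0) \<in> bounded_int_seqs" by (auto simp: bounded_int_seqs_def)
  then obtain L T T' where T: "unitary_family L T T'" "intertwines T a (\<lambda>_. 0)" using swindle[OF a _ fin] by blast
  obtain S S' where S: "unitary_family m S S'" "trivializes S (\<lambda>_. 0)" using zero_trivial by blast
  show ?thesis
    by (rule sum_bundle_trivial[OF a unitary_family_compose[OF T(1) S(1)] trivializes_compose[OF T(2) S(2)]])
qed

end

theorem proposition4p5:
  fixes n :: nat
    and E :: "int \<Rightarrow> (hemisphere, nat \<Rightarrow> real, 'e, nat \<Rightarrow> complex) gbundle"
    and N :: "hemisphere \<Rightarrow> (nat \<Rightarrow> real) set"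
    and \<iota> :: "int \<Rightarrow> ((nat \<Rightarrow> real) \<Rightarrow> (nat \<Rightarrow> complex) set) set"
    and b0 :: "(nat \<Rightarrow> complex) set"
    and s0 :: "nat \<Rightarrow> real"
    and q :: "(nat \<Rightarrow> real) \<Rightarrow> (nat \<Rightarrow> real)"
  assumes n: "n \<ge> 1"
    and cover: "\<And>c. openin (nsphere (2 * n)) (N c) \<and> hemisphere_set (2 * n) c \<subseteq> N c"
    and E: "\<And>k. hermitian_bundle (2 * n) (nsphere (2 * n)) (E k)"
    and E_cover: "\<And>k c. chart_dom (E k) c = N c"
    and b0: "b0 \<in> topspace (BU (2 * n))"
    and s0: "s0 \<in> topspace (nsphere (2 * n))"
    and q: "cube_collapse (2 * n) s0 q"
    and \<iota>: "\<iota> \<in> iso integer_group (homotopy_group (2 * n) (BU (2 * n)) b0)"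
    and E_class: "\<And>k. \<exists>f. classified_by (2 * n) (nsphere (2 * n)) (E k) f \<and> f s0 = b0 \<and> f \<circ> q \<in> \<iota> k"
  shows "(\<forall>a\<in>bounded_int_seqs. \<forall>a'\<in>bounded_int_seqs. finite {i. a i \<noteq> a' i} \<longrightarrow>
            end_bundle_iso (nsphere (2 * n))
              (completed_sum (2 * n) (nsphere (2 * n)) N E a)
              (completed_sum (2 * n) (nsphere (2 * n)) N E a')) \<and>
         (\<forall>a\<in>bounded_int_seqs. finite {i. a i \<noteq> 0} \<longrightarrow>
            end_bundle_trivial (nsphere (2 * n))
              (completed_sum (2 * n) (nsphere (2 * n)) N E a))"
proof -
  have "(\<Union>c. N c) = topspace (nsphere (2 * n))"
  proof
    show "(\<Union>c. N c) \<subseteq> topspace (nsphere (2 * n))" using cover openin_subset by blast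
    show "topspace (nsphere (2 * n)) \<subseteq> (\<Union>c. N c)"
    proof
      fix x assume "x \<in> topspace (nsphere (2 * n))"
      then have "x \<in> hemisphere_set (2 * n) Upper \<or> x \<in> hemisphere_set (2 * n) Lower" by auto
      then show "x \<in> (\<Union>c. N c)" using cover by blast
    qed
  qed
  then interpret classified_bundles "2 * n" E N \<iota> b0 s0 q
    by unfold_locales (use assms in auto)
  show ?thesis
    by (intro conjI ballI impI sum_bundle_iso_finite_change sum_bundle_trivial_finite_support)
qed

end
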